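(* Let $r_{k,\mathrm{diag}}(z)=r_k(z,z)$. \begin{enumerate} \item[(i)] Let $\mathcal K\subseteq\mathcal D$ be a compact set of positive area. Then for any $p\ge2$, $$\mathbb E\big[\|h_k\|_{p,\mathcal K}\big]=\big\|\sqrt{r_{k,\mathrm{diag}}}\big\|_{p,\mathcal K}\sqrt N\Bigg(\frac{\Gamma(\frac p2+1)\Gamma(\frac{2N-1}{2})}{\Gamma(\frac{p+2N-1}{2})}\Bigg)^{1/p}+O_{\mathcal K}\Big(\frac{\sqrt p}{k^{1/p}}\Big).$$ \item[(ii)] For any $p\ge2$, $$\mathbb E\big[\|h_k\|_{p,\mathcal D}\big]=\big\|\sqrt{r_{k,\mathrm{diag}}}\big\|_{p,\mathcal D}\sqrt N\Bigg(\frac{\Gamma(\frac p2+1)\Gamma(\frac{2N-1}{2})}{\Gamma(\frac{p+2N-1}{2})}\Bigg)^{1/p}+O\big(k^{\frac14-\frac3{2p}}\sqrt p\big).$$ \end{enumerate}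
   Context: For even $k\ge 2$, let $\mathcal S_k$ be the space of weight-$k$ cusp forms for $\mathrm{SL}_2(\mathbb Z)$, viewed as holomorphic functions on $\mathbb H^2=\{z=x+iy:\ y>0\}$, and $N=N_k=\dim\mathcal S_k$ (so $N_k=k/12+O(1)$); only $k$ with $N\ge1$ are considered. Let $\mathcal D=\{z\in\mathbb H^2:\ |\Re z|\le 1/2,\ |z|\ge 1\}$. The Petersson inner product is $\langle f,g\rangle=\int_{\mathcal D} f\bar g\,y^k\,\frac{dx\,dy}{y^2}$. With $f_1,\dots,f_N$ an orthonormal basis of $\mathcal S_k$, the random cusp form is $g_k=\sum_{j=1}^N a_jf_j$ with $(a_1,\dots,a_N)$ uniform on the unit sphere $\{\sum_j|a_j|^2=1\}\subset\mathbb C^N$, $h_k(z)=y^{k/2}g_k(z)$, and $r_k(z,w)=\mathbb E[h_k(z)\overline{h_k(w)}]=\frac1N\sum_{j}y^{k/2}f_j(z)v^{k/2}\overline{f_j(w)}$ for $w=u+iv$. For a function $F$ on $\mathcal D$, a subset $\mathcal D'\subseteq\mathcal D$ and $p\ge1$, $\|F\|_{p,\mathcal D'}=\big(\int_{\mathcal D'}|F(z)|^p\frac{dx\,dy}{y^2}\big)^{1/p}$. *)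

theory Defs
  imports "HOL-Probability.Probability" "HOL-Complex_Analysis.Complex_Analysis"
    "HOL-Library.Function_Algebras"
begin

definition upper_half_plane :: "complex set" where
  "upper_half_plane = {z. Im z > 0}"

definition fund_domain :: "complex set" where
  "fund_domain = {z \<in> upper_half_plane. \<bar>Re z\<bar> \<le> 1/2 \<and> cmod z \<ge> 1}"

definition hyp_area :: "complex measure" where
  "hyp_area = density lborel (\<lambda>z. indicator upper_half_plane z * ennreal (1 / (Im z)\<^sup>2))"

text \<open>Functions on the upper half plane are represented by total functions
  vanishing outside of it, so that the space of cusp forms is a genuine finite-dimensional space of functions.\<close>

definition cusp_forms :: "nat \<Rightarrow> (complex \<Rightarrow> complex) set" where
  "cusp_forms k = {f.
     f holomorphic_on upper_half_plane \<and>
     (\<forall>z. z \<notin> upper_half_plane \<longrightarrow> f z = 0) \<and>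
     (\<forall>a b c d :: int. a * d - b * c = 1 \<longrightarrow>
        (\<forall>z \<in> upper_half_plane.
           f ((of_int a * z + of_int b) / (of_int c * z + of_int d))
             = (of_int c * z + of_int d) ^ k * f z)) \<and>
     (\<exists>q :: nat \<Rightarrow> complex. q 0 = 0 \<and>
        (\<forall>z \<in> upper_half_plane.
           (\<lambda>n. q n * exp (2 * of_real pi * \<i> * of_nat n * z)) sums f z))}"

interpretation cfun: vector_space "\<lambda>(c::complex) (f :: complex \<Rightarrow> complex) z. c * f z"
  by unfold_locales (auto simp: fun_eq_iff algebra_simps)

definition cusp_dim :: "nat \<Rightarrow> nat" where
  "cusp_dim k = cfun.dim (cusp_forms k)"

definition petersson :: "nat \<Rightarrow> (complex \<Rightarrow> complex) \<Rightarrow> (complex \<Rightarrow> complex) \<Rightarrow> complex" where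
  "petersson k f g = (LINT z:fund_domain|hyp_area. f z * cnj (g z) * of_real (Im z ^ k))"

definition orthonormal_basis :: "nat \<Rightarrow> (nat \<Rightarrow> complex \<Rightarrow> complex) \<Rightarrow> bool" where
  "orthonormal_basis k f \<longleftrightarrow>
     (\<forall>j < cusp_dim k. f j \<in> cusp_forms k) \<and>
     cfun.span (f ` {..<cusp_dim k}) = cusp_forms k \<and>
     (\<forall>i < cusp_dim k. \<forall>j < cusp_dim k. petersson k (f i) (f j) = (if i = j then 1 else 0))"

text \<open>The uniform distribution on the unit sphere of \<open>\<complex>\<^sup>N\<close>, i.e. normalised surface measure,
  as the image of the uniform distribution on the unit ball under radial projection.
  Vectors are functions on \<open>{..<N}\<close>.\<close>

definition complex_unit_ball :: "nat \<Rightarrow> (nat \<Rightarrow> complex) set" where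
  "complex_unit_ball N = {a \<in> space (\<Pi>\<^sub>M j\<in>{..<N}. lborel). (\<Sum>j<N. (cmod (a j))\<^sup>2) \<le> 1}"

definition uniform_sphere :: "nat \<Rightarrow> (nat \<Rightarrow> complex) measure" where
  "uniform_sphere N =
     distr (uniform_measure (\<Pi>\<^sub>M j\<in>{..<N}. lborel) (complex_unit_ball N))
       (\<Pi>\<^sub>M j\<in>{..<N}. lborel)
       (\<lambda>a. \<lambda>j\<in>{..<N}. a j / of_real (sqrt (\<Sum>i<N. (cmod (a i))\<^sup>2)))"

text \<open>In the following, \<open>f\<close> is an orthonormal basis of the space of cusp forms of weight \<open>k\<close>
  and \<open>a\<close> the random coefficient vector.\<close>

definition random_form ::
    "nat \<Rightarrow> (nat \<Rightarrow> complex \<Rightarrow> complex) \<Rightarrow> (nat \<Rightarrow> complex) \<Rightarrow> complex \<Rightarrow> complex" where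
  "random_form k f a z = (\<Sum>j < cusp_dim k. a j * f j z)"

definition normalized_form ::
    "nat \<Rightarrow> (nat \<Rightarrow> complex \<Rightarrow> complex) \<Rightarrow> (nat \<Rightarrow> complex) \<Rightarrow> complex \<Rightarrow> complex" where
  "normalized_form k f a z = of_real (Im z powr (real k / 2)) * random_form k f a z"

definition cov_kernel ::
    "nat \<Rightarrow> (nat \<Rightarrow> complex \<Rightarrow> complex) \<Rightarrow> complex \<Rightarrow> complex \<Rightarrow> complex" where
  "cov_kernel k f z w =
     (LINT a|uniform_sphere (cusp_dim k). normalized_form k f a z * cnj (normalized_form k f a w))"

text \<open>\<open>r\<^sub>k(z,z)\<close> is a nonnegative real, here as an element of type \<^typ>\<open>complex\<close>;
  its root is therefore taken with \<^const>\<open>csqrt\<close>.\<close>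

definition cov_diag :: "nat \<Rightarrow> (nat \<Rightarrow> complex \<Rightarrow> complex) \<Rightarrow> complex \<Rightarrow> complex" where
  "cov_diag k f z = cov_kernel k f z z"

definition hyp_Lp_norm :: "real \<Rightarrow> complex set \<Rightarrow> (complex \<Rightarrow> complex) \<Rightarrow> real" where
  "hyp_Lp_norm p A F = (LINT z:A|hyp_area. cmod (F z) powr p) powr (1 / p)"

definition expected_norm ::
    "nat \<Rightarrow> (nat \<Rightarrow> complex \<Rightarrow> complex) \<Rightarrow> real \<Rightarrow> complex set \<Rightarrow> real" where
  "expected_norm k f p A =
     (LINT a|uniform_sphere (cusp_dim k). hyp_Lp_norm p A (normalized_form k f a))"

end

theory Submission imports Defs begin

text \<open>Let \<open>h\<close> be the random form and \<open>F\<close> its \<open>L\<^sup>p\<close> norm as a function of the coefficient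
  vector. The \<open>p\<close>-th moment of \<open>F\<close> on the sphere is computed exactly by Fubini and gives the main
  term, up to replacing \<open>N\<close> by \<open>N - 1/2\<close> in the Gamma quotient, which costs a relative error \<open>O(1/N)\<close>.
  It remains to compare the mean of \<open>F\<close> with its \<open>p\<close>-th moment. A uniform point of the sphere is the
  direction of a standard complex Gaussian vector, and for Gaussian vectors Maurey's rotation argument
  bounds the difference by \<open>sqrt p\<close> times the Lipschitz constant of \<open>F\<close>. If \<open>S\<close> bounds the Bergman
  kernel \<open>B(z) = \<Sum>\<^sub>j |f\<^sub>j(z)|\<^sup>2 y\<^sup>k\<close>, this constant is at most \<open>S\<close> to the power \<open>1/2 - 1/p\<close>, so the
  error is \<open>O(sqrt p S\<^bsup>1/2 - 1/p\<^esup> / sqrt N)\<close>.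

  The mean value inequality on discs of hyperbolic radius comparable to \<open>1 / sqrt k\<close> gives
  \<open>B(z) = O(k (1 + y / sqrt k))\<close>, hence \<open>O(k)\<close> on compact sets, and \<open>O(k\<^bsup>3/2\<^esup>)\<close> everywhere
  since a cusp form divided by its first power of \<open>q\<close> obeys the maximum principle. Products of powers of a
  fixed cusp form with Eisenstein series show that \<open>N\<close> grows at least linearly in \<open>k\<close>.\<close>

section \<open>Lebesgue measure on complex vector spaces\<close>

text \<open>The quarter circle of the rotation argument is cut into \<open>N\<close> chords, and on
  each chord the norming functional \<open>ell\<close> serves as a supporting hyperplane where a
  gradient would otherwise be needed. The second-order remainder of the chords is absorbed by a
  trivial bound on the p-th moment, so neither a derivative nor a limit occurs. The comparison is
  made in p-th moments and not in tail probabilities because the p-norm of a standard complex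
  Gaussian variable is at most \<open>sqrt p\<close>, which settles the dependence on
  \<open>p\<close> at once. The Lipschitz constant is an interpolation of L^p between L^2 and the
  supremum. With \<open>S\<close> of order \<open>k powr x\<close> and \<open>N\<close> at least a
  multiple of \<open>k\<close>, the error is \<open>sqrt p\<close> times
  \<open>k powr (x * (1/2 - 1/p) - 1/2)\<close>; the two claims are the cases \<open>x = 1\<close>
  and \<open>x = 3/2\<close>. All unitary invariance is derived from translation invariance by
  factoring matrices into shears.\<close>

interpretation lborel_product: product_sigma_finite "\<lambda>_::nat. lborel :: complex measure"
  by standard

abbreviation lborel_vec :: "nat set \<Rightarrow> (nat \<Rightarrow> complex) measure" where
  "lborel_vec I \<equiv> Pi\<^sub>M I (\<lambda>_. lborel)"

definition lincomb :: "nat set \<Rightarrow> complex \<Rightarrow> complex \<Rightarrow> (nat \<Rightarrow> complex) \<Rightarrow> (nat \<Rightarrow> complex) \<Rightarrow> nat \<Rightarrow> complex" where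
  "lincomb I a b x y = (\<lambda>j\<in>I. a * x j + b * y j)"

lemma measurable_lincomb [measurable]:
  assumes [measurable]: "f \<in> measurable M (lborel_vec I)" "g \<in> measurable M (lborel_vec I)"
  shows "(\<lambda>x. lincomb I a b (f x) (g x)) \<in> measurable M (lborel_vec I)"
  unfolding lincomb_def
proof (rule measurable_restrict)
  fix j assume "j \<in> I"
  then have "(\<lambda>x. f x j) \<in> measurable M lborel" "(\<lambda>x. g x j) \<in> measurable M lborel"
    by (rule measurable_compose[OF assms(1) measurable_component_singleton],
        rule measurable_compose[OF assms(2) measurable_component_singleton])
  then show "(\<lambda>x. a * f x j + b * g x j) \<in> measurable M lborel" by simp
qed

lemma sigma_finite_lborel_vec: "finite I \<Longrightarrow> sigma_finite_measure (lborel_vec I)"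
  by (rule lborel_product.sigma_finite)

lemma lborel_vec_translate:
  assumes I: "finite I"
  shows "distr (lborel_vec I) (lborel_vec I) (\<lambda>x. \<lambda>j\<in>I. x j + c j) = lborel_vec I"
proof (rule lborel_product.PiM_eqI[OF I])
  show "sets (distr (lborel_vec I) (lborel_vec I) (\<lambda>x. \<lambda>j\<in>I. x j + c j)) = sets (lborel_vec I)" by simp
  fix A :: "nat \<Rightarrow> complex set" assume A: "\<And>i. i \<in> I \<Longrightarrow> A i \<in> sets lborel"
  have S: "Pi\<^sub>E I A \<in> sets (lborel_vec I)" using A I by (auto intro!: sets_PiM_I_finite)
  have "emeasure (distr (lborel_vec I) (lborel_vec I) (\<lambda>x. \<lambda>j\<in>I. x j + c j)) (Pi\<^sub>E I A)
    = emeasure (lborel_vec I) ((\<lambda>x. \<lambda>j\<in>I. x j + c j) -` (Pi\<^sub>E I A) \<inter> space (lborel_vec I))"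
    by (rule emeasure_distr) (use S in auto)
  also have "(\<lambda>x. \<lambda>j\<in>I. x j + c j) -` (Pi\<^sub>E I A) \<inter> space (lborel_vec I) = Pi\<^sub>E I (\<lambda>i. (+) (c i) -` A i)"
    by (auto simp: space_PiM PiE_iff extensional_def add.commute)
  also have "emeasure (lborel_vec I) \<dots> = (\<Prod>i\<in>I. emeasure lborel ((+) (c i) -` A i))"
    using A I by (intro lborel_product.emeasure_PiM) (auto intro!: measurable_sets_borel[where M=borel])
  also have "\<dots> = (\<Prod>i\<in>I. emeasure lborel (A i))"
  proof (rule prod.cong)
    fix i assume "i \<in> I"
    have "emeasure lborel (A i) = emeasure (distr lborel borel ((+) (c i))) (A i)"
      by (simp add: lborel_distr_plus)
    also have "\<dots> = emeasure lborel ((+) (c i) -` A i)"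
      using A[OF \<open>i \<in> I\<close>] by (subst emeasure_distr) auto
    finally show "emeasure lborel ((+) (c i) -` A i) = emeasure lborel (A i)" by simp
  qed simp
  finally show "emeasure (distr (lborel_vec I) (lborel_vec I) (\<lambda>x. \<lambda>j\<in>I. x j + c j)) (Pi\<^sub>E I A)
    = (\<Prod>i\<in>I. emeasure lborel (A i))" .
qed

text \<open>With one component fixed, a shear translates the other one, so Fubini reduces the claim
  to \<open>lborel_vec_translate\<close>.\<close>

lemma nn_integral_lborel_vec_shear:
  assumes I: "finite I" and f [measurable]: "f \<in> borel_measurable (lborel_vec I \<Otimes>\<^sub>M lborel_vec I)"
  shows "(\<integral>\<^sup>+p. f p \<partial>(lborel_vec I \<Otimes>\<^sub>M lborel_vec I))
           = (\<integral>\<^sup>+p. f (lincomb I 1 t (fst p) (snd p), snd p) \<partial>(lborel_vec I \<Otimes>\<^sub>M lborel_vec I))" (is "?A = ?B")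
    and "(\<integral>\<^sup>+p. f p \<partial>(lborel_vec I \<Otimes>\<^sub>M lborel_vec I))
           = (\<integral>\<^sup>+p. f (fst p, lincomb I t 1 (fst p) (snd p)) \<partial>(lborel_vec I \<Otimes>\<^sub>M lborel_vec I))" (is "_ = ?C")
proof -
  interpret M: sigma_finite_measure "lborel_vec I" by (rule sigma_finite_lborel_vec[OF I])
  interpret P: pair_sigma_finite "lborel_vec I" "lborel_vec I" ..
  have tr: "(\<integral>\<^sup>+x. g (lincomb I 1 t x y) \<partial>lborel_vec I) = (\<integral>\<^sup>+x. g x \<partial>lborel_vec I)"
     and tr': "(\<integral>\<^sup>+x. g (lincomb I t 1 y x) \<partial>lborel_vec I) = (\<integral>\<^sup>+x. g x \<partial>lborel_vec I)"
    if [measurable]: "g \<in> borel_measurable (lborel_vec I)" for g y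
  proof -
    have "(\<integral>\<^sup>+x. g x \<partial>lborel_vec I) = (\<integral>\<^sup>+x. g x \<partial>distr (lborel_vec I) (lborel_vec I) (\<lambda>x. \<lambda>j\<in>I. x j + t * y j))"
      by (subst lborel_vec_translate[OF I]) simp
    also have "\<dots> = (\<integral>\<^sup>+x. g (\<lambda>j\<in>I. x j + t * y j) \<partial>lborel_vec I)"
      by (subst nn_integral_distr) auto
    finally show "(\<integral>\<^sup>+x. g (lincomb I 1 t x y) \<partial>lborel_vec I) = (\<integral>\<^sup>+x. g x \<partial>lborel_vec I)"
      and "(\<integral>\<^sup>+x. g (lincomb I t 1 y x) \<partial>lborel_vec I) = (\<integral>\<^sup>+x. g x \<partial>lborel_vec I)"
      by (simp_all add: lincomb_def add.commute)
  qed
  have "?A = (\<integral>\<^sup>+y. \<integral>\<^sup>+x. f (x, y) \<partial>lborel_vec I \<partial>lborel_vec I)"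
    by (rule P.nn_integral_snd[symmetric]) measurable
  also have "\<dots> = (\<integral>\<^sup>+y. \<integral>\<^sup>+x. f (lincomb I 1 t x y, y) \<partial>lborel_vec I \<partial>lborel_vec I)"
    by (intro nn_integral_cong tr[symmetric]) measurable
  also have "\<dots> = ?B"
    by (subst P.nn_integral_snd[symmetric]) auto
  finally show "?A = ?B" .
  have "?A = (\<integral>\<^sup>+x. \<integral>\<^sup>+y. f (x, y) \<partial>lborel_vec I \<partial>lborel_vec I)"
    by (rule M.nn_integral_fst[symmetric]) measurable
  also have "\<dots> = (\<integral>\<^sup>+x. \<integral>\<^sup>+y. f (x, lincomb I t 1 x y) \<partial>lborel_vec I \<partial>lborel_vec I)"
    by (intro nn_integral_cong tr'[symmetric]) measurable
  also have "\<dots> = ?C"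
    by (subst M.nn_integral_fst[symmetric]) auto
  finally show "?A = ?C" .
qed

text \<open>A matrix in SU(2) with nonzero off-diagonal entries is a product of three shears.\<close>

lemma nn_integral_lborel_vec_rotate_aux:
  assumes I: "finite I" and f [measurable]: "f \<in> borel_measurable (lborel_vec I \<Otimes>\<^sub>M lborel_vec I)"
    and ab: "(cmod a)\<^sup>2 + (cmod b)\<^sup>2 = 1" "b \<noteq> 0"
  shows "(\<integral>\<^sup>+p. f p \<partial>(lborel_vec I \<Otimes>\<^sub>M lborel_vec I))
    = (\<integral>\<^sup>+p. f (lincomb I a b (fst p) (snd p), lincomb I (- cnj b) (cnj a) (fst p) (snd p)) \<partial>(lborel_vec I \<Otimes>\<^sub>M lborel_vec I))"
proof -
  let ?Q = "lborel_vec I \<Otimes>\<^sub>M lborel_vec I"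
  \<comment> \<open>The factors have the rows (1, s), (0, 1), then (1, 0), (t, 1), then (1, u), (0,
    1). The lower left entry of the product is \<open>t\<close>, which forces
    \<open>t = - cnj b\<close>; the diagonal entries \<open>1 + s * t\<close> and
    \<open>1 + t * u\<close> determine \<open>s\<close> and \<open>u\<close>; the last entry is then
    right because the determinant is 1.\<close>
  define s t u where "s = (1 - a) / cnj b" and "t = - cnj b" and "u = (1 - cnj a) / cnj b"
  have ab': "a * cnj a + b * cnj b = 1"
    using ab(1) by (simp add: complex_norm_square[symmetric] flip: of_real_add of_real_power)
  have cb: "cnj b \<noteq> 0" using ab by simp
  have e1: "1 + s * t = a" using cb by (simp add: s_def t_def field_simps)
  have e2: "1 + t * u = cnj a" using cb by (simp add: u_def t_def field_simps)
  have e3: "a * u + s = b"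
  proof -
    have "(a * u + s) * cnj b = b * cnj b"
    proof -
      have "(a * u + s) * cnj b = a * (1 - cnj a) + (1 - a)"
        using cb by (simp add: u_def s_def distrib_right)
      also have "\<dots> = b * cnj b" using ab' by (simp add: algebra_simps)
      finally show ?thesis .
    qed
    then show ?thesis using cb by simp
  qed
  define h where "h p = (lincomb I 1 s (fst p) (snd p), snd p)" for p :: "(nat \<Rightarrow> complex) \<times> (nat \<Rightarrow> complex)"
  define h' where "h' p = (fst p, lincomb I t 1 (fst p) (snd p))" for p :: "(nat \<Rightarrow> complex) \<times> (nat \<Rightarrow> complex)"
  define h'' where "h'' p = (lincomb I 1 u (fst p) (snd p), snd p)" for p :: "(nat \<Rightarrow> complex) \<times> (nat \<Rightarrow> complex)"
  have [measurable]: "h \<in> measurable ?Q ?Q" "h' \<in> measurable ?Q ?Q" "h'' \<in> measurable ?Q ?Q"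
    unfolding h_def h'_def h''_def by measurable
  have "(\<integral>\<^sup>+p. f p \<partial>?Q) = (\<integral>\<^sup>+p. f (h p) \<partial>?Q)"
    unfolding h_def by (rule nn_integral_lborel_vec_shear(1)[OF I]) measurable
  also have "\<dots> = (\<integral>\<^sup>+p. f (h (h' p)) \<partial>?Q)"
    using nn_integral_lborel_vec_shear(2)[OF I, of "\<lambda>p. f (h p)" t] unfolding h'_def[abs_def] by simp
  also have "\<dots> = (\<integral>\<^sup>+p. f (h (h' (h'' p))) \<partial>?Q)"
    using nn_integral_lborel_vec_shear(1)[OF I, of "\<lambda>p. f (h (h' p))" u] unfolding h''_def[abs_def] by simp
  also have "\<dots> = (\<integral>\<^sup>+p. f (lincomb I a b (fst p) (snd p), lincomb I (- cnj b) (cnj a) (fst p) (snd p)) \<partial>?Q)"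
  proof (rule nn_integral_cong, rule arg_cong[where f=f])
    fix p assume "p \<in> space ?Q"
    have "lincomb I t 1 (lincomb I 1 u (fst p) (snd p)) (snd p) = lincomb I (- cnj b) (cnj a) (fst p) (snd p)"
      using e2 by (auto simp: lincomb_def fun_eq_iff t_def[symmetric] algebra_simps simp flip: e2)
    moreover have "lincomb I 1 s (lincomb I 1 u (fst p) (snd p)) (lincomb I (- cnj b) (cnj a) (fst p) (snd p))
      = lincomb I a b (fst p) (snd p)"
    proof -
      have "x + u * y + s * (t * x + cnj a * y) = a * x + b * y" for x y
      proof -
        have "x + u * y + s * (t * x + cnj a * y) = (1 + s * t) * x + (u * (1 + s * t) + s) * y"
          unfolding e2[symmetric] by (simp add: algebra_simps)
        also have "\<dots> = a * x + b * y" using e1 e3 by (simp add: mult.commute)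
        finally show ?thesis .
      qed
      then show ?thesis by (auto simp: lincomb_def fun_eq_iff t_def)
    qed
    ultimately show "h (h' (h'' p)) = (lincomb I a b (fst p) (snd p), lincomb I (- cnj b) (cnj a) (fst p) (snd p))"
      by (simp add: h_def h'_def h''_def)
  qed
  finally show ?thesis .
qed

lemma nn_integral_lborel_vec_rotate:
  assumes I: "finite I" and f [measurable]: "f \<in> borel_measurable (lborel_vec I \<Otimes>\<^sub>M lborel_vec I)"
    and ab: "(cmod a)\<^sup>2 + (cmod b)\<^sup>2 = 1"
  shows "(\<integral>\<^sup>+p. f p \<partial>(lborel_vec I \<Otimes>\<^sub>M lborel_vec I))
    = (\<integral>\<^sup>+p. f (lincomb I a b (fst p) (snd p), lincomb I (- cnj b) (cnj a) (fst p) (snd p)) \<partial>(lborel_vec I \<Otimes>\<^sub>M lborel_vec I))"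
proof (cases "b = 0")
  case False
  then show ?thesis by (intro nn_integral_lborel_vec_rotate_aux[OF I f ab])
next
  case True
  then have a: "cmod a = 1" using ab by (simp add: power2_eq_1_iff) (smt (verit) norm_ge_zero)
  let ?Q = "lborel_vec I \<Otimes>\<^sub>M lborel_vec I"
  \<comment> \<open>For \<open>b = 0\<close> the matrix is diagonal. It is the product of two
    antidiagonal matrices of determinant 1, and the previous lemma applies to each of them.\<close>
  define h where "h p = (lincomb I 0 a (fst p) (snd p), lincomb I (- cnj a) 0 (fst p) (snd p))"
    for p :: "(nat \<Rightarrow> complex) \<times> (nat \<Rightarrow> complex)"
  have [measurable]: "h \<in> measurable ?Q ?Q" unfolding h_def by measurable
  have "(\<integral>\<^sup>+p. f p \<partial>?Q) = (\<integral>\<^sup>+p. f (h p) \<partial>?Q)"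
    using nn_integral_lborel_vec_rotate_aux[OF I f, of 0 a] a unfolding h_def by force
  also have "\<dots> = (\<integral>\<^sup>+p. f (h (lincomb I 0 (-1) (fst p) (snd p), lincomb I 1 0 (fst p) (snd p))) \<partial>?Q)"
    using nn_integral_lborel_vec_rotate_aux[OF I, of "\<lambda>p. f (h p)" 0 "-1"] by simp
  also have "\<dots> = (\<integral>\<^sup>+p. f (lincomb I a b (fst p) (snd p), lincomb I (- cnj b) (cnj a) (fst p) (snd p)) \<partial>?Q)"
    by (intro nn_integral_cong arg_cong[where f=f])
      (auto simp: h_def lincomb_def fun_eq_iff True)
  finally show ?thesis .
qed

text \<open>The sublevel sets have mass \<open>c * r ^ d\<close>, so the image of \<open>M\<close>
  under \<open>\<rho>\<close> has density \<open>c * d * r ^ (d - 1)\<close> on the half line.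
  \<open>M\<close> is arbitrary because the lemma is applied to Lebesgue measure and also to
  Lebesgue measure weighted by a function of the direction.\<close>

lemma nn_integral_radial:
  fixes \<rho> :: "'a \<Rightarrow> real" and d :: nat
  assumes [measurable]: "\<rho> \<in> borel_measurable M" and nn: "\<And>x. x \<in> space M \<Longrightarrow> 0 \<le> \<rho> x"
    and d: "d \<ge> 1" and c: "0 \<le> c"
    and vol: "\<And>r. 0 < r \<Longrightarrow> emeasure M {x \<in> space M. \<rho> x \<le> r} = ennreal (c * r ^ d)"
    and [measurable]: "\<psi> \<in> borel_measurable borel"
  shows "(\<integral>\<^sup>+x. \<psi> (\<rho> x) \<partial>M) = (\<integral>\<^sup>+r. \<psi> r * (ennreal (c * d * r ^ (d - 1)) * indicator {0..} r) \<partial>lborel)"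
proof -
  let ?D = "density lborel (\<lambda>r. ennreal (c * d * r ^ (d - 1)) * indicator {0..} r) :: real measure"
  have dens: "emeasure ?D {..r} = (if r \<le> 0 then 0 else ennreal (c * r ^ d))" for r
  proof -
    have "emeasure ?D {..r} = (\<integral>\<^sup>+s. ennreal (c * d * s ^ (d - 1)) * indicator {0..} s * indicator {..r} s \<partial>lborel)"
      by (subst emeasure_density) auto
    also have "\<dots> = (\<integral>\<^sup>+s. ennreal (c * d * s ^ (d - 1)) * indicator {0..r} s \<partial>lborel)"
      by (intro nn_integral_cong) (auto simp: indicator_def)
    also have "\<dots> = (if r \<le> 0 then 0 else ennreal (c * r ^ d))"
    proof (cases "r \<le> 0")
      case True
      then have "(\<integral>\<^sup>+s. ennreal (c * d * s ^ (d - 1)) * indicator {0..r} s \<partial>lborel) = (\<integral>\<^sup>+s. 0 \<partial>(lborel :: real measure))"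
      proof (intro nn_integral_cong_AE)
        have "AE s::real in lborel. s \<noteq> 0" by (rule AE_lborel_singleton)
        then show "AE s in lborel. ennreal (c * d * s ^ (d - 1)) * indicator {0..r} s = 0"
          by eventually_elim (use True in \<open>auto simp: indicator_def\<close>)
      qed
      then show ?thesis using True by simp
    next
      case False
      have "(\<integral>\<^sup>+s. ennreal (c * d * s ^ (d - 1)) * indicator {0..r} s \<partial>lborel) = ennreal (c * r ^ d - c * 0 ^ d)"
      proof (rule nn_integral_FTC_Icc)
        fix s :: real assume "s \<in> {0..r}"
        then show "0 \<le> c * d * s ^ (d - 1)" using c by simp
        show "((\<lambda>r. c * r ^ d) has_real_derivative c * d * s ^ (d - 1)) (at s)"
          by (auto intro!: derivative_eq_intros)
      qed (use False in auto)
      then show ?thesis using False d by (simp add: power_0_left)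
    qed
    finally show ?thesis .
  qed
  have dist: "emeasure (distr M borel \<rho>) {..r} = (if r \<le> 0 then 0 else ennreal (c * r ^ d))" for r
  proof -
    have eq: "emeasure (distr M borel \<rho>) {..r} = emeasure M {x \<in> space M. \<rho> x \<le> r}" for r
      by (subst emeasure_distr) (auto intro!: arg_cong[where f="emeasure M"])
    show ?thesis
    proof (cases "r \<le> 0")
      \<comment> \<open>Masses are given for positive radii only. Letting \<open>e\<close> tend to 0
        shows that the sublevel sets at \<open>r \<le> 0\<close> are null.\<close>
      case True
      have le: "emeasure M {x \<in> space M. \<rho> x \<le> r} \<le> ennreal (c * e)" if "0 < e" "e \<le> 1" for e
      proof -
        have "emeasure M {x \<in> space M. \<rho> x \<le> r} \<le> emeasure M {x \<in> space M. \<rho> x \<le> e}"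
          using that True by (intro emeasure_mono) auto
        also have "\<dots> = ennreal (c * e ^ d)" using that vol by simp
        also have "\<dots> \<le> ennreal (c * e)"
          using that d c power_decreasing[of 1 d e] by (intro ennreal_leI mult_left_mono) auto
        finally show ?thesis .
      qed
      have "emeasure M {x \<in> space M. \<rho> x \<le> r} \<le> 0"
      proof (rule ennreal_le_epsilon)
        fix e :: real assume "0 < e"
        define e' where "e' = min 1 (e / (c + 1))"
        have "emeasure M {x \<in> space M. \<rho> x \<le> r} \<le> ennreal (c * e')"
          using \<open>0 < e\<close> c by (intro le) (auto simp: e'_def)
        also have "c * e' \<le> e"
        proof -
          have "c * e' \<le> c * (e / (c + 1))" using c by (intro mult_left_mono) (auto simp: e'_def)
          also have "\<dots> \<le> e" using c \<open>0 < e\<close> by (simp add: field_simps)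
          finally show ?thesis .
        qed
        finally show "emeasure M {x \<in> space M. \<rho> x \<le> r} \<le> 0 + ennreal e" by (simp add: ennreal_leI)
      qed
      then show ?thesis using True by (simp add: eq)
    next
      case False
      then show ?thesis using vol by (simp add: eq)
    qed
  qed
  have "distr M borel \<rho> = ?D"
  proof (rule measure_eqI_generator_eq[where E="range (\<lambda>a::real. {..a})" and \<Omega>=UNIV and A="\<lambda>n. {..real n}"])
    show "Int_stable (range (\<lambda>a::real. {..a}))" by (auto simp: Int_stable_def)
    show "sets (distr M borel \<rho>) = sigma_sets UNIV (range (\<lambda>a::real. {..a}))"
      "sets ?D = sigma_sets UNIV (range (\<lambda>a::real. {..a}))"
      by (simp_all add: borel_eq_atMost sets_measure_of)
    show "(\<Union>i. {..real i}) = UNIV" by (auto intro: real_arch_simple)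
    show "emeasure (distr M borel \<rho>) X = emeasure ?D X" if "X \<in> range (\<lambda>a::real. {..a})" for X
      using that by (elim rangeE) (simp only: dens dist)
  qed (auto simp: dist)
  then have "(\<integral>\<^sup>+x. \<psi> x \<partial>distr M borel \<rho>) = (\<integral>\<^sup>+x. \<psi> x \<partial>?D)" by simp
  then show ?thesis
    by (subst (asm) nn_integral_distr, measurable) (simp add: nn_integral_density mult.commute)
qed

lemma nn_integral_Gamma:
  assumes "x > (0::real)"
  shows "(\<integral>\<^sup>+t. ennreal (t powr (x - 1) * exp (- t)) * indicator {0..} t \<partial>lborel) = ennreal (Gamma x)"
proof -
  have "((\<lambda>t. if t \<in> {0..} then t powr (x - 1) / exp t else 0) has_integral Gamma x) UNIV"
    using Gamma_integral_real[OF assms] by (subst has_integral_restrict_UNIV)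
  then have "(\<integral>\<^sup>+t. ennreal (if t \<in> {0..} then t powr (x - 1) / exp t else 0) \<partial>lborel) = ennreal (Gamma x)"
    by (intro nn_integral_has_integral_lborel) auto
  then show ?thesis
    by (subst (asm) nn_integral_cong[where v="\<lambda>t. ennreal (t powr (x - 1) * exp (- t)) * indicator {0..} t"])
      (auto simp: indicator_def exp_minus field_simps)
qed

section \<open>Gaussian vectors and the uniform distribution on the sphere\<close>

lemma sq_powr_half: "0 \<le> x \<Longrightarrow> (x\<^sup>2) powr (q / 2) = x powr (q::real)"
  by (cases "x = 0") (auto simp: powr_powr simp flip: powr_numeral)

lemma powr_sqrt_eq: "0 \<le> x \<Longrightarrow> sqrt x powr q = x powr (q / 2)"
  by (simp add: powr_half_sqrt[symmetric] powr_powr)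

text \<open>Real and imaginary part have variance 1/2, so the mean of the squared modulus is
  1.\<close>

definition gauss1 :: "complex measure" where
  "gauss1 = density lborel (\<lambda>z. ennreal (exp (- (cmod z)\<^sup>2) / pi))"

lemma sets_gauss1 [measurable_cong, simp]: "sets gauss1 = sets borel"
  by (simp add: gauss1_def)

lemma space_gauss1 [simp]: "space gauss1 = UNIV"
  by (simp add: gauss1_def)

text \<open>A disc has area \<open>pi * r\<close> when \<open>r\<close> is the square of its radius,
  so the squared modulus is exponentially distributed with rate 1 and its moment of order
  \<open>q / 2\<close> is a Gamma value.\<close>

lemma gauss1_moment:
  assumes q: "q \<ge> (0::real)"
  shows "(\<integral>\<^sup>+z. ennreal (cmod z powr q) \<partial>gauss1) = ennreal (Gamma (q / 2 + 1))"
proof -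
  have "(\<integral>\<^sup>+z. ennreal (cmod z powr q) \<partial>gauss1)
      = (\<integral>\<^sup>+z. ennreal (exp (- (cmod z)\<^sup>2) / pi) * ennreal (cmod z powr q) \<partial>lborel)"
    unfolding gauss1_def by (subst nn_integral_density) auto
  also have "\<dots> = (\<integral>\<^sup>+z. ennreal (1 / pi * (((cmod z)\<^sup>2) powr (q / 2) * exp (- (cmod z)\<^sup>2))) \<partial>lborel)"
    by (intro nn_integral_cong) (auto simp: sq_powr_half mult_ac simp flip: ennreal_mult)
  also have "\<dots> = (\<integral>\<^sup>+t. ennreal (1 / pi * (t powr (q / 2) * exp (- t)))
      * (ennreal (pi * real 1 * t ^ (1 - 1)) * indicator {0..} t) \<partial>lborel)"
  proof (rule nn_integral_radial)
    fix r :: real assume r: "0 < r"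
    have "{x \<in> space lborel. (cmod x)\<^sup>2 \<le> r} = cball 0 (sqrt r)"
      using r by (auto simp: real_le_rsqrt) (metis norm_ge_zero real_sqrt_le_iff real_sqrt_unique)
    then show "emeasure lborel {x \<in> space lborel. (cmod x)\<^sup>2 \<le> r} = ennreal (pi * r ^ 1)"
      using r by (simp add: emeasure_cball unit_ball_vol_2)
  qed auto
  also have "\<dots> = (\<integral>\<^sup>+t. ennreal (t powr ((q / 2 + 1) - 1) * exp (- t)) * indicator {0..} t \<partial>lborel)"
    by (intro nn_integral_cong) (auto simp: indicator_def simp flip: ennreal_mult)
  also have "\<dots> = ennreal (Gamma (q / 2 + 1))"
    using q by (intro nn_integral_Gamma) auto
  finally show ?thesis .
qed

lemma prob_space_gauss1: "prob_space gauss1"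
proof
  have "(\<integral>\<^sup>+z. ennreal (cmod z powr 0) \<partial>gauss1) = (\<integral>\<^sup>+z. 1 \<partial>gauss1)"
  proof (rule nn_integral_cong_AE)
    \<comment> \<open>\<open>0 powr 0\<close> is 0, so the zeroth moment agrees with the total mass
      only off the null set \<open>{0}\<close>.\<close>
    have "AE z::complex in lborel. z \<noteq> 0" by (rule AE_lborel_singleton)
    then show "AE z in gauss1. ennreal (cmod z powr 0) = 1"
      unfolding gauss1_def by (subst AE_density) auto
  qed
  then show "emeasure gauss1 (space gauss1) = 1"
    using gauss1_moment[of 0] by simp
qed

interpretation gauss1: prob_space gauss1 by (rule prob_space_gauss1)
interpretation gauss1_product: product_sigma_finite "\<lambda>_::nat. gauss1" by standard

abbreviation gauss_vec :: "nat set \<Rightarrow> (nat \<Rightarrow> complex) measure" where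
  "gauss_vec I \<equiv> Pi\<^sub>M I (\<lambda>_. gauss1)"

lemma sets_gauss_vec [measurable_cong]: "sets (gauss_vec I) = sets (lborel_vec I)"
  by (rule sets_PiM_cong) auto

definition norm_sq :: "nat set \<Rightarrow> (nat \<Rightarrow> complex) \<Rightarrow> real" where
  "norm_sq I x = (\<Sum>j\<in>I. (cmod (x j))\<^sup>2)"

lemma norm_sq_nonneg [simp]: "0 \<le> norm_sq I x"
  by (auto simp: norm_sq_def intro: sum_nonneg)

lemma measurable_norm_sq [measurable]: "norm_sq I \<in> borel_measurable (lborel_vec I)"
  unfolding norm_sq_def by measurable

lemma gauss_vec_eq_density:
  assumes I: "finite I"
  shows "gauss_vec I = density (lborel_vec I) (\<lambda>x. ennreal (exp (- norm_sq I x) / pi ^ card I))"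
proof (rule gauss1_product.PiM_eqI[OF I, symmetric])
  show "sets (density (lborel_vec I) (\<lambda>x. ennreal (exp (- norm_sq I x) / pi ^ card I))) = sets (gauss_vec I)"
    by (simp add: sets_gauss_vec)
  fix A :: "nat \<Rightarrow> complex set" assume A: "\<And>i. i \<in> I \<Longrightarrow> A i \<in> sets gauss1"
  have A' [measurable]: "i \<in> I \<Longrightarrow> A i \<in> sets borel" for i using A by simp
  have "Pi\<^sub>E I A \<in> sets (lborel_vec I)" using A I by (auto intro!: sets_PiM_I_finite)
  then have "emeasure (density (lborel_vec I) (\<lambda>x. ennreal (exp (- norm_sq I x) / pi ^ card I))) (Pi\<^sub>E I A)
    = (\<integral>\<^sup>+x. ennreal (exp (- norm_sq I x) / pi ^ card I) * indicator (Pi\<^sub>E I A) x \<partial>lborel_vec I)"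
    by (intro emeasure_density) auto
  also have "\<dots> = (\<integral>\<^sup>+x. (\<Prod>i\<in>I. ennreal (exp (- (cmod (x i))\<^sup>2) / pi) * indicator (A i) (x i)) \<partial>lborel_vec I)"
  proof (rule nn_integral_cong)
    fix x assume x: "x \<in> space (lborel_vec I)"
    have "indicator (Pi\<^sub>E I A) x = (\<Prod>i\<in>I. indicator (A i) (x i) :: ennreal)"
      using x I by (auto simp: indicator_def PiE_iff space_PiM)
    moreover have "ennreal (exp (- norm_sq I x) / pi ^ card I) = (\<Prod>i\<in>I. ennreal (exp (- (cmod (x i))\<^sup>2) / pi))"
      using I by (subst prod_ennreal) (auto simp: norm_sq_def exp_sum prod_dividef simp flip: sum_negf)
    ultimately show "ennreal (exp (- norm_sq I x) / pi ^ card I) * indicator (Pi\<^sub>E I A) x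
      = (\<Prod>i\<in>I. ennreal (exp (- (cmod (x i))\<^sup>2) / pi) * indicator (A i) (x i))"
      by (simp add: prod.distrib)
  qed
  also have "\<dots> = (\<Prod>i\<in>I. \<integral>\<^sup>+z. ennreal (exp (- (cmod z)\<^sup>2) / pi) * indicator (A i) z \<partial>lborel)"
    using I by (intro lborel_product.product_nn_integral_prod) auto
  also have "\<dots> = (\<Prod>i\<in>I. emeasure gauss1 (A i))"
    by (intro prod.cong) (auto simp: gauss1_def emeasure_density)
  finally show "emeasure (density (lborel_vec I) (\<lambda>x. ennreal (exp (- norm_sq I x) / pi ^ card I))) (Pi\<^sub>E I A)
     = (\<Prod>i\<in>I. emeasure gauss1 (A i))" .
qed

section \<open>Polar decomposition of Gaussian vectors\<close>

lemma nn_integral_lborel_vec_scale: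
  assumes I: "finite I" and r: "r > 0" and [measurable]: "g \<in> borel_measurable (lborel_vec I)"
  shows "(\<integral>\<^sup>+x. g x \<partial>lborel_vec I) = ennreal (r ^ (2 * card I)) * (\<integral>\<^sup>+x. g (\<lambda>j\<in>I. of_real r * x j) \<partial>lborel_vec I)"
proof -
  let ?s = "\<lambda>x. \<lambda>j\<in>I. of_real r * x j :: complex"
  let ?P = "density (distr (lborel_vec I) (lborel_vec I) ?s) (\<lambda>_. ennreal (r ^ (2 * card I)))"
  have "?P = lborel_vec I"
  proof (rule lborel_product.PiM_eqI[OF I])
    fix A :: "nat \<Rightarrow> complex set" assume A: "\<And>i. i \<in> I \<Longrightarrow> A i \<in> sets lborel"
    have S: "Pi\<^sub>E I A \<in> sets (lborel_vec I)" using A I by (auto intro!: sets_PiM_I_finite)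
    have "emeasure ?P (Pi\<^sub>E I A) = ennreal (r ^ (2 * card I)) * emeasure (distr (lborel_vec I) (lborel_vec I) ?s) (Pi\<^sub>E I A)"
      using S by (simp add: emeasure_density nn_integral_cmult_indicator)
    also have "emeasure (distr (lborel_vec I) (lborel_vec I) ?s) (Pi\<^sub>E I A)
      = emeasure (lborel_vec I) (?s -` (Pi\<^sub>E I A) \<inter> space (lborel_vec I))"
      by (rule emeasure_distr) (use S in auto)
    also have "?s -` (Pi\<^sub>E I A) \<inter> space (lborel_vec I) = Pi\<^sub>E I (\<lambda>i. (\<lambda>z. of_real r * z) -` A i)"
      by (auto simp: space_PiM PiE_iff extensional_def)
    also have "emeasure (lborel_vec I) \<dots> = (\<Prod>i\<in>I. emeasure lborel ((\<lambda>z. of_real r * z) -` A i))"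
      using A I by (intro lborel_product.emeasure_PiM) (auto intro!: measurable_sets_borel[where M=borel])
    also have "ennreal (r ^ (2 * card I)) * \<dots> = (\<Prod>i\<in>I. ennreal (r\<^sup>2) * emeasure lborel ((\<lambda>z. of_real r * z) -` A i))"
      using r by (simp add: prod.distrib power_mult ennreal_power)
    also have "\<dots> = (\<Prod>i\<in>I. emeasure lborel (A i))"
    proof (rule prod.cong)
      fix i assume i: "i \<in> I"
      have "emeasure lborel (A i) = emeasure (density (distr lborel borel (\<lambda>x::complex. 0 + r *\<^sub>R x)) (\<lambda>_. \<bar>r\<bar>^DIM(complex))) (A i)"
        using r by (subst lborel_affine[of r 0]) auto
      also have "\<dots> = ennreal (r\<^sup>2) * emeasure (distr lborel borel (\<lambda>x::complex. 0 + r *\<^sub>R x)) (A i)"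
        using A[OF i] r by (simp add: emeasure_density nn_integral_cmult_indicator)
      also have "emeasure (distr lborel borel (\<lambda>x::complex. 0 + r *\<^sub>R x)) (A i) = emeasure lborel ((\<lambda>z. of_real r * z) -` A i)"
        using A[OF i] by (subst emeasure_distr) (auto simp: scaleR_conv_of_real)
      finally show "ennreal (r\<^sup>2) * emeasure lborel ((\<lambda>z. of_real r * z) -` A i) = emeasure lborel (A i)" by simp
    qed simp
    finally show "emeasure ?P (Pi\<^sub>E I A) = (\<Prod>i\<in>I. emeasure lborel (A i))" .
  qed simp
  then have "(\<integral>\<^sup>+x. g x \<partial>lborel_vec I) = (\<integral>\<^sup>+x. g x \<partial>?P)" by simp
  also have "\<dots> = ennreal (r ^ (2 * card I)) * (\<integral>\<^sup>+x. g x \<partial>distr (lborel_vec I) (lborel_vec I) ?s)"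
    by (subst nn_integral_density) (auto simp: nn_integral_cmult)
  also have "(\<integral>\<^sup>+x. g x \<partial>distr (lborel_vec I) (lborel_vec I) ?s) = (\<integral>\<^sup>+x. g (?s x) \<partial>lborel_vec I)"
    by (subst nn_integral_distr) auto
  finally show ?thesis .
qed

definition sphere_proj :: "nat \<Rightarrow> (nat \<Rightarrow> complex) \<Rightarrow> nat \<Rightarrow> complex" where
  "sphere_proj N a = (\<lambda>j\<in>{..<N}. a j / of_real (sqrt (norm_sq {..<N} a)))"

lemma measurable_sphere_proj [measurable]: "sphere_proj N \<in> measurable (lborel_vec {..<N}) (lborel_vec {..<N})"
  unfolding sphere_proj_def by measurable

lemma norm_sq_scale: "norm_sq I (\<lambda>j\<in>I. of_real r * x j) = r\<^sup>2 * norm_sq I x"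
  by (simp add: norm_sq_def norm_mult power_mult_distrib sum_distrib_left)

lemma sphere_proj_scale: "r > 0 \<Longrightarrow> sphere_proj N (\<lambda>j\<in>{..<N}. of_real r * x j) = sphere_proj N x"
  by (auto simp: sphere_proj_def norm_sq_scale real_sqrt_mult)

lemma complex_unit_ball_eq: "complex_unit_ball N = {a \<in> space (lborel_vec {..<N}). norm_sq {..<N} a \<le> 1}"
  by (simp add: complex_unit_ball_def norm_sq_def)

lemma sets_complex_unit_ball [measurable]: "complex_unit_ball N \<in> sets (lborel_vec {..<N})"
  unfolding complex_unit_ball_eq by measurable

text \<open>Weight Lebesgue measure by \<open>\<Psi>\<close> of the direction. By homogeneity the
  ball \<open>norm_sq x \<le> r\<close> has weighted mass \<open>c * r ^ N\<close>; the exponent is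
  half the real dimension because the radial variable is the square of the norm. Radial integration
  then leaves a Gamma integral.\<close>

lemma nn_integral_polar:
  fixes N :: nat and c :: real
  assumes N: "N \<ge> 1" and q: "q \<ge> (0::real)"
    and [measurable]: "\<Psi> \<in> borel_measurable (lborel_vec {..<N})"
    and fin: "(\<integral>\<^sup>+x. \<Psi> (sphere_proj N x) * indicator (complex_unit_ball N) x \<partial>lborel_vec {..<N}) = ennreal c" "0 \<le> c"
  shows "(\<integral>\<^sup>+x. ennreal (norm_sq {..<N} x powr (q / 2)) * \<Psi> (sphere_proj N x) \<partial>gauss_vec {..<N})
           = ennreal (c * N / pi ^ N * Gamma (N + q / 2))"
proof -
  let ?I = "{..<N}" let ?L = "lborel_vec {..<N}"
  define M where "M = density ?L (\<lambda>x. \<Psi> (sphere_proj N x))"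
  have [measurable_cong, simp]: "sets M = sets ?L" by (simp add: M_def)
  have [simp]: "space M = space ?L" by (simp add: M_def)
  have vol: "emeasure M {x \<in> space M. norm_sq ?I x \<le> r} = ennreal (c * r ^ N)" if r: "0 < r" for r :: real
  proof -
    have "emeasure M {x \<in> space M. norm_sq ?I x \<le> r} = (\<integral>\<^sup>+x. \<Psi> (sphere_proj N x) * indicator {x \<in> space ?L. norm_sq ?I x \<le> r} x \<partial>?L)"
      unfolding M_def by (subst emeasure_density) auto
    also have "\<dots> = ennreal (sqrt r ^ (2 * card ?I)) *
      (\<integral>\<^sup>+x. \<Psi> (sphere_proj N (\<lambda>j\<in>?I. of_real (sqrt r) * x j)) * indicator {x \<in> space ?L. norm_sq ?I x \<le> r} (\<lambda>j\<in>?I. of_real (sqrt r) * x j) \<partial>?L)"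
      using r by (intro nn_integral_lborel_vec_scale) auto
    also have "(\<integral>\<^sup>+x. \<Psi> (sphere_proj N (\<lambda>j\<in>?I. of_real (sqrt r) * x j)) * indicator {x \<in> space ?L. norm_sq ?I x \<le> r} (\<lambda>j\<in>?I. of_real (sqrt r) * x j) \<partial>?L)
      = (\<integral>\<^sup>+x. \<Psi> (sphere_proj N x) * indicator (complex_unit_ball N) x \<partial>?L)"
      using r by (intro nn_integral_cong, subst sphere_proj_scale)
        (auto simp: indicator_def complex_unit_ball_eq norm_sq_scale space_PiM)
    also have "sqrt r ^ (2 * card ?I) = r ^ N" using r by (simp add: power_mult)
    finally show ?thesis using fin r by (simp add: mult.commute flip: ennreal_mult)
  qed
  have "(\<integral>\<^sup>+x. ennreal (norm_sq ?I x powr (q / 2)) * \<Psi> (sphere_proj N x) \<partial>gauss_vec ?I)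
    = (\<integral>\<^sup>+x. \<Psi> (sphere_proj N x) * ennreal (norm_sq ?I x powr (q / 2) * (exp (- norm_sq ?I x) / pi ^ N)) \<partial>?L)"
    by (subst gauss_vec_eq_density, simp, subst nn_integral_density)
      (auto simp: mult_ac intro!: nn_integral_cong simp flip: ennreal_mult)
  also have "\<dots> = (\<integral>\<^sup>+x. ennreal (norm_sq ?I x powr (q / 2) * (exp (- norm_sq ?I x) / pi ^ N)) \<partial>M)"
    unfolding M_def by (subst nn_integral_density) auto
  also have "\<dots> = (\<integral>\<^sup>+t. ennreal (t powr (q / 2) * (exp (- t) / pi ^ N)) *
      (ennreal (c * real N * t ^ (N - 1)) * indicator {0..} t) \<partial>lborel)"
    by (rule nn_integral_radial) (use N fin vol in auto)
  also have "\<dots> = (\<integral>\<^sup>+t. ennreal (c * N / pi ^ N) * (ennreal (t powr (N + q / 2 - 1) * exp (- t)) * indicator {0..} t) \<partial>lborel)"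
  proof (rule nn_integral_cong)
    fix t :: real
    show "ennreal (t powr (q / 2) * (exp (- t) / pi ^ N)) * (ennreal (c * real N * t ^ (N - 1)) * indicator {0..} t)
      = ennreal (c * N / pi ^ N) * (ennreal (t powr (N + q / 2 - 1) * exp (- t)) * indicator {0..} t)"
    proof (cases "t > 0")
      case True
      have "t powr (N + q / 2 - 1) = t powr (q / 2) * t powr (real (N - 1))"
        using N by (subst powr_add[symmetric]) (simp add: of_nat_diff algebra_simps)
      then have "t powr (N + q / 2 - 1) = t powr (q / 2) * t ^ (N - 1)"
        using True by (simp add: powr_realpow)
      then show ?thesis using True fin(2) by (simp add: mult_ac flip: ennreal_mult)
    next
      case False
      then show ?thesis by (cases "t = 0") auto
    qed
  qed
  also have "\<dots> = ennreal (c * N / pi ^ N) * ennreal (Gamma (N + q / 2))"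
    using N q by (subst nn_integral_cmult, measurable, subst nn_integral_Gamma) auto
  also have "\<dots> = ennreal (c * N / pi ^ N * Gamma (N + q / 2))"
    using N q fin by (subst ennreal_mult) auto
  finally show ?thesis .
qed

text \<open>The volume \<open>pi ^ N / N!\<close> is read off from the total mass 1 of the Gaussian
  measure, by \<open>nn_integral_polar\<close> with \<open>\<Psi> = 1\<close> and
  \<open>q = 0\<close>. The enclosing product of discs only shows that the volume is finite.\<close>

lemma complex_unit_ball_volume:
  assumes N: "N \<ge> 1"
  obtains V :: real where "V > 0" "emeasure (lborel_vec {..<N}) (complex_unit_ball N) = ennreal V"
    "V * N / pi ^ N * Gamma N = 1"
proof -
  let ?L = "lborel_vec {..<N}"
  interpret prob_space "gauss_vec {..<N}" by (rule prob_space_PiM) (rule prob_space_gauss1)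
  have "emeasure ?L (complex_unit_ball N) \<le> emeasure ?L (Pi\<^sub>E {..<N} (\<lambda>_. cball 0 1))"
  proof (rule emeasure_mono)
    show "complex_unit_ball N \<subseteq> (\<Pi>\<^sub>E i\<in>{..<N}. cball 0 1)"
    proof
      fix a assume a: "a \<in> complex_unit_ball N"
      have "(cmod (a j))\<^sup>2 \<le> 1" if "j < N" for j
        using a member_le_sum[of j "{..<N}" "\<lambda>j. (cmod (a j))\<^sup>2"] that
        by (auto simp: complex_unit_ball_eq norm_sq_def)
      then show "a \<in> (\<Pi>\<^sub>E i\<in>{..<N}. cball 0 1)" using a
        by (auto simp: complex_unit_ball_eq space_PiM PiE_iff power_le_one_iff abs_square_le_1)
    qed
  qed (auto intro!: sets_PiM_I_finite)
  also have "\<dots> = (\<Prod>i<N. emeasure lborel (cball (0::complex) 1))"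
    by (intro lborel_product.emeasure_PiM) auto
  also have "\<dots> < \<infinity>" by (simp add: emeasure_cball ennreal_power power_less_top_ennreal)
  finally obtain V :: real where V: "V \<ge> 0" "emeasure ?L (complex_unit_ball N) = ennreal V"
    by (cases "emeasure ?L (complex_unit_ball N)") auto
  have "(\<integral>\<^sup>+x. ennreal (norm_sq {..<N} x powr (0 / 2)) * 1 \<partial>gauss_vec {..<N}) = ennreal (V * N / pi ^ N * Gamma (N + 0 / 2))"
    using nn_integral_polar[OF N order_refl, of "\<lambda>_. 1" V] V by simp
  moreover have "(\<integral>\<^sup>+x. ennreal (norm_sq {..<N} x powr (0 / 2)) * 1 \<partial>gauss_vec {..<N}) = (\<integral>\<^sup>+x. 1 \<partial>gauss_vec {..<N})"
  proof (rule nn_integral_cong_AE)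
    have 0: "0 \<in> {..<N}" using N by auto
    have "AE x in gauss_vec {..<N}. x 0 \<noteq> 0"
    proof (rule AE_PiM_component[where P="\<lambda>z. z \<noteq> 0"])
      show "AE z in gauss1. z \<noteq> 0"
        unfolding gauss1_def by (subst AE_density) (use AE_lborel_singleton[of "0::complex"] in auto)
    qed (use 0 in \<open>auto intro: prob_space_gauss1\<close>)
    then show "AE x in gauss_vec {..<N}. ennreal (norm_sq {..<N} x powr (0 / 2)) * 1 = 1"
    proof eventually_elim
      fix x :: "nat \<Rightarrow> complex" assume "x 0 \<noteq> 0"
      then have "norm_sq {..<N} x > 0"
        unfolding norm_sq_def using 0 by (intro sum_pos2[of _ 0]) auto
      then show "ennreal (norm_sq {..<N} x powr (0 / 2)) * 1 = 1" by simp
    qed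
  qed
  ultimately have "ennreal (V * N / pi ^ N * Gamma (N + 0 / 2)) = (\<integral>\<^sup>+x. 1 \<partial>gauss_vec {..<N})"
    by (simp only:)
  also have "\<dots> = 1" using emeasure_space_1 by (simp only: nn_integral_const mult_1)
  finally have "ennreal (V * N / pi ^ N * Gamma N) = 1" by (simp only: div_0 add_0_right)
  then have 1: "V * N / pi ^ N * Gamma N = 1"
    by (simp only: ennreal_eq_1)
  then have "V \<noteq> 0" by auto
  then show ?thesis using V by (intro that[OF _ V(2) 1]) auto
qed

lemma prob_space_uniform_sphere:
  assumes N: "N \<ge> 1"
  shows "prob_space (uniform_sphere N)"
proof -
  obtain V where V: "V > 0" "emeasure (lborel_vec {..<N}) (complex_unit_ball N) = ennreal V"
    using complex_unit_ball_volume[OF N] by metis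
  interpret U: prob_space "uniform_measure (lborel_vec {..<N}) (complex_unit_ball N)"
    by (rule prob_space_uniform_measure) (use V in auto)
  show ?thesis unfolding uniform_sphere_def
    by (rule U.prob_space_distr) simp
qed

lemma sets_uniform_sphere [measurable_cong, simp]: "sets (uniform_sphere N) = sets (lborel_vec {..<N})"
  by (simp add: uniform_sphere_def)

text \<open>A standard complex Gaussian vector is the product of a uniform point of the sphere and an
  independent radius.\<close>

lemma nn_integral_gauss_vec_polar:
  assumes N: "N \<ge> 1" and q: "q \<ge> (0::real)"
    and [measurable]: "\<Psi> \<in> borel_measurable (lborel_vec {..<N})" and b: "\<And>x. x \<in> space (lborel_vec {..<N}) \<Longrightarrow> \<Psi> (sphere_proj N x) \<le> ennreal b"
  shows "(\<integral>\<^sup>+x. ennreal (norm_sq {..<N} x powr (q / 2)) * \<Psi> (sphere_proj N x) \<partial>gauss_vec {..<N})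
    = ennreal (Gamma (N + q / 2) / Gamma N) * (\<integral>\<^sup>+x. \<Psi> x \<partial>uniform_sphere N)"
proof -
  let ?L = "lborel_vec {..<N}" let ?B = "complex_unit_ball N"
  obtain V :: real where V: "V > 0" "emeasure ?L ?B = ennreal V" "V * N / pi ^ N * Gamma N = 1"
    using complex_unit_ball_volume[OF N] by metis
  have "(\<integral>\<^sup>+x. \<Psi> (sphere_proj N x) * indicator ?B x \<partial>?L) \<le> (\<integral>\<^sup>+x. ennreal b * indicator ?B x \<partial>?L)"
    using b by (intro nn_integral_mono mult_right_mono) auto
  also have "\<dots> = ennreal b * ennreal V" using V by (simp add: nn_integral_cmult_indicator)
  also have "\<dots> < \<infinity>" by (simp add: ennreal_mult_less_top)
  finally obtain c :: real where c: "c \<ge> 0" "(\<integral>\<^sup>+x. \<Psi> (sphere_proj N x) * indicator ?B x \<partial>?L) = ennreal c"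
    by (cases "(\<integral>\<^sup>+x. \<Psi> (sphere_proj N x) * indicator ?B x \<partial>?L)") auto
  have meas: "sphere_proj N \<in> uniform_measure ?L ?B \<rightarrow>\<^sub>M ?L"
    using measurable_sphere_proj by (simp add: measurable_def)
  have "(\<integral>\<^sup>+x. \<Psi> x \<partial>uniform_sphere N) = (\<integral>\<^sup>+x. \<Psi> (sphere_proj N x) \<partial>uniform_measure ?L ?B)"
    unfolding uniform_sphere_def sphere_proj_def[abs_def, symmetric, folded norm_sq_def] norm_sq_def[symmetric]
    by (subst nn_integral_distr) (use meas in \<open>auto simp: sphere_proj_def[abs_def]\<close>)
  also have "\<dots> = ennreal c / ennreal V"
    by (subst nn_integral_uniform_measure) (auto simp: c V)
  also have "\<dots> = ennreal (c / V)" using c V by (simp add: divide_ennreal)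
  finally have s: "(\<integral>\<^sup>+x. \<Psi> x \<partial>uniform_sphere N) = ennreal (c / V)" .
  have "Gamma N > 0" using N by simp
  then have "c * N / pi ^ N * Gamma (N + q / 2) = Gamma (N + q / 2) / Gamma N * (c / V)"
    using V N by (simp add: field_simps)
  then show ?thesis unfolding s using nn_integral_polar[OF N q _ c(2) c(1)] N q V c
    by (subst ennreal_mult[symmetric]) auto
qed

section \<open>Rotations and linear forms of Gaussian vectors\<close>

lemma cmod_rotate:
  "(cmod (a * x + b * y))\<^sup>2 + (cmod (- cnj b * x + cnj a * y))\<^sup>2
     = ((cmod a)\<^sup>2 + (cmod b)\<^sup>2) * ((cmod x)\<^sup>2 + (cmod y)\<^sup>2)"
  unfolding cmod_power2 by (simp add: power2_eq_square) (simp add: algebra_simps)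

text \<open>The product density depends only on \<open>norm_sq I x + norm_sq I y\<close>, which a
  unitary mixing of the two vectors preserves.\<close>

lemma nn_integral_gauss_vec_rotate:
  assumes I: "finite I" and f [measurable]: "f \<in> borel_measurable (lborel_vec I \<Otimes>\<^sub>M lborel_vec I)"
    and ab: "(cmod a)\<^sup>2 + (cmod b)\<^sup>2 = 1"
  shows "(\<integral>\<^sup>+p. f p \<partial>(gauss_vec I \<Otimes>\<^sub>M gauss_vec I))
    = (\<integral>\<^sup>+p. f (lincomb I a b (fst p) (snd p), lincomb I (- cnj b) (cnj a) (fst p) (snd p)) \<partial>(gauss_vec I \<Otimes>\<^sub>M gauss_vec I))"
proof -
  define w where "w x = ennreal (exp (- norm_sq I x) / pi ^ card I)" for x
  have [measurable]: "w \<in> borel_measurable (lborel_vec I)" unfolding w_def by measurable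
  have g: "gauss_vec I = density (lborel_vec I) w"
    unfolding w_def by (rule gauss_vec_eq_density[OF I])
  have "gauss_vec I \<Otimes>\<^sub>M gauss_vec I = density (lborel_vec I \<Otimes>\<^sub>M lborel_vec I) (\<lambda>(x, y). w x * w y)"
    unfolding g
  proof (rule pair_measure_density)
    show "sigma_finite_measure (density (lborel_vec I) w)"
      using gauss1_product.sigma_finite[OF I] unfolding g .
  qed (use I sigma_finite_lborel_vec in auto)
  then have G: "(\<integral>\<^sup>+p. h p \<partial>(gauss_vec I \<Otimes>\<^sub>M gauss_vec I)) = (\<integral>\<^sup>+p. w (fst p) * w (snd p) * h p \<partial>(lborel_vec I \<Otimes>\<^sub>M lborel_vec I))"
    if [measurable]: "h \<in> borel_measurable (lborel_vec I \<Otimes>\<^sub>M lborel_vec I)" for h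
    by (simp add: nn_integral_density case_prod_unfold)
  have inv: "w (lincomb I a b x y) * w (lincomb I (- cnj b) (cnj a) x y) = w x * w y" for x y
  proof -
    have "norm_sq I (lincomb I a b x y) + norm_sq I (lincomb I (- cnj b) (cnj a) x y)
      = (\<Sum>j\<in>I. (cmod (a * x j + b * y j))\<^sup>2 + (cmod (- cnj b * x j + cnj a * y j))\<^sup>2)"
      by (simp add: norm_sq_def lincomb_def sum.distrib)
    also have "\<dots> = norm_sq I x + norm_sq I y"
      by (subst cmod_rotate) (simp add: ab norm_sq_def sum.distrib)
    finally have *: "- norm_sq I (lincomb I a b x y) + - norm_sq I (lincomb I (- cnj b) (cnj a) x y) = - norm_sq I x + - norm_sq I y"
      by simp
    have "exp (- norm_sq I (lincomb I a b x y)) * exp (- norm_sq I (lincomb I (- cnj b) (cnj a) x y))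
       = exp (- norm_sq I x) * exp (- norm_sq I y)"
      unfolding exp_add[symmetric] * by simp
    then show ?thesis
      unfolding w_def by (simp add: flip: ennreal_mult)
  qed
  have "(\<integral>\<^sup>+p. f p \<partial>(gauss_vec I \<Otimes>\<^sub>M gauss_vec I)) = (\<integral>\<^sup>+p. w (fst p) * w (snd p) * f p \<partial>(lborel_vec I \<Otimes>\<^sub>M lborel_vec I))"
    by (rule G) measurable
  also have "\<dots> = (\<integral>\<^sup>+p. w (fst p) * w (snd p) * f (lincomb I a b (fst p) (snd p), lincomb I (- cnj b) (cnj a) (fst p) (snd p)) \<partial>(lborel_vec I \<Otimes>\<^sub>M lborel_vec I))"
    by (subst nn_integral_lborel_vec_rotate[OF I _ ab]) (simp_all only: fst_conv snd_conv inv, measurable)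
  also have "\<dots> = (\<integral>\<^sup>+p. f (lincomb I a b (fst p) (snd p), lincomb I (- cnj b) (cnj a) (fst p) (snd p)) \<partial>(gauss_vec I \<Otimes>\<^sub>M gauss_vec I))"
    by (rule G[symmetric]) measurable
  finally show ?thesis .
qed

text \<open>Rotation by \<open>u\<close> is the first component of the determinant-one map with
  diagonal entries \<open>u\<close> and \<open>cnj u\<close>. The second component carries the
  indicator of the unit disc, which is invariant, and its area \<open>pi\<close>, finite and
  nonzero, cancels.\<close>

lemma nn_integral_lborel_rotate:
  fixes u :: complex
  assumes u: "cmod u = 1" and [measurable]: "\<phi> \<in> borel_measurable borel"
  shows "(\<integral>\<^sup>+z. \<phi> (u * z) \<partial>lborel) = (\<integral>\<^sup>+z. \<phi> z \<partial>lborel)"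
proof -
  let ?I = "{0::nat}" and ?D = "cball (0::complex) 1"
  interpret M: sigma_finite_measure "lborel_vec ?I" by (rule sigma_finite_lborel_vec) simp
  have [measurable]: "?D \<in> sets borel" by simp
  have sing: "(\<integral>\<^sup>+x. g (x 0) \<partial>lborel_vec ?I) = (\<integral>\<^sup>+z. g z \<partial>lborel)" if "g \<in> borel_measurable borel" for g :: "complex \<Rightarrow> ennreal"
    using that by (intro lborel_product.product_nn_integral_singleton) auto
  have P: "(\<integral>\<^sup>+p. g (fst p 0) * indicator ?D (snd p 0) \<partial>(lborel_vec ?I \<Otimes>\<^sub>M lborel_vec ?I)) = (\<integral>\<^sup>+z. g z \<partial>lborel) * ennreal pi"
    if [measurable]: "g \<in> borel_measurable borel" for g :: "complex \<Rightarrow> ennreal"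
  proof -
    have "(\<integral>\<^sup>+p. g (fst p 0) * indicator ?D (snd p 0) \<partial>(lborel_vec ?I \<Otimes>\<^sub>M lborel_vec ?I))
      = (\<integral>\<^sup>+x. \<integral>\<^sup>+y. g (x 0) * indicator ?D (y 0) \<partial>lborel_vec ?I \<partial>lborel_vec ?I)"
      by (subst M.nn_integral_fst[symmetric]) auto
    also have "\<dots> = (\<integral>\<^sup>+x. g (x 0) * ennreal pi \<partial>lborel_vec ?I)"
      by (intro nn_integral_cong, subst nn_integral_cmult, simp, subst sing)
        (auto simp: emeasure_cball unit_ball_vol_2)
    also have "\<dots> = (\<integral>\<^sup>+z. g z * ennreal pi \<partial>lborel)" by (rule sing) measurable
    finally show ?thesis by (simp add: nn_integral_multc)
  qed
  have "(\<integral>\<^sup>+z. \<phi> z \<partial>lborel) * ennreal pi = (\<integral>\<^sup>+p. \<phi> (fst p 0) * indicator ?D (snd p 0) \<partial>(lborel_vec ?I \<Otimes>\<^sub>M lborel_vec ?I))"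
    by (rule P[symmetric]) measurable
  also have "\<dots> = (\<integral>\<^sup>+p. \<phi> (lincomb ?I u 0 (fst p) (snd p) 0) * indicator ?D (lincomb ?I (- cnj 0) (cnj u) (fst p) (snd p) 0) \<partial>(lborel_vec ?I \<Otimes>\<^sub>M lborel_vec ?I))"
    by (subst nn_integral_lborel_vec_rotate[where a=u and b=0]) (use u in auto)
  also have "\<dots> = (\<integral>\<^sup>+p. \<phi> (u * fst p 0) * indicator ?D (snd p 0) \<partial>(lborel_vec ?I \<Otimes>\<^sub>M lborel_vec ?I))"
    using u by (intro nn_integral_cong) (simp add: lincomb_def indicator_def norm_mult)
  also have "\<dots> = (\<integral>\<^sup>+z. \<phi> (u * z) \<partial>lborel) * ennreal pi" by (rule P) measurable
  finally show ?thesis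
    using ennreal_mult_cancel_left[of "ennreal pi"] by (simp add: mult.commute)
qed

text \<open>Divided by the length of the vector \<open>(a, b)\<close>, the combination is the first
  component of a rotated pair of independent Gaussian variables.\<close>

lemma nn_integral_gauss1_comb:
  assumes [measurable]: "\<phi> \<in> borel_measurable borel"
  shows "(\<integral>\<^sup>+u. \<integral>\<^sup>+v. \<phi> (a * u + b * v) \<partial>gauss1 \<partial>gauss1)
           = (\<integral>\<^sup>+u. \<phi> (of_real (sqrt ((cmod a)\<^sup>2 + (cmod b)\<^sup>2)) * u) \<partial>gauss1)"
proof -
  define s where "s = sqrt ((cmod a)\<^sup>2 + (cmod b)\<^sup>2)"
  show ?thesis
  proof (cases "s = 0")
    case True
    then have "a = 0" "b = 0" by (auto simp: s_def add_nonneg_eq_0_iff)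
    then show ?thesis using gauss1.emeasure_space_1 by simp
  next
    case False
    let ?I = "{0::nat}"
    interpret M: sigma_finite_measure "gauss_vec ?I" by (rule gauss1_product.sigma_finite) simp
    have sing: "(\<integral>\<^sup>+x. g (x 0) \<partial>gauss_vec ?I) = (\<integral>\<^sup>+z. g z \<partial>gauss1)" if "g \<in> borel_measurable borel" for g :: "complex \<Rightarrow> ennreal"
      using that by (intro gauss1_product.product_nn_integral_singleton) auto
    have s1: "(cmod (a / of_real s))\<^sup>2 + (cmod (b / of_real s))\<^sup>2 = 1"
    proof -
      have "s\<^sup>2 = (cmod a)\<^sup>2 + (cmod b)\<^sup>2" by (simp add: s_def)
      moreover have "s > 0" using False by (simp add: s_def less_le)
      moreover have "(cmod (a / of_real s))\<^sup>2 + (cmod (b / of_real s))\<^sup>2 = ((cmod a)\<^sup>2 + (cmod b)\<^sup>2) / s\<^sup>2"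
        by (simp add: norm_divide power_divide add_divide_distrib)
      ultimately have "(cmod (a / of_real s))\<^sup>2 + (cmod (b / of_real s))\<^sup>2 = s\<^sup>2 / s\<^sup>2" by (simp only:)
      then show ?thesis using \<open>s > 0\<close> by simp
    qed
    have "(\<integral>\<^sup>+u. \<phi> (of_real s * u) \<partial>gauss1) = (\<integral>\<^sup>+x. \<integral>\<^sup>+y. \<phi> (of_real s * x 0) \<partial>gauss_vec ?I \<partial>gauss_vec ?I)"
    proof -
      interpret prob_space "gauss_vec ?I" by (rule prob_space_PiM) (rule prob_space_gauss1)
      show ?thesis using sing[of "\<lambda>u. \<phi> (of_real s * u)"] emeasure_space_1 by simp
    qed
    also have "\<dots> = (\<integral>\<^sup>+p. \<phi> (of_real s * fst p 0) \<partial>(gauss_vec ?I \<Otimes>\<^sub>M gauss_vec ?I))"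
      by (subst M.nn_integral_fst[symmetric]) auto
    also have "\<dots> = (\<integral>\<^sup>+p. \<phi> (of_real s * lincomb ?I (a / of_real s) (b / of_real s) (fst p) (snd p) 0) \<partial>(gauss_vec ?I \<Otimes>\<^sub>M gauss_vec ?I))"
      by (subst nn_integral_gauss_vec_rotate[OF _ _ s1]) auto
    also have "\<dots> = (\<integral>\<^sup>+p. \<phi> (a * fst p 0 + b * snd p 0) \<partial>(gauss_vec ?I \<Otimes>\<^sub>M gauss_vec ?I))"
      using False by (intro nn_integral_cong) (simp add: lincomb_def distrib_left)
    also have "\<dots> = (\<integral>\<^sup>+x. \<integral>\<^sup>+y. \<phi> (a * x 0 + b * y 0) \<partial>gauss_vec ?I \<partial>gauss_vec ?I)"
      by (subst M.nn_integral_fst[symmetric]) auto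
    also have "\<dots> = (\<integral>\<^sup>+x. \<integral>\<^sup>+v. \<phi> (a * x 0 + b * v) \<partial>gauss1 \<partial>gauss_vec ?I)"
      by (intro nn_integral_cong sing) measurable
    also have "\<dots> = (\<integral>\<^sup>+u. \<integral>\<^sup>+v. \<phi> (a * u + b * v) \<partial>gauss1 \<partial>gauss1)"
      by (rule sing) measurable
    finally show ?thesis by (simp add: s_def)
  qed
qed

text \<open>Induction over the coordinates: the partial sum is a scaled Gaussian variable
  independent of the next coordinate, and \<open>nn_integral_gauss1_comb\<close> merges the
  two.\<close>

lemma nn_integral_gauss_vec_sum:
  assumes "finite I" and "\<phi> \<in> borel_measurable borel"
  shows "(\<integral>\<^sup>+x. \<phi> (\<Sum>j\<in>I. c j * x j) \<partial>gauss_vec I) = (\<integral>\<^sup>+u. \<phi> (of_real (sqrt (norm_sq I c)) * u) \<partial>gauss1)"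
  using assms
proof (induction I arbitrary: \<phi>)
  case empty
  then show ?case using gauss1.emeasure_space_1
    by (simp add: norm_sq_def PiM_empty nn_integral_count_space_finite)
next
  case (insert i I)
  note insert.prems [measurable]
  have "(\<integral>\<^sup>+x. \<phi> (\<Sum>j\<in>insert i I. c j * x j) \<partial>gauss_vec (insert i I))
     = (\<integral>\<^sup>+x. \<integral>\<^sup>+y. \<phi> (\<Sum>j\<in>insert i I. c j * (x(i := y)) j) \<partial>gauss1 \<partial>gauss_vec I)"
    using insert.hyps by (intro gauss1_product.product_nn_integral_insert) auto
  also have "\<dots> = (\<integral>\<^sup>+x. \<integral>\<^sup>+y. \<phi> ((\<Sum>j\<in>I. c j * x j) + c i * y) \<partial>gauss1 \<partial>gauss_vec I)"
  proof (intro nn_integral_cong arg_cong[where f=\<phi>])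
    fix x y
    have "(\<Sum>j\<in>I. c j * (x(i := y)) j) = (\<Sum>j\<in>I. c j * x j)"
      using insert.hyps by (intro sum.cong) auto
    then show "(\<Sum>j\<in>insert i I. c j * (x(i := y)) j) = (\<Sum>j\<in>I. c j * x j) + c i * y"
      using insert.hyps by (simp add: add.commute)
  qed
  also have "\<dots> = (\<integral>\<^sup>+u. \<integral>\<^sup>+y. \<phi> (of_real (sqrt (norm_sq I c)) * u + c i * y) \<partial>gauss1 \<partial>gauss1)"
    by (rule insert.IH) measurable
  also have "\<dots> = (\<integral>\<^sup>+u. \<phi> (of_real (sqrt ((cmod (of_real (sqrt (norm_sq I c))))\<^sup>2 + (cmod (c i))\<^sup>2)) * u) \<partial>gauss1)"
    by (rule nn_integral_gauss1_comb) measurable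
  finally show ?case using insert.hyps by (simp add: norm_sq_def add.commute sum_nonneg)
qed

lemma gauss_vec_sum_moment:
  assumes "finite I" and q: "q \<ge> (0::real)"
  shows "(\<integral>\<^sup>+x. ennreal (cmod (\<Sum>j\<in>I. c j * x j) powr q) \<partial>gauss_vec I)
    = ennreal (norm_sq I c powr (q / 2) * Gamma (q / 2 + 1))"
proof -
  have "(\<integral>\<^sup>+x. ennreal (cmod (\<Sum>j\<in>I. c j * x j) powr q) \<partial>gauss_vec I)
    = (\<integral>\<^sup>+u. ennreal (cmod (of_real (sqrt (norm_sq I c)) * u) powr q) \<partial>gauss1)"
    by (rule nn_integral_gauss_vec_sum[OF assms(1)]) measurable
  also have "\<dots> = (\<integral>\<^sup>+u. ennreal (norm_sq I c powr (q / 2)) * ennreal (cmod u powr q) \<partial>gauss1)"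
    by (intro nn_integral_cong) (simp add: norm_mult powr_mult powr_sqrt_eq flip: ennreal_mult)
  also have "\<dots> = ennreal (norm_sq I c powr (q / 2)) * ennreal (Gamma (q / 2 + 1))"
    by (subst nn_integral_cmult) (auto simp: gauss1_moment[OF q])
  finally show ?thesis using q by (simp add: ennreal_mult)
qed

section \<open>Elementary inequalities\<close>

text \<open>The tangent line inequality of the convex function \<open>t powr p\<close> at
  \<open>a\<close>, evaluated at \<open>b\<close>. The power mean, Jensen and Hoelder inequalities
  below are all sums or integrals of it.\<close>

lemma powr_tangent:
  fixes p a b :: real
  assumes p: "p > 1" and a: "a \<ge> 0" and b: "b \<ge> 0"
  shows "p * (a powr (p - 1) * b) \<le> (p - 1) * a powr p + b powr p"
proof -
  have "a powr (p - 1) * b \<le> (a powr (p - 1)) powr (p / (p - 1)) / (p / (p - 1)) + b powr p / p"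
    using p b by (intro Youngs_inequality) (auto simp: field_simps)
  also have "(a powr (p - 1)) powr (p / (p - 1)) = a powr p"
    using p by (simp add: powr_powr)
  finally show ?thesis using p by (simp add: field_simps)
qed

lemma powr_sum_le:
  fixes x :: "nat \<Rightarrow> real"
  assumes p: "p > 1" and n: "n \<ge> 1" and x: "\<And>i. i < n \<Longrightarrow> 0 \<le> x i"
  shows "(\<Sum>i<n. x i) powr p \<le> real n powr (p - 1) * (\<Sum>i<n. x i powr p)"
proof -
  define A where "A = (\<Sum>i<n. x i) / n"
  have A: "A \<ge> 0" unfolding A_def using x by (intro divide_nonneg_nonneg sum_nonneg) auto
  have s: "(\<Sum>i<n. x i) = n * A" using n by (simp add: A_def)
  have AA: "A powr (p - 1) * A = A powr p"
    using A by (cases "A = 0") (auto simp: powr_mult_base mult.commute)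
  have "(\<Sum>i<n. p * (A powr (p - 1) * x i)) \<le> (\<Sum>i<n. (p - 1) * A powr p + x i powr p)"
    using x by (intro sum_mono powr_tangent p A) auto
  then have le: "p * (A powr (p - 1) * (n * A)) \<le> n * ((p - 1) * A powr p) + (\<Sum>i<n. x i powr p)"
    by (simp add: sum.distrib s flip: sum_distrib_left)
  have "p * (A powr (p - 1) * (n * A)) = p * n * (A powr (p - 1) * A)" by (simp only: mult_ac)
  also have "\<dots> = p * n * A powr p" by (simp only: AA)
  finally have "p * n * A powr p \<le> n * ((p - 1) * A powr p) + (\<Sum>i<n. x i powr p)" using le by (simp only:)
  then have *: "n * A powr p \<le> (\<Sum>i<n. x i powr p)" by (simp add: algebra_simps)
  have "(\<Sum>i<n. x i) powr p = n powr p * A powr p" unfolding s using A by (simp add: powr_mult)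
  also have "\<dots> = n powr (p - 1) * (n * A powr p)" using n by (simp add: powr_diff)
  also have "\<dots> \<le> n powr (p - 1) * (\<Sum>i<n. x i powr p)" using * by (intro mult_left_mono) auto
  finally show ?thesis .
qed

lemma powr_add_le:
  fixes a b p :: real
  assumes "p > 1" "a \<ge> 0" "b \<ge> 0"
  shows "(a + b) powr p \<le> 2 powr (p - 1) * (a powr p + b powr p)"
  using powr_sum_le[of p 2 "\<lambda>i. if i = 0 then a else b"] assms by (simp add: numeral_2_eq_2 add.commute)

text \<open>Convexity of the p-th power at the average of \<open>1\<close> and \<open>W / w\<close>
  with weights \<open>m / (m + w)\<close> and \<open>w / (m + w)\<close>. The right side is affine
  in \<open>W powr p\<close>, so it can be integrated over a random \<open>W\<close>; if the p-th
  moment of \<open>W\<close> is at most \<open>w powr p\<close>, the outcome is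
  \<open>(m + w) powr p\<close>. This takes the place of Minkowski's inequality.\<close>

lemma powr_add_le_weighted:
  fixes m W w p :: real
  assumes p: "p > 1" and m: "m \<ge> 0" and W: "W \<ge> 0" and w: "w > 0"
  shows "(m + W) powr p \<le> (m + w) powr (p - 1) * (m + w powr (1 - p) * W powr p)"
proof -
  define s A where "s = m + w" and "A = m + W"
  have s: "s > 0" and A: "A \<ge> 0" using assms by (auto simp: s_def A_def)
  have AA: "A powr (p - 1) * A = A powr p"
    using A by (cases "A = 0") (auto simp: powr_mult_base mult.commute)
  have 1: "p * (A powr (p - 1) * s) \<le> (p - 1) * A powr p + s powr p"
    using s A p by (intro powr_tangent) auto
  have 2: "p * (A powr (p - 1) * (s * W / w)) \<le> (p - 1) * A powr p + (s * W / w) powr p"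
    using s A p w W by (intro powr_tangent) auto
  have "m * (p * (A powr (p - 1) * s)) + w * (p * (A powr (p - 1) * (s * W / w)))
    \<le> m * ((p - 1) * A powr p + s powr p) + w * ((p - 1) * A powr p + (s * W / w) powr p)"
    using 1 2 m w by (intro add_mono mult_left_mono) auto
  moreover have "m * (p * (A powr (p - 1) * s)) + w * (p * (A powr (p - 1) * (s * W / w))) = p * s * (A powr (p - 1) * A)"
    using w by (simp add: A_def algebra_simps)
  ultimately have "s * A powr p \<le> m * s powr p + w * (s * W / w) powr p"
    unfolding AA by (simp add: s_def algebra_simps)
  also have "w * (s * W / w) powr p = s powr p * (w powr (1 - p) * W powr p)"
    using s w W by (simp add: powr_mult powr_divide powr_diff)
  also have "m * s powr p + s powr p * (w powr (1 - p) * W powr p) = s * (s powr (p - 1) * (m + w powr (1 - p) * W powr p))"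
    using s by (simp add: powr_diff algebra_simps)
  finally have "A powr p \<le> s powr (p - 1) * (m + w powr (1 - p) * W powr p)"
    using s by simp
  then show ?thesis by (simp add: A_def s_def)
qed

text \<open>The tangent line inequality at the mean, integrated. The right side is a nonnegative
  integral so that it may be infinite.\<close>

lemma jensen_powr_nn_integral:
  assumes M: "prob_space M" and p: "p > 1" and D: "integrable M D" "\<And>x. x \<in> space M \<Longrightarrow> 0 \<le> D x"
  shows "ennreal ((\<integral>x. D x \<partial>M) powr p) \<le> (\<integral>\<^sup>+x. ennreal (D x powr p) \<partial>M)"
proof -
  interpret prob_space M by (rule M)
  note [measurable] = borel_measurable_integrable[OF D(1)]
  define c where "c = (\<integral>x. D x \<partial>M)"
  have c: "c \<ge> 0" unfolding c_def using D by (intro integral_nonneg_AE) auto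
  have ell_coeff: "c powr (p - 1) * c = c powr p"
    using c by (cases "c = 0") (auto simp: powr_mult_base mult.commute)
  have nn: "(\<integral>\<^sup>+x. ennreal (D x) \<partial>M) = ennreal c"
    unfolding c_def using D by (intro nn_integral_eq_integral) auto
  have "ennreal (p * c powr p) = ennreal (p * c powr (p - 1)) * ennreal c"
    using p c by (simp add: ell_coeff mult.assoc flip: ennreal_mult)
  also have "\<dots> = (\<integral>\<^sup>+x. ennreal (p * c powr (p - 1)) * ennreal (D x) \<partial>M)"
    by (subst nn_integral_cmult) (auto simp: nn)
  also have "\<dots> \<le> (\<integral>\<^sup>+x. ennreal ((p - 1) * c powr p) + ennreal (D x powr p) \<partial>M)"
    using powr_tangent[OF p c] D(2) p
    by (intro nn_integral_mono) (auto simp: mult.assoc simp flip: ennreal_mult ennreal_plus intro!: ennreal_leI)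
  also have "\<dots> = ennreal ((p - 1) * c powr p) + (\<integral>\<^sup>+x. ennreal (D x powr p) \<partial>M)"
    by (subst nn_integral_add) (auto simp: emeasure_space_1)
  finally have "ennreal (p * c powr p) \<le> ennreal ((p - 1) * c powr p) + (\<integral>\<^sup>+x. ennreal (D x powr p) \<partial>M)" .
  moreover have "ennreal (p * c powr p) = ennreal ((p - 1) * c powr p) + ennreal (c powr p)"
    using p mult_right_mono[of 1 p "c powr p"] by (subst ennreal_plus[symmetric]) (auto simp: left_diff_distrib)
  ultimately show ?thesis
    unfolding c_def[symmetric] by (simp add: ennreal_add_left_cancel_le)
qed

text \<open>The conjugate exponents are \<open>p / (p - 1)\<close> and \<open>p\<close>: normalise
  both factors and integrate \<open>powr_tangent\<close>. The power \<open>p - 1\<close> is the one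
  that occurs in the norming functional.\<close>

lemma Holder_powr:
  fixes u v :: "'a \<Rightarrow> real"
  assumes p: "p > 1" and [measurable]: "u \<in> borel_measurable M" "v \<in> borel_measurable M"
    and nn: "\<And>x. u x \<ge> 0" "\<And>x. v x \<ge> 0"
    and int: "integrable M (\<lambda>x. u x powr p)" "integrable M (\<lambda>x. v x powr p)"
  shows "integrable M (\<lambda>x. u x powr (p - 1) * v x)"
    and "(\<integral>x. u x powr (p - 1) * v x \<partial>M) \<le> (\<integral>x. u x powr p \<partial>M) powr (1 - 1 / p) * (\<integral>x. v x powr p \<partial>M) powr (1 / p)"
proof -
  show I: "integrable M (\<lambda>x. u x powr (p - 1) * v x)"
  proof (rule Bochner_Integration.integrable_bound)
    show "integrable M (\<lambda>x. (p - 1) * u x powr p + v x powr p)" using int by auto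
    show "AE x in M. norm (u x powr (p - 1) * v x) \<le> norm ((p - 1) * u x powr p + v x powr p)"
    proof (rule AE_I2)
      fix x
      have "u x powr (p - 1) * v x \<le> p * (u x powr (p - 1) * v x)"
        using p nn mult_right_mono[of 1 p "u x powr (p - 1) * v x"] by auto
      then show "norm (u x powr (p - 1) * v x) \<le> norm ((p - 1) * u x powr p + v x powr p)"
        using powr_tangent[OF p nn(1)[of x] nn(2)[of x]] nn p by (simp add: abs_mult)
    qed
  qed measurable
  define U V where "U = (\<integral>x. u x powr p \<partial>M)" and "V = (\<integral>x. v x powr p \<partial>M)"
  have UV: "U \<ge> 0" "V \<ge> 0" unfolding U_def V_def by auto
  show "(\<integral>x. u x powr (p - 1) * v x \<partial>M) \<le> U powr (1 - 1 / p) * V powr (1 / p)"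
  proof (cases "U = 0 \<or> V = 0")
    case True
    then have "AE x in M. u x powr (p - 1) * v x = 0"
    proof
      assume "U = 0"
      then have "AE x in M. u x powr p = 0" unfolding U_def using int by (subst (asm) integral_nonneg_eq_0_iff_AE) auto
      then show ?thesis by eventually_elim auto
    next
      assume "V = 0"
      then have "AE x in M. v x powr p = 0" unfolding V_def using int by (subst (asm) integral_nonneg_eq_0_iff_AE) auto
      then show ?thesis by eventually_elim auto
    qed
    then have "(\<integral>x. u x powr (p - 1) * v x \<partial>M) = 0" by (subst integral_cong_AE[where g="\<lambda>_. 0"]) auto
    then show ?thesis by simp
  next
    case False
    then have pos: "U > 0" "V > 0" using UV by auto
    define a b where "a = U powr (1 / p)" and "b = V powr (1 / p)"
    have ab: "a > 0" "b > 0" "a powr p = U" "b powr p = V" "a powr (p - 1) = U powr (1 - 1 / p)"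
      using pos p by (auto simp: a_def b_def powr_powr diff_divide_distrib)
    have "(\<integral>x. p * ((u x / a) powr (p - 1) * (v x / b)) \<partial>M) \<le> (\<integral>x. (p - 1) * (u x / a) powr p + (v x / b) powr p \<partial>M)"
    proof (rule integral_mono)
      fix x show "p * ((u x / a) powr (p - 1) * (v x / b)) \<le> (p - 1) * (u x / a) powr p + (v x / b) powr p"
        using nn ab by (intro powr_tangent p) auto
    qed (use ab nn I int in \<open>auto simp: powr_divide\<close>)
    also have "(\<integral>x. (p - 1) * (u x / a) powr p + (v x / b) powr p \<partial>M) = (p - 1) * U / U + V / V"
      using nn ab int by (simp add: powr_divide U_def V_def)
    also have "\<dots> = p" using pos by simp
    also have "(\<integral>x. p * ((u x / a) powr (p - 1) * (v x / b)) \<partial>M) = p * ((\<integral>x. u x powr (p - 1) * v x \<partial>M) / (a powr (p - 1) * b))"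
      using nn ab by (simp add: powr_divide)
    finally have "p * ((\<integral>x. u x powr (p - 1) * v x \<partial>M) / (a powr (p - 1) * b)) \<le> p * 1" by simp
    then have "(\<integral>x. u x powr (p - 1) * v x \<partial>M) / (a powr (p - 1) * b) \<le> 1"
      using p by (simp only: mult_le_cancel_left_pos)
    then have "(\<integral>x. u x powr (p - 1) * v x \<partial>M) \<le> a powr (p - 1) * b"
      using ab by (subst (asm) divide_le_eq_1_pos) auto
    then show ?thesis using ab(5) by (simp add: b_def)
  qed
qed

section \<open>Inequalities for the Gamma function\<close>

text \<open>Log-convexity: \<open>x + s\<close> and \<open>y\<close> lie between \<open>x\<close>
  and \<open>y + s\<close>, and the two pairs have the same sum.\<close>

lemma Gamma_increment_mono:
  fixes x y s :: real
  assumes x: "0 < x" and xy: "x \<le> y" and s: "0 \<le> s"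
  shows "Gamma (x + s) * Gamma y \<le> Gamma x * Gamma (y + s)"
proof (cases "y - x + s = 0")
  case True
  then have "s = 0" "x = y" using xy s by auto
  then show ?thesis by simp
next
  case False
  define d where "d = y - x + s"
  define t where "t = s / d"
  have d: "d > 0" using False xy s by (simp add: d_def)
  have t: "0 \<le> t" "t \<le> 1" and td: "t * d = s" using d s xy by (auto simp: t_def d_def field_simps)
  have conv: "convex_on {0<..} (ln \<circ> Gamma :: real \<Rightarrow> real)" by (rule log_convex_Gamma_real)
  have a: "ln (Gamma ((1 - t) * x + t * (y + s))) \<le> (1 - t) * ln (Gamma x) + t * ln (Gamma (y + s))"
    using convex_onD[OF conv t(1) t(2), of x "y + s"] x xy s by simp
  have b: "ln (Gamma ((1 - (1 - t)) * x + (1 - t) * (y + s))) \<le> (1 - (1 - t)) * ln (Gamma x) + (1 - t) * ln (Gamma (y + s))"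
    using convex_onD[OF conv, of "1 - t" x "y + s"] x xy s t by simp
  have e1: "(1 - t) * x + t * (y + s) = x + s"
  proof -
    have "(1 - t) * x + t * (y + s) = x + t * d" by (simp add: d_def algebra_simps)
    then show ?thesis by (simp add: td)
  qed
  have e2: "(1 - (1 - t)) * x + (1 - t) * (y + s) = y"
  proof -
    have "(1 - (1 - t)) * x + (1 - t) * (y + s) = y + s - t * d" by (simp add: d_def algebra_simps)
    then show ?thesis by (simp add: td)
  qed
  have pos: "Gamma x > 0" "Gamma y > 0" "Gamma (x + s) > 0" "Gamma (y + s) > 0" using x xy s by auto
  have "ln (Gamma (x + s) * Gamma y) \<le> ln (Gamma x * Gamma (y + s))"
    using a b pos unfolding e1 e2 by (simp add: ln_mult algebra_simps)
  then show ?thesis using pos by simp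
qed

text \<open>The ratio of Gamma values over the first half step from \<open>x\<close> is at most the
  ratio over the second, and the product of the two is \<open>x\<close>.\<close>

lemma Gamma_half_le:
  fixes x :: real
  assumes x: "0 < x"
  shows "Gamma (x + 1 / 2) \<le> sqrt x * Gamma x"
proof -
  have "Gamma (x + 1 / 2) * Gamma (x + 1 / 2) \<le> Gamma x * Gamma (x + 1 / 2 + 1 / 2)"
    by (rule Gamma_increment_mono) (use x in auto)
  also have "x + 1 / 2 + 1 / 2 = x + 1" by simp
  also have "Gamma (x + 1) = x * Gamma x"
    using x Gamma_plus1[of x] by (simp add: nonpos_Ints_def)
  finally have "(Gamma (x + 1 / 2))\<^sup>2 \<le> (sqrt x * Gamma x)\<^sup>2"
    using x by (simp add: power_mult_distrib power2_eq_square algebra_simps)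
  then show ?thesis using x by (simp add: power2_le_iff_abs_le)
qed

text \<open>The slope of \<open>ln Gamma\<close> over the interval from \<open>x\<close> to
  \<open>x + 1\<close> is \<open>ln x\<close>, and by convexity the slope up to \<open>x + s\<close>
  is no smaller.\<close>

lemma Gamma_add_ge:
  fixes x s :: real
  assumes x: "0 < x" and s: "1 \<le> s"
  shows "x powr s * Gamma x \<le> Gamma (x + s)"
proof -
  have conv: "convex_on {0<..} (ln \<circ> Gamma :: real \<Rightarrow> real)" by (rule log_convex_Gamma_real)
  have "ln (Gamma ((1 - 1 / s) * x + 1 / s * (x + s))) \<le> (1 - 1 / s) * ln (Gamma x) + 1 / s * ln (Gamma (x + s))"
    using convex_onD[OF conv, of "1 / s" x "x + s"] x s by simp
  moreover have "(1 - 1 / s) * x + 1 / s * (x + s) = x + 1" using s by (simp add: field_simps)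
  moreover have "Gamma (x + 1) = x * Gamma x"
    using x Gamma_plus1[of x] by (simp add: nonpos_Ints_def)
  moreover have pos: "Gamma x > 0" "Gamma (x + s) > 0" using x s by auto
  moreover have "ln (x * Gamma x) = ln x + ln (Gamma x)" using x pos(1) by (intro ln_mult_pos)
  ultimately have "ln x + ln (Gamma x) \<le> (1 - 1 / s) * ln (Gamma x) + 1 / s * ln (Gamma (x + s))"
    by (simp only:)
  then have "s * ln x + ln (Gamma x) \<le> ln (Gamma (x + s))"
    using s by (simp add: field_simps)
  moreover have "ln (x powr s * Gamma x) = s * ln x + ln (Gamma x)"
    using x pos(1) by (subst ln_mult_pos) (auto simp: ln_powr)
  ultimately have "ln (x powr s * Gamma x) \<le> ln (Gamma (x + s))" by simp
  then show ?thesis using x pos by simp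
qed

lemma Gamma_le_one:
  fixes x :: real
  assumes "1 \<le> x" "x \<le> 2"
  shows "Gamma x \<le> 1"
proof -
  have conv: "convex_on {0<..} (ln \<circ> Gamma :: real \<Rightarrow> real)" by (rule log_convex_Gamma_real)
  have g: "Gamma (1::real) = 1" "Gamma (2::real) = 1"
    using Gamma_fact[of 0, where 'a=real] Gamma_fact[of 1, where 'a=real] by simp_all
  have "ln (Gamma ((1 - (x - 1)) * 1 + (x - 1) * 2)) \<le> (1 - (x - 1)) * ln (Gamma 1) + (x - 1) * ln (Gamma 2)"
    using convex_onD[OF conv, of "x - 1" 1 2] assms by simp
  then have "ln (Gamma x) \<le> 0" by (simp add: g algebra_simps)
  moreover have "Gamma x > 0" using assms by simp
  ultimately show ?thesis by simp
qed

text \<open>Induction over unit intervals. At the start \<open>Gamma x \<le> 1\<close> suffices, and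
  the functional equation carries the bound one unit to the right.\<close>

lemma Gamma_le_powr:
  fixes x :: real
  assumes "1 \<le> x"
  shows "Gamma (x + 1) \<le> x powr x"
proof -
  have "\<forall>x. 1 \<le> x \<and> x < 2 + real n \<longrightarrow> Gamma (x + 1) \<le> x powr x" for n
  proof (induction n)
    case 0
    show ?case
    proof (intro allI impI)
      fix x :: real assume x: "1 \<le> x \<and> x < 2 + real 0"
      have "Gamma (x + 1) = x * Gamma x" using x Gamma_plus1[of x] by (simp add: nonpos_Ints_def)
      also have "\<dots> \<le> x * 1" using x by (intro mult_left_mono Gamma_le_one) auto
      also have "\<dots> \<le> x powr x" using x powr_mono[of 1 x x] by simp
      finally show "Gamma (x + 1) \<le> x powr x" .
    qed
  next
    case (Suc n)
    show ?case
    proof (intro allI impI)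
      fix x :: real assume x: "1 \<le> x \<and> x < 2 + real (Suc n)"
      show "Gamma (x + 1) \<le> x powr x"
      proof (cases "x < 2 + real n")
        case True then show ?thesis using Suc x by auto
      next
        case False
        then have x2: "x \<ge> 2" by simp
        have "Gamma (x + 1) = x * Gamma x" using x Gamma_plus1[of x] by (simp add: nonpos_Ints_def)
        also have "Gamma x \<le> (x - 1) powr (x - 1)" using Suc[rule_format, of "x - 1"] x x2 by simp
        also have "\<dots> \<le> x powr (x - 1)" using x2 by (intro powr_mono2) auto
        also have "x * x powr (x - 1) = x powr x" using x2 by (simp add: powr_diff)
        finally show ?thesis using x2 by simp
      qed
    qed
  qed
  moreover obtain n where "x < 2 + real n" using reals_Archimedean2[of x] by (metis add.commute add_pos_pos less_add_same_cancel2 less_trans zero_less_numeral)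
  ultimately show ?thesis using assms by blast
qed

text \<open>This is the origin of the factor \<open>sqrt p\<close> in both error terms.\<close>

lemma Gamma_powr_le_sqrt:
  fixes p :: real
  assumes p: "2 \<le> p"
  shows "Gamma (p / 2 + 1) powr (1 / p) \<le> sqrt p"
proof -
  have "Gamma (p / 2 + 1) \<le> (p / 2) powr (p / 2)" using p by (intro Gamma_le_powr) auto
  also have "\<dots> \<le> p powr (p / 2)" using p by (intro powr_mono2) auto
  finally have "Gamma (p / 2 + 1) powr (1 / p) \<le> (p powr (p / 2)) powr (1 / p)"
    using p by (intro powr_mono2) auto
  also have "\<dots> = sqrt p" using p by (simp add: powr_powr powr_half_sqrt)
  finally show ?thesis .
qed

text \<open>Links the exact moment ratio, which contains \<open>N\<close>, to the one with
  \<open>N - 1/2\<close>. The two half steps change the quotient by a factor of at most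
  \<open>exp (3 * p / (4 * x))\<close>, and the p-th root turns this into
  \<open>1 + O(1 / x)\<close> uniformly in \<open>p\<close>.\<close>

lemma Gamma_shift_ratio:
  fixes p x :: real
  assumes p: "2 \<le> p" and x: "1 \<le> x"
  shows "(Gamma x / Gamma (x + p / 2)) powr (1 / p) \<le> (Gamma (x - 1 / 2) / Gamma (p / 2 + x - 1 / 2)) powr (1 / p)"
    and "(Gamma (x - 1 / 2) / Gamma (p / 2 + x - 1 / 2)) powr (1 / p) \<le> (Gamma x / Gamma (x + p / 2)) powr (1 / p) * (1 + 3 / (2 * x))"
proof -
  define y where "y = p / 2 + x - 1 / 2"
  have y: "y > 0" using p x by (simp add: y_def)
  have pos: "Gamma x > 0" "Gamma (x - 1 / 2) > 0" "Gamma y > 0" "Gamma (x + p / 2) > 0"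
    using p x y by auto
  have "Gamma (x - 1 / 2 + p / 2) * Gamma x \<le> Gamma (x - 1 / 2) * Gamma (x + p / 2)"
    by (rule Gamma_increment_mono) (use p x in auto)
  also have "x - 1 / 2 + p / 2 = y" by (simp add: y_def)
  finally have "Gamma x / Gamma (x + p / 2) \<le> Gamma (x - 1 / 2) / Gamma y"
    using pos by (simp add: divide_le_eq mult.commute) (simp add: le_divide_eq mult.commute)
  then show "(Gamma x / Gamma (x + p / 2)) powr (1 / p) \<le> (Gamma (x - 1 / 2) / Gamma (p / 2 + x - 1 / 2)) powr (1 / p)"
    using pos p unfolding y_def by (intro powr_mono2) auto
  have "Gamma (x + p / 2) \<le> sqrt y * Gamma y" using Gamma_half_le[OF y] by (simp add: y_def algebra_simps)
  moreover have "Gamma (x - 1 / 2) * (x - 1 / 2) \<le> sqrt x * Gamma x"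
  proof -
    have "x + 1 / 2 = x - 1 / 2 + 1" by simp
    also have "Gamma \<dots> = (x - 1 / 2) * Gamma (x - 1 / 2)"
      using x by (intro Gamma_plus1) (auto simp: nonpos_Ints_def)
    finally show ?thesis using Gamma_half_le[of x] x by (simp add: mult.commute)
  qed
  ultimately have "Gamma (x + p / 2) * (Gamma (x - 1 / 2) * (x - 1 / 2)) \<le> (sqrt y * Gamma y) * (sqrt x * Gamma x)"
    by (rule mult_mono) (use x y pos in auto)
  then have r: "Gamma (x - 1 / 2) / Gamma y \<le> Gamma x / Gamma (x + p / 2) * (sqrt y * sqrt x / (x - 1 / 2))"
    using pos x by (simp add: field_simps)
  \<comment> \<open>In the exponent, the root of \<open>y / x\<close> costs
    \<open>p / (4 * x)\<close>, and \<open>x / (x - 1/2)\<close> costs \<open>1 / x\<close>, which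
    is at most \<open>p / (2 * x)\<close> since \<open>p \<ge> 2\<close>.\<close>
  have "sqrt y * sqrt x / (x - 1 / 2) \<le> exp (3 * p / (4 * x))"
  proof -
    have "sqrt y * sqrt x / (x - 1 / 2) = sqrt (y / x) * (x / (x - 1 / 2))"
    proof -
      have "sqrt (y / x) * x = sqrt y * (x / sqrt x)" by (simp add: real_sqrt_divide)
      also have "x / sqrt x = sqrt x" using x by (intro real_div_sqrt) auto
      finally show ?thesis by simp
    qed
    also have "\<dots> \<le> exp (p / (4 * x)) * exp (1 / x)"
    proof (intro mult_mono)
      have "y / x \<le> 1 + p / (2 * x)" using x by (simp add: y_def field_simps)
      also have "\<dots> \<le> exp (p / (2 * x))" by (rule exp_ge_add_one_self)
      also have "\<dots> = (exp (p / (4 * x)))\<^sup>2" by (simp add: exp_double[symmetric])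
      finally show "sqrt (y / x) \<le> exp (p / (4 * x))" by (simp add: real_le_lsqrt)
      have "x / (x - 1 / 2) \<le> 1 + 1 / x" using x by (simp add: field_simps)
      also have "\<dots> \<le> exp (1 / x)" by (rule exp_ge_add_one_self)
      finally show "x / (x - 1 / 2) \<le> exp (1 / x)" .
    qed (use x y in auto)
    also have "\<dots> = exp (p / (4 * x) + 1 / x)" by (simp add: exp_add)
    also have "\<dots> \<le> exp (3 * p / (4 * x))" using p x by (simp add: field_simps)
    finally show ?thesis .
  qed
  then have "Gamma (x - 1 / 2) / Gamma y \<le> Gamma x / Gamma (x + p / 2) * exp (3 * p / (4 * x))"
    using pos by (intro order_trans[OF r] mult_left_mono) auto
  then have "(Gamma (x - 1 / 2) / Gamma y) powr (1 / p) \<le> (Gamma x / Gamma (x + p / 2) * exp (3 * p / (4 * x))) powr (1 / p)"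
    using pos p by (intro powr_mono2) auto
  also have "\<dots> = (Gamma x / Gamma (x + p / 2)) powr (1 / p) * exp (3 / (4 * x))"
    using pos p x by (subst powr_mult) (auto simp: exp_powr_real)
  \<comment> \<open>The argument is at most 3/4, so the chord of \<open>exp\<close> over the unit
    interval applies, with \<open>exp 1 \<le> 3\<close>.\<close>
  also have "exp (3 / (4 * x)) \<le> 1 + 3 / (2 * x)"
  proof -
    have "convex_on UNIV (exp :: real \<Rightarrow> real)" by (rule exp_convex)
    from convex_onD[OF this, of "3 / (4 * x)" 0 1]
    have "exp (3 / (4 * x)) \<le> (1 - 3 / (4 * x)) + 3 / (4 * x) * exp 1" using x by simp
    also have "\<dots> \<le> (1 - 3 / (4 * x)) + 3 / (4 * x) * 3" using x exp_le by (intro add_mono mult_left_mono) auto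
    finally show ?thesis using x by (simp add: field_simps)
  qed
  finally show "(Gamma (x - 1 / 2) / Gamma (p / 2 + x - 1 / 2)) powr (1 / p) \<le> (Gamma x / Gamma (x + p / 2)) powr (1 / p) * (1 + 3 / (2 * x))"
    using pos by (simp add: y_def mult_left_mono)
qed

section \<open>Random vectors in a finite-dimensional space of functions\<close>

lemma borel_measurable_cnj [measurable (raw)]:
  "f \<in> borel_measurable M \<Longrightarrow> (\<lambda>x. cnj (f x)) \<in> borel_measurable M"
  by (rule borel_measurable_continuous_on[OF continuous_on_cnj[OF continuous_on_id]])

text \<open>In the application \<open>\<phi> j\<close> is a basis form times
  \<open>y powr (k / 2)\<close>, cut off to the set over which the norm is taken. The cut-off
  destroys orthonormality but keeps \<open>bessel\<close>, so the compact set and the whole domain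
  are treated alike.\<close>

locale random_lp = sigma_finite_measure M for M :: "'z measure" +
  fixes N :: nat and \<phi> :: "nat \<Rightarrow> 'z \<Rightarrow> complex" and S p :: real
  assumes N: "N \<ge> 1" and p: "p \<ge> 2" and S: "S > 0"
    and \<phi>_meas [measurable]: "\<And>j. \<phi> j \<in> borel_measurable M"
    and bessel: "\<And>a. (\<integral>\<^sup>+z. ennreal ((cmod (\<Sum>j<N. a j * \<phi> j z))\<^sup>2) \<partial>M) \<le> ennreal (norm_sq {..<N} a)"
    and sup: "\<And>z. z \<in> space M \<Longrightarrow> norm_sq {..<N} (\<lambda>j. \<phi> j z) \<le> S"
begin

definition h :: "(nat \<Rightarrow> complex) \<Rightarrow> 'z \<Rightarrow> complex" where
  "h a z = (\<Sum>j<N. a j * \<phi> j z)"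

definition B :: "'z \<Rightarrow> real" where
  "B z = norm_sq {..<N} (\<lambda>j. \<phi> j z)"

definition Fp :: "(nat \<Rightarrow> complex) \<Rightarrow> real" where
  "Fp a = (\<integral>z. cmod (h a z) powr p \<partial>M)"

definition F :: "(nat \<Rightarrow> complex) \<Rightarrow> real" where
  "F a = Fp a powr (1 / p)"

definition L :: real where
  "L = S powr (1 / 2 - 1 / p)"

text \<open>The norming functional of \<open>h a\<close> in the dual of \<open>L\<^sup>p\<close>.\<close>

definition ell :: "(nat \<Rightarrow> complex) \<Rightarrow> (nat \<Rightarrow> complex) \<Rightarrow> complex" where
  "ell a b = of_real (Fp a powr (1 / p - 1)) *
     (\<integral>z. of_real (cmod (h a z) powr (p - 2)) * cnj (h a z) * h b z \<partial>M)"

lemma p1: "p > 1" and p0: "p > 0" "p \<noteq> 0" using p by auto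

lemma L_pos: "L > 0" using S by (simp add: L_def)

lemma L_powr: "L powr p = S powr (p / 2 - 1)"
  using S p0 by (simp add: L_def powr_powr diff_divide_distrib algebra_simps)

lemma h_meas [measurable]: "(\<lambda>z. h a z) \<in> borel_measurable M"
  unfolding h_def by measurable

lemma h_meas' [measurable]: "(\<lambda>x. h (fst x) (snd x)) \<in> borel_measurable (lborel_vec {..<N} \<Otimes>\<^sub>M M)"
  unfolding h_def by measurable

lemma B_meas [measurable]: "B \<in> borel_measurable M"
  unfolding B_def norm_sq_def by measurable

lemma B_nonneg: "B z \<ge> 0" by (simp add: B_def)

lemma h_lincomb: "h (lincomb {..<N} a b x y) z = a * h x z + b * h y z"
  by (simp add: h_def lincomb_def sum_distrib_left sum.distrib algebra_simps)

lemma h_sq_le: "(cmod (h a z))\<^sup>2 \<le> norm_sq {..<N} a * B z"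
proof -
  have "cmod (h a z) \<le> (\<Sum>j<N. cmod (a j) * cmod (\<phi> j z))"
    unfolding h_def by (rule order_trans[OF norm_sum]) (simp add: norm_mult)
  then have "(cmod (h a z))\<^sup>2 \<le> (\<Sum>j<N. cmod (a j) * cmod (\<phi> j z))\<^sup>2" by (intro power_mono) auto
  also have "\<dots> \<le> norm_sq {..<N} a * B z" unfolding norm_sq_def B_def by (rule Cauchy_Schwarz_ineq_sum)
  finally show ?thesis .
qed

lemma h_sq_integrable: "integrable M (\<lambda>z. (cmod (h a z))\<^sup>2)"
  and h_sq_integral: "(\<integral>z. (cmod (h a z))\<^sup>2 \<partial>M) \<le> norm_sq {..<N} a"
proof -
  have *: "(\<integral>\<^sup>+z. ennreal ((cmod (h a z))\<^sup>2) \<partial>M) \<le> ennreal (norm_sq {..<N} a)"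
    using bessel by (simp add: h_def)
  then have "(\<integral>\<^sup>+z. ennreal ((cmod (h a z))\<^sup>2) \<partial>M) < \<infinity>" by (rule order_le_less_trans) simp
  then show "integrable M (\<lambda>z. (cmod (h a z))\<^sup>2)" by (intro integrableI_nonneg) auto
  then show "(\<integral>z. (cmod (h a z))\<^sup>2 \<partial>M) \<le> norm_sq {..<N} a"
    using * by (subst (asm) nn_integral_eq_integral) auto
qed

lemma h_powr_le: 
  assumes z: "z \<in> space M"
  shows "cmod (h a z) powr p \<le> (norm_sq {..<N} a * S) powr (p / 2 - 1) * (cmod (h a z))\<^sup>2"
proof -
  have "cmod (h a z) powr p = ((cmod (h a z))\<^sup>2) powr (p / 2)" by (simp add: sq_powr_half)
  also have "\<dots> = ((cmod (h a z))\<^sup>2) powr (p / 2 - 1) * (cmod (h a z))\<^sup>2"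
    by (cases "h a z = 0") (auto simp: powr_diff)
  also have "((cmod (h a z))\<^sup>2) powr (p / 2 - 1) \<le> (norm_sq {..<N} a * S) powr (p / 2 - 1)"
  proof (rule powr_mono2)
    have "(cmod (h a z))\<^sup>2 \<le> norm_sq {..<N} a * B z" by (rule h_sq_le)
    also have "\<dots> \<le> norm_sq {..<N} a * S" using sup[OF z] by (intro mult_left_mono) (auto simp: B_def)
    finally show "(cmod (h a z))\<^sup>2 \<le> norm_sq {..<N} a * S" .
  qed (use p in auto)
  finally show ?thesis by (simp add: mult_right_mono)
qed

lemma h_powr_integrable: "integrable M (\<lambda>z. cmod (h a z) powr p)"
proof (rule Bochner_Integration.integrable_bound)
  show "integrable M (\<lambda>z. (norm_sq {..<N} a * S) powr (p / 2 - 1) * (cmod (h a z))\<^sup>2)"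
    using h_sq_integrable by auto
qed (use h_powr_le in auto)

lemma Fp_nonneg: "Fp a \<ge> 0" by (simp add: Fp_def)

lemma F_nonneg: "F a \<ge> 0" by (simp add: F_def)

lemma F_powr: "F a powr p = Fp a" using Fp_nonneg p0 by (simp add: F_def powr_powr)

text \<open>All but two powers of \<open>h\<close> are bounded pointwise by Cauchy-Schwarz and
  \<open>sup\<close>; the remaining two are integrated by \<open>bessel\<close>. As \<open>F\<close>
  is a seminorm, this makes \<open>L\<close> its Lipschitz constant.\<close>

lemma F_le: "F a \<le> sqrt (norm_sq {..<N} a) * L"
proof -
  have "Fp a \<le> (\<integral>z. (norm_sq {..<N} a * S) powr (p / 2 - 1) * (cmod (h a z))\<^sup>2 \<partial>M)"
    unfolding Fp_def using h_powr_integrable h_sq_integrable h_powr_le by (intro integral_mono) auto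
  also have "\<dots> \<le> (norm_sq {..<N} a * S) powr (p / 2 - 1) * norm_sq {..<N} a"
    using h_sq_integral by (simp add: mult_left_mono)
  also have "\<dots> = norm_sq {..<N} a powr (p / 2) * S powr (p / 2 - 1)"
    using S by (cases "norm_sq {..<N} a = 0") (auto simp: powr_mult powr_diff)
  finally have "F a \<le> (norm_sq {..<N} a powr (p / 2) * S powr (p / 2 - 1)) powr (1 / p)"
    unfolding F_def using p0 Fp_nonneg by (intro powr_mono2) auto
  also have "\<dots> = sqrt (norm_sq {..<N} a) * L"
    using p0 by (simp add: powr_mult powr_powr L_def powr_half_sqrt diff_divide_distrib)
  finally show ?thesis .
qed

lemma F_cong: "(\<And>z. h a z = h b z) \<Longrightarrow> F a = F b"
  by (simp add: F_def Fp_def)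

lemma ell_integrable: "integrable M (\<lambda>z. of_real (cmod (h a z) powr (p - 2)) * cnj (h a z) * h b z)"
  and ell_le: "cmod (ell a b) \<le> F b"
proof -
  have eq: "cmod (of_real (cmod (h a z) powr (p - 2)) * cnj (h a z) * h b z) = cmod (h a z) powr (p - 1) * cmod (h b z)" for z
  proof (cases "h a z = 0")
    case False
    then have "cmod (h a z) powr (p - 1) = cmod (h a z) powr (p - 2) * cmod (h a z)"
      using powr_add[of "cmod (h a z)" "p - 2" 1] by simp
    then show ?thesis by (simp add: norm_mult)
  qed simp
  have I: "integrable M (\<lambda>z. cmod (h a z) powr (p - 1) * cmod (h b z))"
    by (rule Holder_powr(1)[OF p1]) (auto intro: h_powr_integrable)
  show J: "integrable M (\<lambda>z. of_real (cmod (h a z) powr (p - 2)) * cnj (h a z) * h b z)"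
    by (rule Bochner_Integration.integrable_bound[OF I]) (auto simp: eq)
  have "cmod (\<integral>z. of_real (cmod (h a z) powr (p - 2)) * cnj (h a z) * h b z \<partial>M)
     \<le> (\<integral>z. cmod (h a z) powr (p - 1) * cmod (h b z) \<partial>M)"
    by (rule order_trans[OF integral_norm_bound]) (simp add: eq)
  also have "\<dots> \<le> Fp a powr (1 - 1 / p) * Fp b powr (1 / p)"
    unfolding Fp_def by (rule Holder_powr(2)[OF p1]) (auto intro: h_powr_integrable)
  finally have "cmod (ell a b) \<le> Fp a powr (1 / p - 1) * (Fp a powr (1 - 1 / p) * F b)"
    unfolding ell_def F_def by (simp add: norm_mult mult_left_mono)
  \<comment> \<open>If \<open>Fp a = 0\<close>, the left side vanishes because a power of 0 is 0
    under \<open>powr\<close>.\<close>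
  also have "\<dots> \<le> F b"
    using F_nonneg[of b] by (cases "Fp a = 0") (auto simp: powr_add[symmetric] mult.assoc[symmetric])
  finally show "cmod (ell a b) \<le> F b" .
qed

lemma ell_self: "ell a a = of_real (F a)"
proof -
  have "of_real (cmod (h a z) powr (p - 2)) * cnj (h a z) * h a z = complex_of_real (cmod (h a z) powr p)" for z
  proof (cases "h a z = 0")
    case False
    have "cnj (h a z) * h a z = of_real ((cmod (h a z))\<^sup>2)"
      by (simp only: complex_norm_square mult.commute)
    then have "of_real (cmod (h a z) powr (p - 2)) * cnj (h a z) * h a z
      = complex_of_real (cmod (h a z) powr (p - 2) * (cmod (h a z))\<^sup>2)" by (simp add: mult.assoc)
    also have "cmod (h a z) powr (p - 2) * (cmod (h a z))\<^sup>2 = cmod (h a z) powr p"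
      using False by (simp add: powr_diff)
    finally show ?thesis .
  qed (use p in auto)
  then have "ell a a = of_real (Fp a powr (1 / p - 1) * Fp a)"
    by (simp add: ell_def Fp_def)
  also have "Fp a powr (1 / p - 1) * Fp a = F a"
    using Fp_nonneg[of a] by (cases "Fp a = 0") (auto simp: F_def powr_diff)
  finally show ?thesis .
qed

lemma ell_linear:
  assumes "\<And>z. h w z = c * h x z + d * h y z"
  shows "ell a w = c * ell a x + d * ell a y"
proof -
  have "(\<integral>z. of_real (cmod (h a z) powr (p - 2)) * cnj (h a z) * h w z \<partial>M)
    = (\<integral>z. c * (of_real (cmod (h a z) powr (p - 2)) * cnj (h a z) * h x z)
         + d * (of_real (cmod (h a z) powr (p - 2)) * cnj (h a z) * h y z) \<partial>M)"
    by (simp add: assms algebra_simps)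
  also have "\<dots> = c * (\<integral>z. of_real (cmod (h a z) powr (p - 2)) * cnj (h a z) * h x z \<partial>M)
    + d * (\<integral>z. of_real (cmod (h a z) powr (p - 2)) * cnj (h a z) * h y z \<partial>M)"
    by (subst Bochner_Integration.integral_add) (auto intro: ell_integrable)
  finally show ?thesis by (simp add: ell_def algebra_simps)
qed

text \<open>\<open>Re (ell x _)\<close> is a linear minorant of \<open>F\<close> that agrees with
  \<open>F\<close> at \<open>x\<close>. Evaluated at \<open>w\<close>, the point turned back from
  \<open>x\<close>, it bounds the increment.\<close>

lemma F_step:
  assumes "\<And>z. h w z = of_real c * h x z - of_real s * h y z"
  shows "F x - F w \<le> (1 - c) * F x + s * Re (ell x y)"
proof -
  have "ell x w = of_real c * ell x x + (- of_real s) * ell x y"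
    by (rule ell_linear) (simp add: assms)
  then have "Re (ell x w) = c * F x - s * Re (ell x y)" by (simp add: ell_self)
  moreover have "Re (ell x w) \<le> F w" using ell_le[of x w] complex_Re_le_cmod[of "ell x w"] by linarith
  ultimately show ?thesis by (simp add: algebra_simps)
qed

definition ell_coeff :: "(nat \<Rightarrow> complex) \<Rightarrow> nat \<Rightarrow> complex" where
  "ell_coeff a j = ell a (\<lambda>i. if i = j then 1 else 0)"

lemma h_unit: "j < N \<Longrightarrow> h (\<lambda>i. if i = j then 1 else 0) z = \<phi> j z"
  by (simp add: h_def if_distrib[where f="\<lambda>x. x * _"] sum.delta' cong: if_cong)

lemma ell_eq: "ell a b = (\<Sum>j<N. ell_coeff a j * b j)"
proof -
  have i: "integrable M (\<lambda>z. of_real (cmod (h a z) powr (p - 2)) * cnj (h a z) * \<phi> j z)" if "j < N" for j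
    using ell_integrable[of a "\<lambda>i. if i = j then 1 else 0"] by (simp add: h_unit[OF that])
  have "(\<integral>z. of_real (cmod (h a z) powr (p - 2)) * cnj (h a z) * h b z \<partial>M)
    = (\<integral>z. (\<Sum>j<N. b j * (of_real (cmod (h a z) powr (p - 2)) * cnj (h a z) * \<phi> j z)) \<partial>M)"
    by (simp add: h_def[of b] sum_distrib_left sum_distrib_right mult_ac)
  also have "\<dots> = (\<Sum>j<N. b j * (\<integral>z. of_real (cmod (h a z) powr (p - 2)) * cnj (h a z) * \<phi> j z \<partial>M))"
    using i by (subst Bochner_Integration.integral_sum) auto
  finally show ?thesis
    by (simp add: ell_def ell_coeff_def h_unit sum_distrib_left algebra_simps)
qed

text \<open>Duality: evaluated at the conjugates of its own coefficients, \<open>ell a\<close> gives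
  \<open>n\<close>, while \<open>F_le\<close> allows at most \<open>sqrt n * L\<close>. So
  \<open>ell a\<close> of a Gaussian vector has variance at most \<open>L\<^sup>2\<close>.\<close>

lemma norm_sq_ell_coeff_le: "norm_sq {..<N} (ell_coeff a) \<le> L\<^sup>2"
proof -
  define n where "n = norm_sq {..<N} (ell_coeff a)"
  have "ell a (\<lambda>j. cnj (ell_coeff a j)) = of_real n"
    unfolding ell_eq n_def norm_sq_def of_real_sum by (simp only: complex_norm_square)
  then have "n = cmod (ell a (\<lambda>j. cnj (ell_coeff a j)))" by (simp add: n_def)
  also have "\<dots> \<le> F (\<lambda>j. cnj (ell_coeff a j))" by (rule ell_le)
  also have "\<dots> \<le> sqrt n * L" using F_le[of "\<lambda>j. cnj (ell_coeff a j)"] by (simp add: n_def norm_sq_def)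
  finally have "sqrt n * sqrt n \<le> sqrt n * L" by (simp add: n_def)
  then have "sqrt n \<le> L"
  proof (cases "n = 0")
    case False
    then have "sqrt n > 0" by (simp add: n_def order_less_le)
    then show ?thesis using \<open>sqrt n * sqrt n \<le> sqrt n * L\<close> by (simp only: mult_le_cancel_left_pos)
  qed (use L_pos in auto)
  then have "(sqrt n)\<^sup>2 \<le> L\<^sup>2" by (intro power_mono) (auto simp: n_def)
  then show ?thesis by (simp add: n_def)
qed

lemma Fp_meas [measurable]: "Fp \<in> borel_measurable (lborel_vec {..<N})"
  unfolding Fp_def by measurable

lemma F_meas [measurable]: "F \<in> borel_measurable (lborel_vec {..<N})"
  unfolding F_def by measurable

lemma ell_coeff_meas [measurable]: "j < N \<Longrightarrow> (\<lambda>a. ell_coeff a j) \<in> borel_measurable (lborel_vec {..<N})"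
  unfolding ell_coeff_def ell_def h_unit by measurable

lemma ell_meas [measurable]:
  "(\<lambda>x. ell (fst x) (snd x)) \<in> borel_measurable (lborel_vec {..<N} \<Otimes>\<^sub>M lborel_vec {..<N})"
  unfolding ell_eq by measurable

end

section \<open>Moments and concentration of the norm of a Gaussian vector\<close>

lemma one_minus_cos_le: "1 - cos x \<le> (x::real)\<^sup>2 / 2"
proof -
  have "1 - cos x = 2 * (sin (x / 2))\<^sup>2"
    using cos_double_sin[of "x / 2"] by simp
  also have "(sin (x / 2))\<^sup>2 \<le> (x / 2)\<^sup>2"
    using abs_sin_x_le_abs_x[of "x / 2"] by (simp only: abs_le_square_iff)
  finally show ?thesis by (simp add: power2_eq_square)
qed

context random_lp
begin

text \<open>The p-th power of \<open>sqrt N\<close> times the p-norm of the root of the diagonal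
  covariance, since that covariance is \<open>B / N\<close>.\<close>

definition T :: real where
  "T = (\<integral>z. B z powr (p / 2) \<partial>M)"

text \<open>Bessel's inequality summed over the unit coefficient vectors.\<close>

lemma B_integrable: "integrable M B" and B_integral: "(\<integral>z. B z \<partial>M) \<le> N"
proof -
  have eq: "B z = (\<Sum>j<N. (cmod (h (\<lambda>i. if i = j then 1 else 0) z))\<^sup>2)" for z
    by (simp add: B_def norm_sq_def h_unit)
  have n: "norm_sq {..<N} (\<lambda>i. if i = j then 1 else 0) = 1" if "j < N" for j
    using that by (simp add: norm_sq_def if_distrib[where f="\<lambda>x. (cmod x)\<^sup>2"] sum.delta' cong: if_cong)
  show "integrable M B" unfolding eq using h_sq_integrable by auto
  have "(\<integral>z. B z \<partial>M) = (\<Sum>j<N. \<integral>z. (cmod (h (\<lambda>i. if i = j then 1 else 0) z))\<^sup>2 \<partial>M)"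
    unfolding eq using h_sq_integrable by (intro Bochner_Integration.integral_sum) auto
  also have "\<dots> \<le> (\<Sum>j<N. 1)"
    using h_sq_integral n by (intro sum_mono) (metis lessThan_iff)
  finally show "(\<integral>z. B z \<partial>M) \<le> N" by simp
qed

lemma B_powr_le: "z \<in> space M \<Longrightarrow> B z powr (p / 2) \<le> L powr p * B z"
proof -
  assume z: "z \<in> space M"
  have "B z powr (p / 2) = B z powr (p / 2 - 1) * B z"
    using B_nonneg[of z] by (cases "B z = 0") (auto simp: powr_diff)
  also have "\<dots> \<le> S powr (p / 2 - 1) * B z"
    using B_nonneg[of z] sup[OF z] p by (intro mult_right_mono powr_mono2) (auto simp: B_def)
  finally show ?thesis by (simp add: L_powr)
qed

lemma B_powr_integrable: "integrable M (\<lambda>z. B z powr (p / 2))"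
proof (rule Bochner_Integration.integrable_bound)
  show "integrable M (\<lambda>z. L powr p * B z)" using B_integrable by auto
qed (use B_powr_le B_nonneg in \<open>auto simp: abs_mult\<close>)

lemma T_nonneg: "T \<ge> 0" by (simp add: T_def)

text \<open>Crude in \<open>N\<close>, but used only against factors \<open>N powr (- p)\<close> and
  \<open>1 / N\<close>.\<close>

lemma T_le: "T \<le> L powr p * N"
proof -
  have "T \<le> (\<integral>z. L powr p * B z \<partial>M)"
    unfolding T_def using B_powr_integrable B_integrable B_powr_le by (intro integral_mono) auto
  also have "\<dots> \<le> L powr p * N" using B_integral by (simp add: mult_left_mono)
  finally show ?thesis .
qed

lemma prob_gauss_vec: "prob_space (gauss_vec {..<N})"
  by (rule prob_space_PiM) (rule prob_space_gauss1)

lemma Fp_nn: "ennreal (Fp a) = (\<integral>\<^sup>+z. ennreal (cmod (h a z) powr p) \<partial>M)"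
  unfolding Fp_def using h_powr_integrable by (intro nn_integral_eq_integral[symmetric]) auto

text \<open>Fubini: at a fixed point \<open>z\<close> the value of \<open>h\<close> is a Gaussian
  variable of variance \<open>B z\<close>.\<close>

lemma gauss_Fp: "(\<integral>\<^sup>+x. ennreal (Fp x) \<partial>gauss_vec {..<N}) = ennreal (T * Gamma (p / 2 + 1))"
proof -
  interpret G: prob_space "gauss_vec {..<N}" by (rule prob_gauss_vec)
  interpret P: pair_sigma_finite "gauss_vec {..<N}" M ..
  have "(\<integral>\<^sup>+x. ennreal (Fp x) \<partial>gauss_vec {..<N}) = (\<integral>\<^sup>+x. \<integral>\<^sup>+z. ennreal (cmod (h x z) powr p) \<partial>M \<partial>gauss_vec {..<N})"
    by (simp add: Fp_nn)
  also have "\<dots> = (\<integral>\<^sup>+z. \<integral>\<^sup>+x. ennreal (cmod (h x z) powr p) \<partial>gauss_vec {..<N} \<partial>M)"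
    by (rule P.Fubini'[symmetric]) measurable
  also have "\<dots> = (\<integral>\<^sup>+z. ennreal (B z powr (p / 2)) * ennreal (Gamma (p / 2 + 1)) \<partial>M)"
  proof (rule nn_integral_cong)
    fix z
    have "(\<integral>\<^sup>+x. ennreal (cmod (h x z) powr p) \<partial>gauss_vec {..<N}) = (\<integral>\<^sup>+x. ennreal (cmod (\<Sum>j<N. \<phi> j z * x j) powr p) \<partial>gauss_vec {..<N})"
      by (simp add: h_def mult.commute)
    also have "\<dots> = ennreal (B z powr (p / 2) * Gamma (p / 2 + 1))"
      unfolding B_def using p by (intro gauss_vec_sum_moment) auto
    finally show "(\<integral>\<^sup>+x. ennreal (cmod (h x z) powr p) \<partial>gauss_vec {..<N}) = ennreal (B z powr (p / 2)) * ennreal (Gamma (p / 2 + 1))"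
      using p by (simp add: ennreal_mult)
  qed
  also have "\<dots> = (\<integral>\<^sup>+z. ennreal (B z powr (p / 2)) \<partial>M) * ennreal (Gamma (p / 2 + 1))"
    by (rule nn_integral_multc) measurable
  also have "(\<integral>\<^sup>+z. ennreal (B z powr (p / 2)) \<partial>M) = ennreal T"
    unfolding T_def using B_powr_integrable by (intro nn_integral_eq_integral) auto
  finally show ?thesis using T_nonneg p by (simp add: ennreal_mult)
qed

lemma gauss_ell: "(\<integral>\<^sup>+x. ennreal (cmod (ell a x) powr p) \<partial>gauss_vec {..<N}) \<le> ennreal (L powr p * Gamma (p / 2 + 1))"
proof -
  have "(\<integral>\<^sup>+x. ennreal (cmod (ell a x) powr p) \<partial>gauss_vec {..<N}) = ennreal (norm_sq {..<N} (ell_coeff a) powr (p / 2) * Gamma (p / 2 + 1))"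
    unfolding ell_eq using p by (intro gauss_vec_sum_moment) auto
  also have "norm_sq {..<N} (ell_coeff a) powr (p / 2) \<le> (L\<^sup>2) powr (p / 2)"
    using norm_sq_ell_coeff_le p by (intro powr_mono2) auto
  also have "\<dots> = L powr p" using L_pos by (simp add: sq_powr_half)
  finally show ?thesis using p by (simp add: ennreal_leI mult_right_mono)
qed

text \<open>Maurey's rotation trick: \<open>F y - F x\<close> telescopes along the quarter circle from \<open>x\<close> to \<open>y\<close>,
  and each increment is dominated by the norming functional at the rotated point evaluated at the
  independent rotated direction.\<close>

lemma gauss_concentration:
  "(\<integral>\<^sup>+q. ennreal (max 0 (F (snd q) - F (fst q)) powr p) \<partial>(gauss_vec {..<N} \<Otimes>\<^sub>M gauss_vec {..<N}))
     \<le> ennreal ((pi * L) powr p * Gamma (p / 2 + 1))"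
proof -
  let ?I = "{..<N}" let ?Q = "gauss_vec {..<N} \<Otimes>\<^sub>M gauss_vec {..<N}"
  interpret G: prob_space "gauss_vec {..<N}" by (rule prob_gauss_vec)
  interpret P: pair_sigma_finite "gauss_vec {..<N}" "gauss_vec {..<N}" ..
  interpret PP: pair_prob_space "gauss_vec {..<N}" "gauss_vec {..<N}" ..
  \<comment> \<open>\<open>N\<close> chords suffice. In p-norm their second-order terms add up to at
    most \<open>pi\<^sup>2 / (8 * N)\<close> times that of \<open>F\<close>, and the gain
    \<open>1 / N\<close> outweighs the factor \<open>N powr (1 / p)\<close> lost in
    \<open>T_le\<close>.\<close>
  define \<delta> where "\<delta> = pi / (2 * N)"
  have \<delta>: "\<delta> > 0" using N by (simp add: \<delta>_def)
  define X where "X i q = lincomb ?I (of_real (cos (real i * \<delta>))) (of_real (sin (real i * \<delta>))) (fst q) (snd q)" for i q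
  define Y where "Y i q = lincomb ?I (- of_real (sin (real i * \<delta>))) (of_real (cos (real i * \<delta>))) (fst q) (snd q)" for i q
  define t where "t x y = (1 - cos \<delta>) * F x + sin \<delta> * Re (ell x y)" for x y
  define u where "u x y = max 0 (t x y) powr p" for x y
  have step: "F (X (Suc i) q) - F (X i q) \<le> t (X (Suc i) q) (Y (Suc i) q)" for i q
    unfolding t_def
  proof (rule F_step)
    fix z
    let ?a = "real i * \<delta>" and ?b = "real (Suc i) * \<delta>"
    \<comment> \<open>The point at step \<open>i\<close> is the one at step \<open>Suc i\<close>
      turned back by \<open>\<delta>\<close> in the plane spanned by \<open>X\<close> and
      \<open>Y\<close> at step \<open>Suc i\<close>.\<close>
    have ab: "?a = ?b - \<delta>" by (simp add: algebra_simps)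
    have c: "cos ?a = cos \<delta> * cos ?b + sin \<delta> * sin ?b" and s: "sin ?a = cos \<delta> * sin ?b - sin \<delta> * cos ?b"
      unfolding ab cos_diff sin_diff by (simp_all add: mult.commute)
    show "h (X i q) z = of_real (cos \<delta>) * h (X (Suc i) q) z - of_real (sin \<delta>) * h (Y (Suc i) q) z"
      unfolding X_def Y_def h_lincomb c s by (simp add: algebra_simps)
  qed
  have tel: "F (snd q) - F (fst q) \<le> (\<Sum>i<N. t (X (Suc i) q) (Y (Suc i) q))" for q
  proof -
    have Nd: "real N * \<delta> = pi / 2" using N by (simp add: \<delta>_def)
    have "F (X N q) = F (snd q)" "F (X 0 q) = F (fst q)"
      by (auto intro!: F_cong simp: X_def h_lincomb Nd)
    then have "F (snd q) - F (fst q) = (\<Sum>i<N. F (X (Suc i) q) - F (X i q))"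
      using sum_lessThan_telescope[of "\<lambda>i. F (X i q)" N] by simp
    also have "\<dots> \<le> (\<Sum>i<N. t (X (Suc i) q) (Y (Suc i) q))" by (intro sum_mono step)
    finally show ?thesis .
  qed
  have "max 0 (F (snd q) - F (fst q)) powr p \<le> real N powr (p - 1) * (\<Sum>i<N. u (X (Suc i) q) (Y (Suc i) q))" for q
  proof -
    have "max 0 (F (snd q) - F (fst q)) \<le> (\<Sum>i<N. max 0 (t (X (Suc i) q) (Y (Suc i) q)))"
    proof (rule max.boundedI)
      show "F (snd q) - F (fst q) \<le> (\<Sum>i<N. max 0 (t (X (Suc i) q) (Y (Suc i) q)))"
        by (rule order_trans[OF tel]) (intro sum_mono, simp)
    qed (auto intro: sum_nonneg)
    then have "max 0 (F (snd q) - F (fst q)) powr p \<le> (\<Sum>i<N. max 0 (t (X (Suc i) q) (Y (Suc i) q))) powr p"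
      using p by (intro powr_mono2) auto
    also have "\<dots> \<le> real N powr (p - 1) * (\<Sum>i<N. u (X (Suc i) q) (Y (Suc i) q))"
      unfolding u_def by (rule powr_sum_le[OF p1 N]) auto
    finally show ?thesis .
  qed
  moreover have [measurable]: "(\<lambda>q. u (fst q) (snd q)) \<in> borel_measurable (lborel_vec ?I \<Otimes>\<^sub>M lborel_vec ?I)"
    unfolding u_def t_def by measurable
  have [measurable]: "X i \<in> measurable (lborel_vec ?I \<Otimes>\<^sub>M lborel_vec ?I) (lborel_vec ?I)" "Y i \<in> measurable (lborel_vec ?I \<Otimes>\<^sub>M lborel_vec ?I) (lborel_vec ?I)" for i
    unfolding X_def Y_def by measurable
  have [measurable]: "(\<lambda>q. u (X i q) (Y i q)) \<in> borel_measurable (lborel_vec ?I \<Otimes>\<^sub>M lborel_vec ?I)" for i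
    using measurable_compose[of "\<lambda>q. (X i q, Y i q)" _ "lborel_vec ?I \<Otimes>\<^sub>M lborel_vec ?I" "\<lambda>q. u (fst q) (snd q)"] by simp
  ultimately have "(\<integral>\<^sup>+q. ennreal (max 0 (F (snd q) - F (fst q)) powr p) \<partial>?Q)
     \<le> (\<integral>\<^sup>+q. ennreal (real N powr (p - 1)) * (\<Sum>i<N. ennreal (u (X (Suc i) q) (Y (Suc i) q))) \<partial>?Q)"
    by (intro nn_integral_mono) (subst sum_ennreal, auto simp: u_def sum_nonneg intro!: ennreal_leI simp flip: ennreal_mult)
  also have "\<dots> = ennreal (real N powr (p - 1)) * (\<Sum>i<N. \<integral>\<^sup>+q. ennreal (u (X (Suc i) q) (Y (Suc i) q)) \<partial>?Q)"
    by (subst nn_integral_cmult, measurable, subst nn_integral_sum) auto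
  \<comment> \<open>By rotation invariance each pair of \<open>X\<close> and \<open>Y\<close> is
    again a pair of independent Gaussian vectors, so all \<open>N\<close> summands equal the one at
    angle 0.\<close>
  also have "(\<Sum>i<N. \<integral>\<^sup>+q. ennreal (u (X (Suc i) q) (Y (Suc i) q)) \<partial>?Q) = (\<Sum>i<N. \<integral>\<^sup>+q. ennreal (u (fst q) (snd q)) \<partial>?Q)"
  proof (rule sum.cong)
    fix i
    show "(\<integral>\<^sup>+q. ennreal (u (X (Suc i) q) (Y (Suc i) q)) \<partial>?Q) = (\<integral>\<^sup>+q. ennreal (u (fst q) (snd q)) \<partial>?Q)"
      using nn_integral_gauss_vec_rotate[of ?I "\<lambda>q. ennreal (u (fst q) (snd q))" "of_real (cos (real (Suc i) * \<delta>))" "of_real (sin (real (Suc i) * \<delta>))"]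
      by (simp add: X_def Y_def sin_cos_squared_add2 del: of_nat_Suc)
  qed simp
  also have "ennreal (real N powr (p - 1)) * \<dots> = ennreal (real N powr p) * (\<integral>\<^sup>+q. ennreal (u (fst q) (snd q)) \<partial>?Q)"
  proof -
    have "real N powr p = real N powr (p - 1) * real N" using N by (simp add: powr_diff)
    then show ?thesis by (simp add: ennreal_mult mult.assoc ennreal_of_nat_eq_real_of_nat)
  qed
  also have "(\<integral>\<^sup>+q. ennreal (u (fst q) (snd q)) \<partial>?Q) \<le>
     (\<integral>\<^sup>+q. ennreal (2 powr (p - 1) * (\<delta>\<^sup>2 / 2) powr p) * ennreal (Fp (fst q)) + ennreal (2 powr (p - 1) * \<delta> powr p) * ennreal (cmod (ell (fst q) (snd q)) powr p) \<partial>?Q)"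
  proof (rule nn_integral_mono)
    fix q :: "(nat \<Rightarrow> complex) \<times> (nat \<Rightarrow> complex)"
    let ?x = "fst q" and ?y = "snd q"
    have "sin \<delta> * Re (ell ?x ?y) \<le> \<bar>sin \<delta>\<bar> * \<bar>Re (ell ?x ?y)\<bar>" by (metis abs_ge_self abs_mult)
    also have "\<dots> \<le> \<delta> * cmod (ell ?x ?y)"
      using abs_sin_x_le_abs_x[of \<delta>] \<delta> abs_Re_le_cmod by (intro mult_mono) auto
    finally have "t ?x ?y \<le> \<delta>\<^sup>2 / 2 * F ?x + \<delta> * cmod (ell ?x ?y)"
      unfolding t_def using one_minus_cos_le[of \<delta>] F_nonneg by (intro add_mono mult_right_mono) auto
    then have "max 0 (t ?x ?y) \<le> \<delta>\<^sup>2 / 2 * F ?x + \<delta> * cmod (ell ?x ?y)"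
      using F_nonneg \<delta> by (intro max.boundedI add_nonneg_nonneg) auto
    then have "u ?x ?y \<le> (\<delta>\<^sup>2 / 2 * F ?x + \<delta> * cmod (ell ?x ?y)) powr p"
      unfolding u_def using p by (intro powr_mono2) auto
    also have "\<dots> \<le> 2 powr (p - 1) * ((\<delta>\<^sup>2 / 2 * F ?x) powr p + (\<delta> * cmod (ell ?x ?y)) powr p)"
      using F_nonneg \<delta> by (intro powr_add_le p1) auto
    also have "\<dots> = 2 powr (p - 1) * (\<delta>\<^sup>2 / 2) powr p * Fp ?x + 2 powr (p - 1) * \<delta> powr p * cmod (ell ?x ?y) powr p"
    proof -
      have "(\<delta>\<^sup>2 / 2 * F ?x) powr p = (\<delta>\<^sup>2 / 2) powr p * Fp ?x"
        using F_nonneg[of ?x] by (subst powr_mult) (auto simp: F_powr)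
      moreover have "(\<delta> * cmod (ell ?x ?y)) powr p = \<delta> powr p * cmod (ell ?x ?y) powr p"
        using \<delta> by (subst powr_mult) auto
      ultimately show ?thesis by (simp only: distrib_left mult.assoc)
    qed
    finally show "ennreal (u ?x ?y) \<le> ennreal (2 powr (p - 1) * (\<delta>\<^sup>2 / 2) powr p) * ennreal (Fp ?x) + ennreal (2 powr (p - 1) * \<delta> powr p) * ennreal (cmod (ell ?x ?y) powr p)"
      using Fp_nonneg by (simp add: ennreal_leI flip: ennreal_mult ennreal_plus)
  qed
  also have "\<dots> = ennreal (2 powr (p - 1) * (\<delta>\<^sup>2 / 2) powr p) * (\<integral>\<^sup>+q. ennreal (Fp (fst q)) \<partial>?Q)
      + ennreal (2 powr (p - 1) * \<delta> powr p) * (\<integral>\<^sup>+q. ennreal (cmod (ell (fst q) (snd q)) powr p) \<partial>?Q)"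
    by (subst nn_integral_add, measurable, subst nn_integral_cmult, measurable, subst nn_integral_cmult) auto
  also have "(\<integral>\<^sup>+q. ennreal (Fp (fst q)) \<partial>?Q) = ennreal (T * Gamma (p / 2 + 1))"
    by (subst G.nn_integral_fst[symmetric]) (auto simp: gauss_Fp[symmetric] G.emeasure_space_1)
  also have "(\<integral>\<^sup>+q. ennreal (cmod (ell (fst q) (snd q)) powr p) \<partial>?Q) \<le> ennreal (L powr p * Gamma (p / 2 + 1))"
  proof -
    have "(\<integral>\<^sup>+q. ennreal (cmod (ell (fst q) (snd q)) powr p) \<partial>?Q)
       = (\<integral>\<^sup>+x. \<integral>\<^sup>+y. ennreal (cmod (ell x y) powr p) \<partial>gauss_vec ?I \<partial>gauss_vec ?I)"
      by (subst G.nn_integral_fst[symmetric]) auto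
    also have "\<dots> \<le> (\<integral>\<^sup>+x. ennreal (L powr p * Gamma (p / 2 + 1)) \<partial>gauss_vec ?I)"
      by (intro nn_integral_mono gauss_ell)
    finally show ?thesis by (simp add: G.emeasure_space_1)
  qed
  finally have "(\<integral>\<^sup>+q. ennreal (max 0 (F (snd q) - F (fst q)) powr p) \<partial>?Q)
    \<le> ennreal (real N powr p) * (ennreal (2 powr (p - 1) * (\<delta>\<^sup>2 / 2) powr p) * ennreal (T * Gamma (p / 2 + 1))
      + ennreal (2 powr (p - 1) * \<delta> powr p) * ennreal (L powr p * Gamma (p / 2 + 1)))"
    by (simp add: mult_left_mono add_left_mono)
  also have "\<dots> = ennreal (real N powr p * (2 powr (p - 1) * (\<delta>\<^sup>2 / 2) powr p * (T * Gamma (p / 2 + 1))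
      + 2 powr (p - 1) * \<delta> powr p * (L powr p * Gamma (p / 2 + 1))))"
    using T_nonneg p L_pos by (simp flip: ennreal_mult ennreal_plus)
  also have "\<dots> \<le> ennreal ((pi * L) powr p * Gamma (p / 2 + 1))"
  proof (rule ennreal_leI)
    have Nd: "real N * \<delta> = pi / 2" using N by (simp add: \<delta>_def)
    have e1: "real N powr p * \<delta> powr p = (pi / 2) powr p"
      using \<delta> by (simp add: Nd flip: powr_mult)
    have "real N powr p * (\<delta>\<^sup>2 / 2) powr p * T \<le> real N powr p * (\<delta>\<^sup>2 / 2) powr p * (L powr p * N)"
      by (intro mult_left_mono T_le) auto
    also have "real N powr p * (\<delta>\<^sup>2 / 2) powr p * (L powr p * N) = (N * (\<delta>\<^sup>2 / 2)) powr p * N * L powr p"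
      by (subst powr_mult) (auto simp only: mult_ac)
    also have "(N * (\<delta>\<^sup>2 / 2)) powr p * N \<le> (pi / 2) powr p"
    proof -
      have "N * (\<delta>\<^sup>2 / 2) = (pi\<^sup>2 / 8) / N" using N by (simp add: \<delta>_def power2_eq_square field_simps)
      moreover have "((pi\<^sup>2 / 8) / N) powr p = (pi\<^sup>2 / 8) powr p / N powr p"
        by (rule powr_divide)
      ultimately have "(N * (\<delta>\<^sup>2 / 2)) powr p * N = (pi\<^sup>2 / 8) powr p * (N / N powr p)"
        by (simp only: times_divide_eq_left times_divide_eq_right)
      also have "\<dots> \<le> (pi / 2) powr p * 1"
      proof (rule mult_mono)
        have "pi * pi \<le> 4 * pi" using pi_less_4 by (intro mult_right_mono) auto
        then show "(pi\<^sup>2 / 8) powr p \<le> (pi / 2) powr p"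
          using p by (intro powr_mono2) (auto simp: power2_eq_square)
        have "real N \<le> real N powr p" using N p powr_mono[of 1 p "real N"] by simp
        then show "N / N powr p \<le> 1" using N by simp
      qed auto
      finally show ?thesis by simp
    qed
    finally have e2: "real N powr p * (\<delta>\<^sup>2 / 2) powr p * T \<le> (pi / 2) powr p * L powr p"
      by (simp add: mult_right_mono)
    have "real N powr p * (2 powr (p - 1) * (\<delta>\<^sup>2 / 2) powr p * (T * Gamma (p / 2 + 1)) + 2 powr (p - 1) * \<delta> powr p * (L powr p * Gamma (p / 2 + 1)))
      = 2 powr (p - 1) * Gamma (p / 2 + 1) * (real N powr p * (\<delta>\<^sup>2 / 2) powr p * T + (real N powr p * \<delta> powr p) * L powr p)"
      by (simp add: algebra_simps)
    also have "\<dots> \<le> 2 powr (p - 1) * Gamma (p / 2 + 1) * ((pi / 2) powr p * L powr p + (pi / 2) powr p * L powr p)"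
      unfolding e1 using e2 p by (intro mult_left_mono add_right_mono) auto
    \<comment> \<open>The first-order and the second-order part have the same bound. Together with
      the factor \<open>2 powr (p - 1)\<close> of \<open>powr_add_le\<close> they turn the angle
      \<open>pi / 2\<close> into \<open>pi\<close>.\<close>
    also have "\<dots> = (2 powr (p - 1) * 2) * (pi / 2) powr p * L powr p * Gamma (p / 2 + 1)" by (simp add: algebra_simps)
    also have "2 powr (p - 1) * 2 = (2::real) powr p" by (simp add: powr_diff)
    also have "2 powr p * (pi / 2) powr p * L powr p = (pi * L) powr p"
      using L_pos by (simp flip: powr_mult)
    finally show "real N powr p * (2 powr (p - 1) * (\<delta>\<^sup>2 / 2) powr p * (T * Gamma (p / 2 + 1)) + 2 powr (p - 1) * \<delta> powr p * (L powr p * Gamma (p / 2 + 1)))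
      \<le> (pi * L) powr p * Gamma (p / 2 + 1)" .
  qed
  finally show ?thesis .
qed

end

section \<open>From Gaussian vectors to the sphere\<close>

text \<open>Equality fails only where \<open>norm_sq\<close> vanishes: there the division by zero in
  \<open>sphere_proj\<close> gives 0.\<close>

lemma norm_sq_sphere_proj_le: "norm_sq {..<N} (sphere_proj N x) \<le> 1"
proof (cases "norm_sq {..<N} x = 0")
  case False
  have "norm_sq {..<N} (sphere_proj N x) = (\<Sum>j<N. (cmod (x j))\<^sup>2 / norm_sq {..<N} x)"
    unfolding norm_sq_def[of _ "sphere_proj N x"] by (simp add: sphere_proj_def norm_divide power_divide)
  also have "\<dots> = 1" using False by (simp add: norm_sq_def flip: sum_divide_distrib)
  finally show ?thesis by simp
qed (simp add: sphere_proj_def norm_sq_def)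

lemma norm_sq_eq_0_iff: "finite I \<Longrightarrow> norm_sq I x = 0 \<longleftrightarrow> (\<forall>j\<in>I. x j = 0)"
  by (simp add: norm_sq_def sum_nonneg_eq_0_iff)

lemma sum_sphere_proj:
  "(\<Sum>j<N. x j * c j) = of_real (sqrt (norm_sq {..<N} x)) * (\<Sum>j<N. sphere_proj N x j * c j)"
proof (cases "norm_sq {..<N} x = 0")
  case True
  then show ?thesis using norm_sq_eq_0_iff[of "{..<N}" x] by auto
next
  case False
  then show ?thesis by (simp add: sphere_proj_def sum_distrib_left)
qed

text \<open>The mean of \<open>norm_sq\<close> for a Gaussian vector is
  \<open>Gamma (N + 1) / Gamma N = N\<close>; dividing the second moment of a Gaussian linear form
  by it gives the moment on the sphere. This identifies the covariance at \<open>(z, z)\<close> with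
  \<open>B z / N\<close>.\<close>

lemma uniform_sphere_sum_sq:
  assumes N: "N \<ge> 1"
  shows "(\<integral>\<^sup>+a. ennreal ((cmod (\<Sum>j<N. a j * c j))\<^sup>2) \<partial>uniform_sphere N) = ennreal (norm_sq {..<N} c / N)"
proof -
  let ?g = "\<lambda>a. ennreal ((cmod (\<Sum>j<N. a j * c j))\<^sup>2)"
  have meas [measurable]: "?g \<in> borel_measurable (lborel_vec {..<N})" by measurable
  have Gam: "Gamma (real N + 2 / 2) / Gamma (real N) = N"
  proof -
    have "Gamma (real N) > 0" using N by simp
    then have "Gamma (real N) \<noteq> 0" by linarith
    moreover have "Gamma (real N + 2 / 2) = N * Gamma (real N)"
      using N Gamma_plus1[of "real N"] by (simp add: nonpos_Ints_def)
    ultimately show ?thesis by (simp only: times_divide_eq_right[symmetric] divide_self mult_1_right not_False_eq_True)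
  qed
  have "ennreal N * (\<integral>\<^sup>+a. ?g a \<partial>uniform_sphere N)
      = (\<integral>\<^sup>+x. ennreal (norm_sq {..<N} x powr (2 / 2)) * ?g (sphere_proj N x) \<partial>gauss_vec {..<N})"
  proof (subst nn_integral_gauss_vec_polar[OF N, where b="norm_sq {..<N} c"])
    fix x
    have "cmod (\<Sum>j<N. sphere_proj N x j * c j) \<le> (\<Sum>j<N. cmod (sphere_proj N x j) * cmod (c j))"
      by (rule order_trans[OF norm_sum]) (simp add: norm_mult)
    then have "(cmod (\<Sum>j<N. sphere_proj N x j * c j))\<^sup>2 \<le> (\<Sum>j<N. cmod (sphere_proj N x j) * cmod (c j))\<^sup>2" by (intro power_mono) auto
    also have "\<dots> \<le> norm_sq {..<N} (sphere_proj N x) * norm_sq {..<N} c" unfolding norm_sq_def by (rule Cauchy_Schwarz_ineq_sum)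
    also have "\<dots> \<le> 1 * norm_sq {..<N} c" by (intro mult_right_mono norm_sq_sphere_proj_le) auto
    finally show "?g (sphere_proj N x) \<le> ennreal (norm_sq {..<N} c)" by (simp add: ennreal_leI)
  qed (use meas Gam in auto)
  also have "\<dots> = (\<integral>\<^sup>+x. ennreal (cmod (\<Sum>j<N. c j * x j) powr 2) \<partial>gauss_vec {..<N})"
  proof (rule nn_integral_cong)
    fix x
    have "(\<Sum>j<N. c j * x j) = of_real (sqrt (norm_sq {..<N} x)) * (\<Sum>j<N. sphere_proj N x j * c j)"
      using sum_sphere_proj[of x c N] by (simp add: mult.commute)
    then show "ennreal (norm_sq {..<N} x powr (2 / 2)) * ?g (sphere_proj N x) = ennreal (cmod (\<Sum>j<N. c j * x j) powr 2)"
      by (simp add: norm_mult power_mult_distrib flip: ennreal_mult)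
  qed
  also have "\<dots> = ennreal (norm_sq {..<N} c powr (2 / 2) * Gamma (2 / 2 + 1))"
    by (rule gauss_vec_sum_moment) auto
  also have "Gamma (2 / 2 + 1 :: real) = 1" using Gamma_fact[of 1, where 'a=real] by simp
  finally have "ennreal N * (\<integral>\<^sup>+a. ?g a \<partial>uniform_sphere N) = ennreal N * ennreal (norm_sq {..<N} c / N)"
    using N by (simp flip: ennreal_mult)
  then show ?thesis using N by (subst (asm) ennreal_mult_cancel_left) auto
qed

context random_lp
begin

lemma F_scale:
  assumes "\<And>z. h a z = of_real c * h b z" "c \<ge> 0"
  shows "F a = c * F b"
proof -
  have "Fp a = c powr p * Fp b" unfolding Fp_def assms(1) using assms(2)
    by (simp add: norm_mult powr_mult)
  then show ?thesis using assms(2) p0 by (simp add: F_def powr_mult powr_powr)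
qed

lemma F_sphere_proj: "F x = sqrt (norm_sq {..<N} x) * F (sphere_proj N x)"
  by (rule F_scale) (auto simp: h_def intro: sum_sphere_proj)

lemma F_sphere_proj_le: "F (sphere_proj N x) \<le> L"
proof -
  have "F (sphere_proj N x) \<le> sqrt (norm_sq {..<N} (sphere_proj N x)) * L" by (rule F_le)
  also have "\<dots> \<le> 1 * L" using norm_sq_sphere_proj_le L_pos by (intro mult_right_mono) auto
  finally show ?thesis by simp
qed

text \<open>\<open>F\<close> is homogeneous of degree 1, so its moments split into a radial factor
  and a moment on the sphere. The exponents \<open>p\<close> and 1 are needed: the first for the
  main term, the second for the mean.\<close>

lemma F_polar:
  assumes q: "q > 0"
  shows "(\<integral>\<^sup>+x. ennreal (F x powr q) \<partial>gauss_vec {..<N}) = ennreal (Gamma (N + q / 2) / Gamma N) * (\<integral>\<^sup>+x. ennreal (F x powr q) \<partial>uniform_sphere N)"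
proof -
  have "(\<integral>\<^sup>+x. ennreal (F x powr q) \<partial>gauss_vec {..<N}) = (\<integral>\<^sup>+x. ennreal (norm_sq {..<N} x powr (q / 2)) * ennreal (F (sphere_proj N x) powr q) \<partial>gauss_vec {..<N})"
    by (intro nn_integral_cong, subst F_sphere_proj) (simp add: powr_mult F_nonneg powr_sqrt_eq flip: ennreal_mult)
  also have "\<dots> = ennreal (Gamma (N + q / 2) / Gamma N) * (\<integral>\<^sup>+x. ennreal (F x powr q) \<partial>uniform_sphere N)"
  proof (rule nn_integral_gauss_vec_polar[OF N, where b="L powr q"])
    fix x show "ennreal (F (sphere_proj N x) powr q) \<le> ennreal (L powr q)"
      using F_sphere_proj_le F_nonneg q by (intro ennreal_leI powr_mono2) auto
  qed (use q in auto)
  finally show ?thesis .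
qed

lemma gauss_F_integrable: "integrable (gauss_vec {..<N}) F"
proof (rule integrableI_nonneg)
  interpret G: prob_space "gauss_vec {..<N}" by (rule prob_gauss_vec)
  have le: "F x \<le> 1 + Fp x" for x
  proof (cases "F x \<le> 1")
    case False
    then have "F x \<le> F x powr p" using p powr_mono[of 1 p "F x"] by simp
    then show ?thesis by (simp add: F_powr)
  qed (use Fp_nonneg[of x] in auto)
  have "(\<integral>\<^sup>+x. ennreal (F x) \<partial>gauss_vec {..<N}) \<le> (\<integral>\<^sup>+x. 1 + ennreal (Fp x) \<partial>gauss_vec {..<N})"
    using le Fp_nonneg by (intro nn_integral_mono) (simp flip: ennreal_plus ennreal_1 add: ennreal_leI)
  also have "\<dots> = 1 + ennreal (T * Gamma (p / 2 + 1))"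
    by (subst nn_integral_add) (auto simp: gauss_Fp G.emeasure_space_1)
  also have "\<dots> < \<infinity>" by simp
  finally show "(\<integral>\<^sup>+x. ennreal (F x) \<partial>gauss_vec {..<N}) < \<infinity>" .
qed (auto simp: F_nonneg)

definition m :: real where "m = (\<integral>x. F x \<partial>gauss_vec {..<N})"

definition w :: real where "w = pi * L * Gamma (p / 2 + 1) powr (1 / p)"

lemma m_nonneg: "m \<ge> 0" unfolding m_def by (intro integral_nonneg_AE) (auto simp: F_nonneg)

lemma w_pos: "w > 0"
proof -
  have "Gamma (p / 2 + 1) > 0" using p by simp
  then have "Gamma (p / 2 + 1) powr (1 / p) > 0" by (simp only: powr_gt_zero less_imp_neq[symmetric] not_False_eq_True)
  then show ?thesis unfolding w_def using L_pos by (intro mult_pos_pos) auto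
qed

lemma w_powr: "w powr p = (pi * L) powr p * Gamma (p / 2 + 1)"
proof -
  have "Gamma (p / 2 + 1) > 0" using p by simp
  then show ?thesis using L_pos p0 by (simp add: w_def powr_mult powr_powr)
qed

text \<open>For fixed \<open>y\<close>, \<open>F y\<close> is at most \<open>m\<close> plus the mean
  over an independent \<open>x\<close> of the positive part of \<open>F y - F x\<close>. Taking p-th
  powers by \<open>powr_add_le_weighted\<close> and averaging over \<open>y\<close> brings in
  exactly the moment of \<open>gauss_concentration\<close>, which is at most
  \<open>w powr p\<close>.\<close>

lemma gauss_Lp_le: "(T * Gamma (p / 2 + 1)) powr (1 / p) \<le> m + w"
proof -
  interpret G: prob_space "gauss_vec {..<N}" by (rule prob_gauss_vec)
  interpret P: pair_sigma_finite "gauss_vec {..<N}" "gauss_vec {..<N}" ..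
  define D where "D y x = max 0 (F y - F x)" for x y
  have Dm [measurable]: "(\<lambda>q. D (snd q) (fst q)) \<in> borel_measurable (lborel_vec {..<N} \<Otimes>\<^sub>M lborel_vec {..<N})"
    unfolding D_def by measurable
  have [measurable]: "D y \<in> borel_measurable (lborel_vec {..<N})" for y unfolding D_def by measurable
  have Dint: "integrable (gauss_vec {..<N}) (D y)" for y
    by (rule G.integrable_const_bound[where B="F y"]) (auto simp: D_def F_nonneg)
  have pt: "ennreal (Fp y) \<le> ennreal ((m + w) powr (p - 1)) * (ennreal m + ennreal (w powr (1 - p)) * (\<integral>\<^sup>+x. ennreal (D y x powr p) \<partial>gauss_vec {..<N}))" for y
  proof -
    define W where "W = (\<integral>x. D y x \<partial>gauss_vec {..<N})"
    have W: "W \<ge> 0" unfolding W_def by (intro integral_nonneg_AE) (auto simp: D_def)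
    have "F y = (\<integral>x. F y \<partial>gauss_vec {..<N})" using G.prob_space by simp
    also have "\<dots> \<le> (\<integral>x. F x + D y x \<partial>gauss_vec {..<N})"
      using Dint gauss_F_integrable by (intro integral_mono) (auto simp: D_def)
    also have "\<dots> = m + W" unfolding m_def W_def using Dint gauss_F_integrable by (intro Bochner_Integration.integral_add) auto
    finally have "Fp y \<le> (m + W) powr p"
      unfolding F_powr[symmetric] using F_nonneg p by (intro powr_mono2) auto
    also have "\<dots> \<le> (m + w) powr (p - 1) * (m + w powr (1 - p) * W powr p)"
      by (rule powr_add_le_weighted[OF p1 m_nonneg W w_pos])
    finally have "ennreal (Fp y) \<le> ennreal ((m + w) powr (p - 1)) * (ennreal m + ennreal (w powr (1 - p)) * ennreal (W powr p))"
      using m_nonneg by (simp add: ennreal_leI flip: ennreal_mult ennreal_plus)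
    also have "ennreal (W powr p) \<le> (\<integral>\<^sup>+x. ennreal (D y x powr p) \<partial>gauss_vec {..<N})"
      unfolding W_def by (rule jensen_powr_nn_integral[OF prob_gauss_vec p1 Dint]) (simp add: D_def)
    finally show ?thesis by (simp add: mult_left_mono add_left_mono)
  qed
  have "ennreal (T * Gamma (p / 2 + 1)) = (\<integral>\<^sup>+y. ennreal (Fp y) \<partial>gauss_vec {..<N})" by (simp add: gauss_Fp)
  also have "\<dots> \<le> (\<integral>\<^sup>+y. ennreal ((m + w) powr (p - 1)) * (ennreal m + ennreal (w powr (1 - p)) * (\<integral>\<^sup>+x. ennreal (D y x powr p) \<partial>gauss_vec {..<N})) \<partial>gauss_vec {..<N})"
    by (intro nn_integral_mono pt)
  also have "\<dots> = ennreal ((m + w) powr (p - 1)) * (ennreal m + ennreal (w powr (1 - p)) * (\<integral>\<^sup>+y. \<integral>\<^sup>+x. ennreal (D y x powr p) \<partial>gauss_vec {..<N} \<partial>gauss_vec {..<N}))"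
    unfolding D_def
    by (subst nn_integral_cmult, measurable, subst nn_integral_add, measurable, subst nn_integral_cmult, measurable)
      (auto simp: G.emeasure_space_1)
  also have "(\<integral>\<^sup>+y. \<integral>\<^sup>+x. ennreal (D y x powr p) \<partial>gauss_vec {..<N} \<partial>gauss_vec {..<N}) = (\<integral>\<^sup>+q. ennreal (max 0 (F (snd q) - F (fst q)) powr p) \<partial>(gauss_vec {..<N} \<Otimes>\<^sub>M gauss_vec {..<N}))"
    by (subst P.nn_integral_snd[symmetric]) (auto simp: D_def)
  also have "\<dots> \<le> ennreal (w powr p)" unfolding w_powr by (rule gauss_concentration)
  finally have "ennreal (T * Gamma (p / 2 + 1)) \<le> ennreal ((m + w) powr (p - 1)) * (ennreal m + ennreal (w powr (1 - p)) * ennreal (w powr p))"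
    by (simp add: mult_left_mono add_left_mono)
  also have "\<dots> = ennreal ((m + w) powr (p - 1) * (m + w powr (1 - p) * w powr p))"
    using m_nonneg by (simp flip: ennreal_mult ennreal_plus)
  also have "w powr (1 - p) * w powr p = w" using w_pos by (simp flip: powr_add)
  also have "(m + w) powr (p - 1) * (m + w) = (m + w) powr p" using m_nonneg w_pos by (simp add: powr_diff)
  finally have "T * Gamma (p / 2 + 1) \<le> (m + w) powr p"
    by (simp add: ennreal_le_iff)
  then have "(T * Gamma (p / 2 + 1)) powr (1 / p) \<le> ((m + w) powr p) powr (1 / p)"
    using T_nonneg p by (intro powr_mono2) auto
  also have "\<dots> = m + w" using m_nonneg w_pos p0 by (simp add: powr_powr)
  finally show ?thesis .
qed

lemma sphere_F_integrable: "integrable (uniform_sphere N) F"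
  and m_eq: "m = Gamma (N + 1 / 2) / Gamma N * (\<integral>a. F a \<partial>uniform_sphere N)"
proof -
  define c where "c = Gamma (real N + 1 / 2) / Gamma N"
  have c: "c > 0" using N by (simp add: c_def)
  have "(\<integral>\<^sup>+x. ennreal (F x) \<partial>gauss_vec {..<N}) = ennreal c * (\<integral>\<^sup>+x. ennreal (F x) \<partial>uniform_sphere N)"
    using F_polar[of 1] F_nonneg by (simp add: c_def)
  moreover have "(\<integral>\<^sup>+x. ennreal (F x) \<partial>gauss_vec {..<N}) = ennreal m"
    unfolding m_def using gauss_F_integrable F_nonneg by (intro nn_integral_eq_integral) auto
  ultimately have *: "ennreal m = ennreal c * (\<integral>\<^sup>+x. ennreal (F x) \<partial>uniform_sphere N)" by simp
  then have "(\<integral>\<^sup>+x. ennreal (F x) \<partial>uniform_sphere N) \<noteq> \<infinity>"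
    using c by (metis ennreal_mult_eq_top_iff ennreal_neq_top infinity_ennreal_def ennreal_eq_0_iff not_le)
  then show I: "integrable (uniform_sphere N) F"
    using F_nonneg by (intro integrableI_nonneg) (auto simp: less_top)
  then have "(\<integral>\<^sup>+x. ennreal (F x) \<partial>uniform_sphere N) = ennreal (\<integral>a. F a \<partial>uniform_sphere N)"
    using F_nonneg by (intro nn_integral_eq_integral) auto
  with * have "ennreal m = ennreal (c * (\<integral>a. F a \<partial>uniform_sphere N))"
    using c F_nonneg by (simp add: ennreal_mult)
  then show "m = Gamma (N + 1 / 2) / Gamma N * (\<integral>a. F a \<partial>uniform_sphere N)"
    using m_nonneg c F_nonneg unfolding c_def[symmetric] by (subst (asm) ennreal_inj) auto
qed

text \<open>\<open>zp\<close>, the bound for the p-norm on the sphere computed from the exact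
  moment, lies between the mean \<open>EZ\<close>, by Jensen, and \<open>main\<close>, by
  \<open>Gamma_shift_ratio\<close>. The gap to \<open>EZ\<close> comes from
  \<open>gauss_Lp_le\<close> divided by \<open>sqrt N\<close>, the gap to \<open>main\<close> is
  \<open>zp\<close> times at most \<open>3 / (2 * N)\<close>; the constants 4 and 3/2 are rounded up
  to 6.\<close>

theorem expected_Lp_norm:
  "\<bar>(\<integral>a. F a \<partial>uniform_sphere N) - T powr (1 / p) * (Gamma (p / 2 + 1) * Gamma (N - 1 / 2) / Gamma (p / 2 + N - 1 / 2)) powr (1 / p)\<bar>
    \<le> 6 * sqrt p * L / sqrt N"
proof -
  define EZ where "EZ = (\<integral>a. F a \<partial>uniform_sphere N)"
  define g where "g = Gamma (p / 2 + 1)"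
  define c where "c = Gamma (real N + p / 2) / Gamma N"
  have N1: "real N \<ge> 1" using N by simp
  have pos: "Gamma (real N) > 0" "Gamma (N + p / 2) > 0" "g > 0" "Gamma (N - 1 / 2) > 0" "Gamma (p / 2 + N - 1 / 2) > 0" "c > 0"
    using p N1 by (auto simp: g_def c_def)
  have EZ0: "EZ \<ge> 0" unfolding EZ_def by (intro integral_nonneg_AE) (auto simp: F_nonneg)
  define zp where "zp = (T * g / c) powr (1 / p)"
  have zp0: "zp \<ge> 0" by (simp add: zp_def)
  have "ennreal (EZ powr p) \<le> (\<integral>\<^sup>+a. ennreal (F a powr p) \<partial>uniform_sphere N)"
    unfolding EZ_def
    by (rule jensen_powr_nn_integral[OF prob_space_uniform_sphere[OF N] p1 sphere_F_integrable]) (simp add: F_nonneg)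
  then have "ennreal c * ennreal (EZ powr p) \<le> (\<integral>\<^sup>+x. ennreal (F x powr p) \<partial>gauss_vec {..<N})"
    unfolding F_polar[OF p0(1)] c_def by (rule mult_left_mono) simp
  also have "\<dots> = ennreal (T * g)" unfolding F_powr g_def by (rule gauss_Fp)
  finally have "c * EZ powr p \<le> T * g"
    using pos T_nonneg by (simp add: ennreal_le_iff flip: ennreal_mult)
  then have "EZ powr p \<le> T * g / c" using pos by (simp add: field_simps)
  then have "(EZ powr p) powr (1 / p) \<le> zp" unfolding zp_def using p by (intro powr_mono2) auto
  then have a: "EZ \<le> zp" using EZ0 p0 by (simp add: powr_powr)
  \<comment> \<open>\<open>c\<close> is the p-th moment of the Gaussian radius. Bounding it below by
    \<open>N powr (p / 2)\<close>, and later the mean radius above by \<open>sqrt N\<close>, are the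
    directions needed to divide \<open>gauss_Lp_le\<close> by \<open>sqrt N\<close>.\<close>
  have cN: "real N powr (p / 2) \<le> c"
    using Gamma_add_ge[of "real N" "p / 2"] p N1 pos by (simp add: c_def field_simps)
  then have "T * g / c \<le> T * g / real N powr (p / 2)"
    using T_nonneg pos N1 by (intro divide_left_mono) auto
  then have "zp \<le> (T * g / real N powr (p / 2)) powr (1 / p)"
    unfolding zp_def using T_nonneg pos p by (intro powr_mono2) auto
  also have "\<dots> = (T * g) powr (1 / p) / sqrt N"
    using T_nonneg pos p0 N1 by (simp add: powr_divide powr_powr powr_half_sqrt)
  finally have zp1: "zp \<le> (T * g) powr (1 / p) / sqrt N" .
  have wle: "w \<le> 4 * L * sqrt p"
  proof -
    have "w \<le> pi * L * sqrt p" unfolding w_def using Gamma_powr_le_sqrt[OF p] L_pos by (intro mult_left_mono) auto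
    also have "\<dots> \<le> 4 * L * sqrt p" using pi_less_4 L_pos p by (intro mult_right_mono) auto
    finally show ?thesis .
  qed
  have "m \<le> sqrt N * EZ"
  proof -
    have "Gamma (real N + 1 / 2) / Gamma N \<le> sqrt N"
      using Gamma_half_le[of "real N"] N1 pos by (simp add: field_simps)
    then show ?thesis unfolding m_eq EZ_def[symmetric] using EZ0 by (intro mult_right_mono) auto
  qed
  then have "(T * g) powr (1 / p) \<le> sqrt N * EZ + 4 * L * sqrt p"
    using gauss_Lp_le wle by (simp add: g_def)
  then have "zp \<le> (sqrt N * EZ + 4 * L * sqrt p) / sqrt N"
    using N1 by (intro order_trans[OF zp1] divide_right_mono) auto
  then have b: "zp - EZ \<le> 4 * L * sqrt p / sqrt N"
    using N1 by (simp add: add_divide_distrib)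
  define main where "main = T powr (1 / p) * (g * Gamma (N - 1 / 2) / Gamma (p / 2 + N - 1 / 2)) powr (1 / p)"
  have main_eq: "main = (T powr (1 / p) * g powr (1 / p)) * (Gamma (N - 1 / 2) / Gamma (p / 2 + N - 1 / 2)) powr (1 / p)"
    unfolding main_def using pos powr_mult[of g "Gamma (N - 1 / 2) / Gamma (p / 2 + N - 1 / 2)" "1 / p"] by simp
  have zp_eq: "zp = (T powr (1 / p) * g powr (1 / p)) * (Gamma N / Gamma (N + p / 2)) powr (1 / p)"
    unfolding zp_def c_def using pos T_nonneg powr_mult[of "T * g" "Gamma N / Gamma (N + p / 2)" "1 / p"]
    by (simp add: powr_mult)
  have mz1: "zp \<le> main" unfolding main_eq zp_eq
    using Gamma_shift_ratio(1)[OF p N1] by (intro mult_left_mono) auto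
  have "main \<le> (T powr (1 / p) * g powr (1 / p)) * ((Gamma N / Gamma (N + p / 2)) powr (1 / p) * (1 + 3 / (2 * N)))"
    unfolding main_eq using Gamma_shift_ratio(2)[OF p N1] by (intro mult_left_mono) auto
  then have "main \<le> zp * (1 + 3 / (2 * N))" by (simp add: zp_eq mult_ac)
  then have "main - zp \<le> zp * (3 / (2 * N))" by (simp add: algebra_simps)
  \<comment> \<open>The relative error \<open>3 / (2 * N)\<close> leaves room for losing a whole
    factor \<open>N\<close> in the bound of \<open>zp\<close>.\<close>
  also have "\<dots> \<le> (L * sqrt p / sqrt N * N) * (3 / (2 * N))"
  proof (rule mult_right_mono)
    have "(T * g) powr (1 / p) \<le> L * N * sqrt p"
    proof -
      have "T powr (1 / p) \<le> (L powr p * N) powr (1 / p)" using T_le T_nonneg p by (intro powr_mono2) auto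
      also have "\<dots> = L * real N powr (1 / p)" using L_pos p0 N1 by (simp add: powr_mult powr_powr)
      also have "\<dots> \<le> L * N" using L_pos p N1 powr_mono[of "1 / p" 1 "real N"] by (intro mult_left_mono) auto
      finally have "T powr (1 / p) * g powr (1 / p) \<le> L * N * sqrt p"
        using Gamma_powr_le_sqrt[OF p] L_pos by (intro mult_mono) (auto simp: g_def)
      then show ?thesis using T_nonneg pos by (simp add: powr_mult)
    qed
    then have "(T * g) powr (1 / p) / sqrt N \<le> L * N * sqrt p / sqrt N" by (intro divide_right_mono) auto
    with zp1 show "zp \<le> L * sqrt p / sqrt N * N" by (simp add: mult_ac)
  qed simp
  also have "\<dots> = 3 / 2 * (L * sqrt p / sqrt N)" using N1 by (simp add: field_simps)
  finally have d: "main - zp \<le> 3 / 2 * (L * sqrt p / sqrt N)" .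
  have "\<bar>EZ - main\<bar> \<le> (zp - EZ) + (main - zp)" using a mz1 by simp
  also have "\<dots> \<le> 4 * L * sqrt p / sqrt N + 3 / 2 * (L * sqrt p / sqrt N)" by (rule add_mono[OF b d])
  also have "\<dots> \<le> 6 * sqrt p * L / sqrt N" using L_pos p N1 by (simp add: field_simps)
  finally show ?thesis unfolding EZ_def main_def g_def .
qed

end

section \<open>The area mean value inequality and the hyperbolic area\<close>

text \<open>Cauchy's formula on the circle through \<open>z + w\<close>. The starting point is kept
  as a parameter so that the inequality can be integrated over all \<open>w\<close> in the
  disc.\<close>

lemma circle_mean_value:
  fixes f :: "complex \<Rightarrow> complex"
  assumes f: "f holomorphic_on ball z r" and w: "cmod w < r"
  shows "ennreal (cmod (f z)) \<le> (\<integral>\<^sup>+t. ennreal (cmod (f (z + w * exp (2 * of_real pi * \<i> * of_real t)))) * indicator {0..1} t \<partial>lborel)"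
proof -
  define e where "e t = exp (2 * of_real pi * \<i> * of_real t)" for t :: real
  define g where "g \<zeta> = f (z + w * \<zeta>)" for \<zeta>
  have r: "r > 0" using w norm_ge_zero[of w] by linarith
  have "g holomorphic_on cball 0 1"
    unfolding g_def
  proof (rule holomorphic_on_compose_gen[OF _ f, unfolded o_def])
    show "(\<lambda>\<zeta>. z + w * \<zeta>) ` cball 0 1 \<subseteq> ball z r"
    proof safe
      fix \<zeta> :: complex assume "\<zeta> \<in> cball 0 1"
      then have "cmod w * cmod \<zeta> \<le> cmod w * 1" by (intro mult_left_mono) auto
      then show "z + w * \<zeta> \<in> ball z r" using w by (simp add: dist_norm norm_mult)
    qed
  qed (intro holomorphic_intros)
  then have "((\<lambda>u. g u / (u - 0)) has_contour_integral (2 * of_real pi * \<i> * g 0)) (circlepath 0 1)"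
    by (intro Cauchy_integral_circlepath_simple) auto
  then have "((\<lambda>t. g (circlepath 0 1 t) / (circlepath 0 1 t - 0) * vector_derivative (circlepath 0 1) (at t within {0..1}))
     has_integral (2 * of_real pi * \<i> * g 0)) {0..1}"
    by (simp only: has_contour_integral_def)
  then have "((\<lambda>t. 2 * of_real pi * \<i> * g (e t)) has_integral (2 * of_real pi * \<i> * g 0)) {0..1}"
  proof (rule has_integral_eq[rotated])
    fix t :: real assume t: "t \<in> {0..1}"
    have v: "vector_derivative (circlepath 0 1) (at t within {0..1}) = 2 * of_real pi * \<i> * e t"
      using vector_derivative_circlepath01[of t 0 1] t by (simp add: e_def)
    have c: "circlepath 0 1 t = e t" by (simp add: circlepath e_def)
    show "g (circlepath 0 1 t) / (circlepath 0 1 t - 0) * vector_derivative (circlepath 0 1) (at t within {0..1})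
      = 2 * of_real pi * \<i> * g (e t)"
      unfolding v c by (simp add: e_def)
  qed
  then have "((\<lambda>t. (1 / (2 * of_real pi * \<i>)) * (2 * of_real pi * \<i> * g (e t))) has_integral (1 / (2 * of_real pi * \<i>)) * (2 * of_real pi * \<i> * g 0)) {0..1}"
    by (rule has_integral_mult_right)
  then have hi: "((\<lambda>t. g (e t)) has_integral g 0) {0..1}" by simp
  have "continuous_on {0..1} (\<lambda>t. g (e t))"
  proof (rule continuous_on_compose2[of "cball 0 1" g])
    show "continuous_on (cball 0 1) g"
      using \<open>g holomorphic_on cball 0 1\<close> by (rule holomorphic_on_imp_continuous_on)
    show "continuous_on {0..1} e" unfolding e_def by (intro continuous_intros)
    show "e ` {0..1} \<subseteq> cball 0 1" by (auto simp: e_def norm_exp_eq_Re)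
  qed
  then have si: "set_integrable lborel {0..1} (\<lambda>t. g (e t))" by (rule borel_integrable_atLeastAtMost')
  then have "(LINT t:{0..1}|lborel. g (e t)) = g 0"
    using set_borel_integral_eq_integral(2)[OF si] hi by (simp add: has_integral_iff)
  then have "ennreal (cmod (g 0)) = ennreal (norm (LINT t|lborel. indicat_real {0..1} t *\<^sub>R g (e t)))"
    by (simp add: set_lebesgue_integral_def)
  also have "\<dots> \<le> (\<integral>\<^sup>+t. ennreal (norm (indicat_real {0..1} t *\<^sub>R g (e t))) \<partial>lborel)"
    using si unfolding set_integrable_def by (rule integral_norm_bound_ennreal)
  also have "\<dots> = (\<integral>\<^sup>+t. ennreal (cmod (g (e t))) * indicator {0..1} t \<partial>lborel)"
    by (intro nn_integral_cong) (auto simp: indicator_def)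
  finally show ?thesis by (simp add: g_def e_def)
qed

text \<open>Averaging the circle mean value inequality over rotations of the disc avoids polar coordinates.\<close>

lemma area_mean_value:
  fixes f :: "complex \<Rightarrow> complex"
  assumes f: "f holomorphic_on ball z r" and r: "r > 0"
  shows "ennreal (pi * r\<^sup>2) * ennreal (cmod (f z)) \<le> (\<integral>\<^sup>+w. ennreal (cmod (f w)) * indicator (ball z r) w \<partial>lborel)"
proof -
  define e where "e t = exp (2 * of_real pi * \<i> * of_real t)" for t :: real
  have e1: "cmod (e t) = 1" for t by (simp add: e_def norm_exp_eq_Re)
  have [measurable]: "e \<in> borel_measurable borel"
    unfolding e_def by (intro borel_measurable_continuous_onI continuous_intros)
  define G where "G w = ennreal (cmod (f w)) * indicator (ball z r) w" for w
  have [measurable]: "G \<in> borel_measurable borel"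
  proof -
    have "continuous_on (ball z r) (\<lambda>w. cmod (f w))"
      using f by (intro continuous_intros holomorphic_on_imp_continuous_on)
    then have "(\<lambda>w. indicat_real (ball z r) w *\<^sub>R cmod (f w)) \<in> borel_measurable borel"
      by (intro borel_measurable_continuous_on_indicator) auto
    then have "(\<lambda>w. ennreal (indicat_real (ball z r) w *\<^sub>R cmod (f w))) \<in> borel_measurable borel" by simp
    moreover have "G = (\<lambda>w. ennreal (indicat_real (ball z r) w *\<^sub>R cmod (f w)))"
      by (auto simp: G_def indicator_def)
    ultimately show ?thesis by simp
  qed
  have "ennreal (pi * r\<^sup>2) * ennreal (cmod (f z)) = (\<integral>\<^sup>+w. ennreal (cmod (f z)) * indicator (ball 0 r) w \<partial>(lborel :: complex measure))"
    using r by (simp add: nn_integral_cmult_indicator emeasure_ball unit_ball_vol_2 mult.commute)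
  also have "\<dots> \<le> (\<integral>\<^sup>+w. \<integral>\<^sup>+t. G (z + e t * w) * indicator {0..1} t \<partial>lborel \<partial>lborel)"
  proof (rule nn_integral_mono)
    fix w :: complex
    show "ennreal (cmod (f z)) * indicator (ball 0 r) w \<le> (\<integral>\<^sup>+t. G (z + e t * w) * indicator {0..1} t \<partial>lborel)"
    proof (cases "cmod w < r")
      case True
      have "ennreal (cmod (f z)) \<le> (\<integral>\<^sup>+t. ennreal (cmod (f (z + w * e t))) * indicator {0..1} t \<partial>lborel)"
        using circle_mean_value[OF f True] by (simp add: e_def)
      also have "\<dots> = (\<integral>\<^sup>+t. G (z + e t * w) * indicator {0..1} t \<partial>lborel)"
        using True by (intro nn_integral_cong) (simp add: G_def indicator_def dist_norm norm_mult e1 mult.commute)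
      finally show ?thesis using True by simp
    qed (simp add: indicator_def)
  qed
  also have "\<dots> = (\<integral>\<^sup>+t. \<integral>\<^sup>+w. G (z + e t * w) * indicator {0..1} t \<partial>lborel \<partial>lborel)"
    by (rule lborel_pair.Fubini'[symmetric]) measurable
  also have "\<dots> = (\<integral>\<^sup>+t. (\<integral>\<^sup>+w. G w \<partial>lborel) * indicator {0..1::real} t \<partial>lborel)"
  proof (rule nn_integral_cong)
    fix t :: real
    have "(\<integral>\<^sup>+w. G (z + e t * w) * indicator {0..1} t \<partial>lborel) = (\<integral>\<^sup>+w. G (z + e t * w) \<partial>lborel) * indicator {0..1} t"
      by (rule nn_integral_multc) measurable
    also have "(\<integral>\<^sup>+w. G (z + e t * w) \<partial>lborel) = (\<integral>\<^sup>+w. G (z + w) \<partial>lborel)"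
      using nn_integral_lborel_rotate[of "e t" "\<lambda>w. G (z + w)"] e1 by simp
    also have "\<dots> = (\<integral>\<^sup>+w. G w \<partial>distr lborel borel ((+) z))"
      by (subst nn_integral_distr) auto
    also have "\<dots> = (\<integral>\<^sup>+w. G w \<partial>lborel)" by (simp add: lborel_distr_plus)
    finally show "(\<integral>\<^sup>+w. G (z + e t * w) * indicator {0..1} t \<partial>lborel) = (\<integral>\<^sup>+w. G w \<partial>lborel) * indicator {0..1} t" .
  qed
  also have "\<dots> = (\<integral>\<^sup>+w. G w \<partial>lborel)"
    by (simp add: nn_integral_cmult_indicator)
  finally show ?thesis by (simp add: G_def)
qed

section \<open>Invariance of the hyperbolic area\<close>

lemma lborel_complex_eq: "lborel = distr (lborel \<Otimes>\<^sub>M lborel) borel (\<lambda>(x, y). Complex x y)"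
proof (rule lborel_eqI)
  have [measurable]: "(\<lambda>(x, y). Complex x y) \<in> borel_measurable (borel :: (real \<times> real) measure)"
    unfolding Complex_eq case_prod_beta by (intro borel_measurable_continuous_onI continuous_intros)
  have m: "(\<lambda>(x, y). Complex x y) \<in> (lborel :: real measure) \<Otimes>\<^sub>M lborel \<rightarrow>\<^sub>M borel"
    by (simp add: lborel_prod)
  fix l u :: complex assume lu: "\<And>b. b \<in> Basis \<Longrightarrow> l \<bullet> b \<le> u \<bullet> b"
  have "Re l \<le> Re u" "Im l \<le> Im u" using lu[of 1] lu[of \<i>] by (auto simp: Basis_complex_def inner_complex_def)
  moreover have "emeasure (distr (lborel \<Otimes>\<^sub>M lborel) borel (\<lambda>(x, y). Complex x y)) (box l u)
    = emeasure (lborel \<Otimes>\<^sub>M lborel) ({Re l<..<Re u} \<times> {Im l<..<Im u})"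
    by (subst emeasure_distr[OF m])
      (auto intro!: arg_cong[where f="emeasure _"] simp: box_def Basis_complex_def inner_complex_def space_pair_measure)
  ultimately show "emeasure (distr (lborel \<Otimes>\<^sub>M lborel) borel (\<lambda>(x, y). Complex x y)) (box l u)
     = ennreal (\<Prod>b\<in>Basis. (u - l) \<bullet> b)"
    by (simp add: lborel.emeasure_pair_measure_Times Basis_complex_def inner_complex_def ennreal_mult)
qed simp

text \<open>The substitution \<open>y = exp s\<close> is made on the compact intervals from
  \<open>- n\<close> to \<open>n\<close>, and monotone convergence exhausts the line.\<close>

lemma distr_exp: "distr lborel borel exp = density lborel (\<lambda>y. ennreal (1 / y) * indicator {0<..} y)"
proof (rule measure_eqI)
  fix A :: "real set" assume "A \<in> sets (distr lborel borel exp)"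
  then have [measurable]: "A \<in> sets borel" by simp
  let ?f = "\<lambda>y. indicat_real A y / y"
  let ?J = "\<lambda>n::nat. {exp (- real n)..exp (real n)}"
  have J: "indicator {0<..} y = (SUP n. indicator (?J n) y :: ennreal)" for y :: real
  proof (cases "y > 0")
    case True
    obtain n where n: "\<bar>ln y\<bar> \<le> real n" using real_arch_simple by blast
    then have "exp (- real n) \<le> exp (ln y)" "exp (ln y) \<le> exp (real n)" unfolding exp_le_cancel_iff by auto
    then have "y \<in> ?J n" using True by simp
    then have "1 \<le> (SUP n. indicator (?J n) y :: ennreal)" by (intro SUP_upper2[of n]) auto
    moreover have "(SUP n. indicator (?J n) y :: ennreal) \<le> 1" by (intro SUP_least) (auto simp: indicator_def)
    ultimately show ?thesis using True by auto
  next
    case False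
    then have "y \<notin> ?J n" for n using exp_gt_zero[of "- real n"] by (auto simp del: exp_gt_zero)
    then show ?thesis using False by simp
  qed
  have Jmono: "?J a \<subseteq> ?J b" if "a \<le> b" for a b
    using that by simp
  have J': "1 = (SUP n. indicator {- real n..real n} s :: ennreal)" for s :: real
  proof -
    obtain n where n: "\<bar>s\<bar> \<le> real n" using real_arch_simple by blast
    then have "1 \<le> (SUP n. indicator {- real n..real n} s :: ennreal)"
      by (intro SUP_upper2[of n]) (auto simp: indicator_def)
    moreover have "(SUP n. indicator {- real n..real n} s :: ennreal) \<le> 1" by (intro SUP_least) (auto simp: indicator_def)
    ultimately show ?thesis by auto
  qed
  have "emeasure (density lborel (\<lambda>y. ennreal (1 / y) * indicator {0<..} y)) A
      = (\<integral>\<^sup>+y. ennreal (1 / y) * indicator {0<..} y * indicator A y \<partial>lborel)"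
    by (subst emeasure_density) auto
  also have "\<dots> = (\<integral>\<^sup>+y. (SUP n. ennreal (?f y) * indicator (?J n) y) \<partial>lborel)"
    unfolding J by (intro nn_integral_cong, subst SUP_mult_left_ennreal[symmetric]) (auto simp: indicator_def)
  also have "\<dots> = (SUP n. \<integral>\<^sup>+y. ennreal (?f y) * indicator (?J n) y \<partial>lborel)"
  proof (intro nn_integral_monotone_convergence_SUP incseq_SucI le_funI mult_left_mono indicator_leI)
    fix n y assume "y \<in> ?J n"
    then show "y \<in> ?J (Suc n)" using Jmono[OF le_SucI[OF le_refl[of n]]] by blast
  qed auto
  also have "\<dots> = (SUP n. \<integral>\<^sup>+s. indicator A (exp s) * indicator {- real n..real n} s \<partial>lborel)"
  proof (rule SUP_cong)
    fix n :: nat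
    have "(\<integral>\<^sup>+y. ennreal (?f y) * indicator (?J n) y \<partial>lborel) = (\<integral>\<^sup>+y. ennreal (?f y * indicator (?J n) y) \<partial>lborel)"
      by (intro nn_integral_cong) (auto simp: indicator_def)
    also have "\<dots> = (\<integral>\<^sup>+s. ennreal (?f (exp s) * exp s * indicator {- real n..real n} s) \<partial>lborel)"
      by (rule nn_integral_substitution[where g=exp])
        (auto simp: set_borel_measurable_def intro!: derivative_eq_intros continuous_intros)
    also have "\<dots> = (\<integral>\<^sup>+s. indicator A (exp s) * indicator {- real n..real n} s \<partial>lborel)"
      by (intro nn_integral_cong) (auto simp: indicator_def)
    finally show "(\<integral>\<^sup>+y. ennreal (?f y) * indicator (?J n) y \<partial>lborel) = (\<integral>\<^sup>+s. indicator A (exp s) * indicator {- real n..real n} s \<partial>lborel)" .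
  qed simp
  also have "\<dots> = (\<integral>\<^sup>+s. (SUP n. indicator A (exp s) * indicator {- real n..real n} s) \<partial>lborel)"
    by (intro nn_integral_monotone_convergence_SUP[symmetric]) (auto simp: incseq_def le_fun_def indicator_def)
  also have "\<dots> = (\<integral>\<^sup>+s. indicator A (exp s) \<partial>lborel)"
    by (intro nn_integral_cong, subst SUP_mult_left_ennreal[symmetric]) (simp flip: J')
  also have "\<dots> = (\<integral>\<^sup>+y. indicator A y \<partial>distr lborel borel exp)" by (subst nn_integral_distr) auto
  also have "\<dots> = emeasure (distr lborel borel exp) A" by simp
  finally show "emeasure (distr lborel borel exp) A = emeasure (density lborel (\<lambda>y. ennreal (1 / y) * indicator {0<..} y)) A" ..
qed simp

lemma sets_hyp_area [measurable_cong, simp]: "sets hyp_area = sets borel"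
  by (simp add: hyp_area_def)

lemma space_hyp_area [simp]: "space hyp_area = UNIV"
  by (simp add: hyp_area_def)

lemma uhp_borel [measurable]: "upper_half_plane \<in> sets borel"
  unfolding upper_half_plane_def by measurable

lemma fund_domain_borel [measurable]: "fund_domain \<in> sets borel"
  unfolding fund_domain_def upper_half_plane_def by measurable

lemma nn_integral_hyp_area:
  assumes [measurable]: "\<phi> \<in> borel_measurable borel"
  shows "(\<integral>\<^sup>+z. \<phi> z \<partial>hyp_area) = (\<integral>\<^sup>+z. indicator upper_half_plane z * ennreal (1 / (Im z)\<^sup>2) * \<phi> z \<partial>lborel)"
  unfolding hyp_area_def by (subst nn_integral_density) auto

lemma sigma_finite_hyp_area: "sigma_finite_measure hyp_area"
  unfolding hyp_area_def
  by (subst sigma_finite_measure.sigma_finite_iff_density_finite[OF sigma_finite_lborel])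
    (auto simp: indicator_def)

lemma borel_measurable_Complex [measurable (raw)]:
  assumes [measurable]: "f \<in> borel_measurable M" "g \<in> borel_measurable M"
  shows "(\<lambda>x. Complex (f x) (g x)) \<in> borel_measurable M"
  unfolding Complex_eq by measurable

text \<open>In the coordinates \<open>z = e\<^sup>s (t + i)\<close> the hyperbolic area is Lebesgue measure \<open>ds dt\<close>.\<close>

lemma nn_integral_hyp_area_exp:
  assumes [measurable]: "\<phi> \<in> borel_measurable borel"
  shows "(\<integral>\<^sup>+z. \<phi> z \<partial>hyp_area) = (\<integral>\<^sup>+s. \<integral>\<^sup>+t. \<phi> (Complex (exp s * t) (exp s)) \<partial>lborel \<partial>lborel)"
proof -
  define h where "h z = indicator upper_half_plane z * ennreal (1 / (Im z)\<^sup>2) * \<phi> z" for z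
  have [measurable]: "h \<in> borel_measurable borel" unfolding h_def by measurable
  have "(\<integral>\<^sup>+z. \<phi> z \<partial>hyp_area) = (\<integral>\<^sup>+z. h z \<partial>lborel)" unfolding h_def by (rule nn_integral_hyp_area) measurable
  also have "\<dots> = (\<integral>\<^sup>+p. h (Complex (fst p) (snd p)) \<partial>(lborel \<Otimes>\<^sub>M lborel))"
    by (subst lborel_complex_eq, subst nn_integral_distr) (auto simp: case_prod_beta)
  also have "\<dots> = (\<integral>\<^sup>+y. \<integral>\<^sup>+x. h (Complex x y) \<partial>lborel \<partial>lborel)"
    by (subst lborel_pair.nn_integral_snd[symmetric]) auto
  also have "\<dots> = (\<integral>\<^sup>+y. ennreal (1 / y) * indicator {0<..} y * (\<integral>\<^sup>+t. \<phi> (Complex (y * t) y) \<partial>lborel) \<partial>lborel)"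
  proof (rule nn_integral_cong)
    fix y :: real
    show "(\<integral>\<^sup>+x. h (Complex x y) \<partial>lborel) = ennreal (1 / y) * indicator {0<..} y * (\<integral>\<^sup>+t. \<phi> (Complex (y * t) y) \<partial>lborel)"
    proof (cases "y > 0")
      case True
      have "(\<integral>\<^sup>+x. h (Complex x y) \<partial>lborel) = (\<integral>\<^sup>+x. ennreal (1 / y\<^sup>2) * \<phi> (Complex x y) \<partial>lborel)"
        using True by (simp add: h_def upper_half_plane_def)
      also have "\<dots> = ennreal (1 / y\<^sup>2) * (\<integral>\<^sup>+x. \<phi> (Complex x y) \<partial>lborel)"
        by (rule nn_integral_cmult) measurable
      also have "(\<integral>\<^sup>+x. \<phi> (Complex x y) \<partial>lborel) = ennreal \<bar>y\<bar> * (\<integral>\<^sup>+x. \<phi> (Complex (0 + y * x) y) \<partial>lborel)"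
        using True by (intro nn_integral_real_affine) auto
      also have "ennreal (1 / y\<^sup>2) * (ennreal \<bar>y\<bar> * (\<integral>\<^sup>+x. \<phi> (Complex (0 + y * x) y) \<partial>lborel))
        = ennreal (1 / y) * (\<integral>\<^sup>+t. \<phi> (Complex (y * t) y) \<partial>lborel)"
        using True by (simp add: power2_eq_square mult.assoc[symmetric] flip: ennreal_mult)
      finally show ?thesis using True by simp
    qed (simp add: h_def upper_half_plane_def)
  qed
  also have "\<dots> = (\<integral>\<^sup>+y. \<integral>\<^sup>+t. \<phi> (Complex (y * t) y) \<partial>lborel \<partial>density lborel (\<lambda>y. ennreal (1 / y) * indicator {0<..} y))"
    by (subst nn_integral_density) auto
  also have "\<dots> = (\<integral>\<^sup>+s. \<integral>\<^sup>+t. \<phi> (Complex (exp s * t) (exp s)) \<partial>lborel \<partial>lborel)"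
    unfolding distr_exp[symmetric] by (subst nn_integral_distr) auto
  finally show ?thesis .
qed

text \<open>In the coordinates \<open>(s, t)\<close> inversion is
  \<open>(- s - ln (1 + t\<^sup>2), - t)\<close>: for fixed \<open>t\<close> a reflection with a
  translation in \<open>s\<close>, and then a reflection in \<open>t\<close>. Fubini allows the two
  to be treated one at a time.\<close>

lemma nn_integral_hyp_area_inversion:
  assumes [measurable]: "\<phi> \<in> borel_measurable borel"
  shows "(\<integral>\<^sup>+z. \<phi> (- 1 / z) \<partial>hyp_area) = (\<integral>\<^sup>+z. \<phi> z \<partial>hyp_area)"
proof -
  have [measurable]: "(\<lambda>p. \<phi> (Complex (exp (fst p) * snd p) (exp (fst p)))) \<in> borel_measurable (lborel \<Otimes>\<^sub>M lborel)"
    unfolding Complex_eq by measurable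
  have [measurable]: "(\<lambda>p. \<phi> (Complex (exp (fst p) * - snd p) (exp (fst p)))) \<in> borel_measurable (lborel \<Otimes>\<^sub>M lborel)"
    unfolding Complex_eq by measurable
  have [measurable]: "(\<lambda>p. \<phi> (Complex (exp (- fst p - ln (1 + (snd p)\<^sup>2)) * - snd p) (exp (- fst p - ln (1 + (snd p)\<^sup>2))))) \<in> borel_measurable (lborel \<Otimes>\<^sub>M lborel)"
    unfolding Complex_eq by measurable
  have eq: "- 1 / Complex (exp s * t) (exp s) = Complex (exp (- s - ln (1 + t\<^sup>2)) * - t) (exp (- s - ln (1 + t\<^sup>2)))" for s t
  proof -
    have p: "1 + t\<^sup>2 > 0" by (metis add_pos_nonneg zero_le_power2 zero_less_one)
    have e: "exp (- s - ln (1 + t\<^sup>2)) = 1 / (exp s * (1 + t\<^sup>2))"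
      using p by (simp add: exp_diff exp_minus field_simps)
    have "Complex (exp s * t) (exp s) * Complex (exp (- s - ln (1 + t\<^sup>2)) * - t) (exp (- s - ln (1 + t\<^sup>2)))
       = of_real (exp s * exp (- s - ln (1 + t\<^sup>2)) * (1 + t\<^sup>2)) * (-1)"
      by (simp add: complex_eq_iff algebra_simps power2_eq_square)
    also have "exp s * exp (- s - ln (1 + t\<^sup>2)) * (1 + t\<^sup>2) = 1" unfolding e using p by simp
    finally have m: "Complex (exp s * t) (exp s) * Complex (exp (- s - ln (1 + t\<^sup>2)) * - t) (exp (- s - ln (1 + t\<^sup>2))) = -1" by simp
    have "Complex (exp s * t) (exp s) \<noteq> 0" by (simp add: complex_eq_iff)
    moreover have "- 1 / A = B" if "A * B = - 1" "A \<noteq> 0" for A B :: complex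
      using that by (metis nonzero_mult_div_cancel_left)
    ultimately show ?thesis using m by blast
  qed
  have "(\<integral>\<^sup>+z. \<phi> (- 1 / z) \<partial>hyp_area) = (\<integral>\<^sup>+s. \<integral>\<^sup>+t. \<phi> (- 1 / Complex (exp s * t) (exp s)) \<partial>lborel \<partial>lborel)"
    by (rule nn_integral_hyp_area_exp) measurable
  also have "\<dots> = (\<integral>\<^sup>+s. \<integral>\<^sup>+t. \<phi> (Complex (exp (- s - ln (1 + t\<^sup>2)) * - t) (exp (- s - ln (1 + t\<^sup>2)))) \<partial>lborel \<partial>lborel)"
    by (simp only: eq)
  also have "\<dots> = (\<integral>\<^sup>+t. \<integral>\<^sup>+s. \<phi> (Complex (exp (- s - ln (1 + t\<^sup>2)) * - t) (exp (- s - ln (1 + t\<^sup>2)))) \<partial>lborel \<partial>lborel)"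
    by (rule lborel_pair.Fubini'[symmetric]) (unfold case_prod_beta Complex_eq, measurable)
  also have "\<dots> = (\<integral>\<^sup>+t. \<integral>\<^sup>+s. \<phi> (Complex (exp s * - t) (exp s)) \<partial>lborel \<partial>lborel)"
  proof (rule nn_integral_cong)
    fix t :: real
    have ms: "(\<lambda>s. \<phi> (Complex (exp s * - t) (exp s))) \<in> borel_measurable borel"
      unfolding Complex_eq by measurable
    show "(\<integral>\<^sup>+s. \<phi> (Complex (exp (- s - ln (1 + t\<^sup>2)) * - t) (exp (- s - ln (1 + t\<^sup>2)))) \<partial>lborel) = (\<integral>\<^sup>+s. \<phi> (Complex (exp s * - t) (exp s)) \<partial>lborel)"
      using nn_integral_real_affine[OF ms, of "-1" "- ln (1 + t\<^sup>2)"]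
      by (simp add: algebra_simps)
  qed
  also have "\<dots> = (\<integral>\<^sup>+s. \<integral>\<^sup>+t. \<phi> (Complex (exp s * - t) (exp s)) \<partial>lborel \<partial>lborel)"
    by (rule lborel_pair.Fubini') (unfold case_prod_beta Complex_eq, measurable)
  also have "\<dots> = (\<integral>\<^sup>+s. \<integral>\<^sup>+t. \<phi> (Complex (exp s * t) (exp s)) \<partial>lborel \<partial>lborel)"
  proof (rule nn_integral_cong)
    fix s :: real
    have ms: "(\<lambda>t. \<phi> (Complex (exp s * t) (exp s))) \<in> borel_measurable borel"
      unfolding Complex_eq by measurable
    show "(\<integral>\<^sup>+t. \<phi> (Complex (exp s * - t) (exp s)) \<partial>lborel) = (\<integral>\<^sup>+t. \<phi> (Complex (exp s * t) (exp s)) \<partial>lborel)"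
      using nn_integral_real_affine[OF ms, of "-1" 0] by simp
  qed
  also have "\<dots> = (\<integral>\<^sup>+z. \<phi> z \<partial>hyp_area)" by (rule nn_integral_hyp_area_exp[symmetric]) measurable
  finally show ?thesis .
qed

lemma nn_integral_hyp_area_translate:
  assumes [measurable]: "\<phi> \<in> borel_measurable borel"
  shows "(\<integral>\<^sup>+z. \<phi> (z + of_real c) \<partial>hyp_area) = (\<integral>\<^sup>+z. \<phi> z \<partial>hyp_area)"
proof -
  define h where "h z = indicator upper_half_plane z * ennreal (1 / (Im z)\<^sup>2) * \<phi> z" for z
  have [measurable]: "h \<in> borel_measurable borel" unfolding h_def by measurable
  have "(\<integral>\<^sup>+z. \<phi> (z + of_real c) \<partial>hyp_area) = (\<integral>\<^sup>+z. indicator upper_half_plane z * ennreal (1 / (Im z)\<^sup>2) * \<phi> (z + of_real c) \<partial>lborel)"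
    by (rule nn_integral_hyp_area) measurable
  also have "\<dots> = (\<integral>\<^sup>+z. h (of_real c + z) \<partial>lborel)"
    by (intro nn_integral_cong) (simp add: h_def upper_half_plane_def add.commute indicator_def)
  also have "\<dots> = (\<integral>\<^sup>+z. h z \<partial>distr lborel borel ((+) (of_real c)))" by (subst nn_integral_distr) auto
  also have "\<dots> = (\<integral>\<^sup>+z. h z \<partial>lborel)" by (simp add: lborel_distr_plus)
  also have "\<dots> = (\<integral>\<^sup>+z. \<phi> z \<partial>hyp_area)" unfolding h_def by (rule nn_integral_hyp_area[symmetric]) measurable
  finally show ?thesis .
qed

lemma AE_hyp_area: "AE z in hyp_area. z \<in> upper_half_plane"
  unfolding hyp_area_def by (subst AE_density) (auto simp: indicator_def)

section \<open>Covering discs by images of the fundamental domain\<close>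

text \<open>Points of the fundamental domain have height above 6/7, and a disc of radius at most
  3/10 of the height stays above \<open>7/10 * 6/7 = 3/5\<close>. The bound 3/5 is still high enough
  for inversion to bring the part inside the unit circle within one integer translation of the
  fundamental domain.\<close>

definition uhp_strip :: "complex set" where
  "uhp_strip = {z. \<bar>Re z\<bar> \<le> 1/2 \<and> Im z \<ge> 3/5}"

text \<open>Inversion carries the inside of the unit circle outside and leaves a real part of at
  most 3/2 in modulus. A further translation by one does not re-enter the circle, because with real
  part at most 1/2 in modulus \<open>z\<close> is no closer to 1 or -1 than to 0.\<close>

lemma strip_cover:
  assumes z: "z \<in> uhp_strip" "z \<notin> fund_domain"
  shows "- 1 / z \<in> fund_domain \<or> - 1 / z + 1 \<in> fund_domain \<or> - 1 / z - 1 \<in> fund_domain"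
proof -
  obtain x y where zxy: "z = Complex x y" by (cases z)
  have x: "\<bar>x\<bar> \<le> 1/2" and y: "y \<ge> 3/5" using z by (auto simp: uhp_strip_def zxy)
  define d where "d = x\<^sup>2 + y\<^sup>2"
  have y2: "y\<^sup>2 \<ge> 9/25" using power_mono[OF y, of 2] by (simp add: power2_eq_square)
  have d: "d > 0" "d \<ge> 9/25" using y2 zero_le_power2[of x] unfolding d_def by linarith+
  have d1: "d < 1"
  proof (rule ccontr)
    assume "\<not> d < 1"
    then have "cmod z \<ge> 1" by (simp add: zxy cmod_def d_def)
    then show False using z x y by (auto simp: fund_domain_def upper_half_plane_def zxy)
  qed
  have s: "- 1 / z = Complex (- x / d) (y / d)"
    by (simp add: zxy complex_eq_iff Re_divide Im_divide d_def)
  have im: "y / d > 0" using y d by simp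
  have re: "\<bar>- x / d\<bar> \<le> 3 / 2" using x d by (simp add: field_simps)
  have n0: "(- x / d)\<^sup>2 + (y / d)\<^sup>2 \<ge> 1"
  proof -
    have "(- x / d)\<^sup>2 + (y / d)\<^sup>2 = 1 / d"
    proof -
      have "(- x / d)\<^sup>2 + (y / d)\<^sup>2 = (x\<^sup>2 + y\<^sup>2) / d\<^sup>2" by (simp add: power_divide add_divide_distrib)
      also have "\<dots> = d / d\<^sup>2" by (simp only: d_def)
      also have "\<dots> = 1 / d" using d by (simp add: power2_eq_square)
      finally show ?thesis .
    qed
    then show ?thesis using d d1 by simp
  qed
  have n1: "(- x / d + e)\<^sup>2 + (y / d)\<^sup>2 \<ge> 1" if "e = 1 \<or> e = -1" for e
  proof -
    have "(- x / d)\<^sup>2 + (y / d)\<^sup>2 = 1 / d"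
    proof -
      have "(- x / d)\<^sup>2 + (y / d)\<^sup>2 = (x\<^sup>2 + y\<^sup>2) / d\<^sup>2" by (simp add: power_divide add_divide_distrib)
      also have "\<dots> = d / d\<^sup>2" by (simp only: d_def)
      also have "\<dots> = 1 / d" using d by (simp add: power2_eq_square)
      finally show ?thesis .
    qed
    moreover have "(- x / d + e)\<^sup>2 = (- x / d)\<^sup>2 + 1 - 2 * e * x / d"
      using that by (auto simp: power2_eq_square algebra_simps)
    ultimately have "(- x / d + e)\<^sup>2 + (y / d)\<^sup>2 = 1 + (1 - 2 * e * x) / d" by (simp add: diff_divide_distrib)
    moreover have "2 * e * x \<le> 1" using x that by auto
    ultimately show ?thesis using d by simp
  qed
  have c: "Complex a b \<in> fund_domain" if "b > 0" "\<bar>a\<bar> \<le> 1/2" "a\<^sup>2 + b\<^sup>2 \<ge> 1" for a b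
    using that by (simp add: fund_domain_def upper_half_plane_def cmod_def)
  have s1: "- 1 / z + 1 = Complex (- x / d + 1) (y / d)" "- 1 / z - 1 = Complex (- x / d + - 1) (y / d)"
    unfolding s by (simp_all add: complex_eq_iff)
  consider "\<bar>- x / d\<bar> \<le> 1/2" | "- x / d < - 1/2" | "- x / d > 1/2" by linarith
  then show ?thesis
  proof cases
    case 1
    then have "- 1 / z \<in> fund_domain" unfolding s by (intro c im n0)
    then show ?thesis by simp
  next
    case 2
    then have "\<bar>- x / d + 1\<bar> \<le> 1/2" using re by linarith
    then have "- 1 / z + 1 \<in> fund_domain" unfolding s1 by (intro c im n1) auto
    then show ?thesis by simp
  next
    case 3
    then have "\<bar>- x / d + - 1\<bar> \<le> 1/2" using re by linarith
    then have "- 1 / z - 1 \<in> fund_domain" unfolding s1 by (intro c im n1) auto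
    then show ?thesis by simp
  qed
qed

lemma uhp_strip_borel [measurable]: "uhp_strip \<in> sets borel"
  unfolding uhp_strip_def by measurable

text \<open>Each point of the strip, or one of its three images under inversion and a translation by
  at most one, lies in the fundamental domain. These maps preserve both \<open>\<Phi>\<close> and
  the area, hence the factor 4.\<close>

lemma strip_integral_le:
  assumes [measurable]: "\<Phi> \<in> borel_measurable borel"
    and T: "\<And>z n. z \<in> upper_half_plane \<Longrightarrow> \<Phi> (z + of_int n) = \<Phi> z"
    and S: "\<And>z. z \<in> upper_half_plane \<Longrightarrow> \<Phi> (- 1 / z) = \<Phi> z"
  shows "(\<integral>\<^sup>+z. \<Phi> z * indicator uhp_strip z \<partial>hyp_area) \<le> 4 * (\<integral>\<^sup>+z. \<Phi> z * indicator fund_domain z \<partial>hyp_area)"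
proof -
  define h where "h z = \<Phi> z * indicator fund_domain z" for z
  have [measurable]: "h \<in> borel_measurable borel" unfolding h_def by measurable
  have Suhp: "- 1 / z \<in> upper_half_plane" if "z \<in> upper_half_plane" for z
  proof -
    have "z \<noteq> 0" using that by (auto simp: upper_half_plane_def)
    then have "Im (- 1 / z) = Im z / (cmod z)\<^sup>2" by (simp add: Im_divide cmod_power2)
    then show ?thesis using that \<open>z \<noteq> 0\<close> by (simp add: upper_half_plane_def)
  qed
  have "(\<integral>\<^sup>+z. \<Phi> z * indicator uhp_strip z \<partial>hyp_area) \<le>
    (\<integral>\<^sup>+z. h z + (h (- 1 / z) + (h (- 1 / z + of_real 1) + h (- 1 / z + of_real (- 1)))) \<partial>hyp_area)"
  proof (rule nn_integral_mono_AE, use AE_hyp_area in eventually_elim)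
    fix z assume z: "z \<in> upper_half_plane"
    have t: "\<Phi> (- 1 / z + 1) = \<Phi> z" "\<Phi> (- 1 / z - 1) = \<Phi> z"
      using T[OF Suhp[OF z], of 1] T[OF Suhp[OF z], of "-1"] S[OF z] by simp_all
    show "\<Phi> z * indicator uhp_strip z \<le> h z + (h (- 1 / z) + (h (- 1 / z + of_real 1) + h (- 1 / z + of_real (- 1))))"
    proof (cases "z \<in> uhp_strip")
      case True
      show ?thesis
      proof (cases "z \<in> fund_domain")
        case True then show ?thesis using \<open>z \<in> uhp_strip\<close> by (simp add: h_def)
      next
        case False
        from strip_cover[OF \<open>z \<in> uhp_strip\<close> False] show ?thesis
          using \<open>z \<in> uhp_strip\<close> False S[OF z] t by (auto simp: h_def indicator_def)
      qed
    qed simp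
  qed
  also have "\<dots> = (\<integral>\<^sup>+z. h z \<partial>hyp_area) + ((\<integral>\<^sup>+z. h (- 1 / z) \<partial>hyp_area) + ((\<integral>\<^sup>+z. h (- 1 / z + of_real 1) \<partial>hyp_area) + (\<integral>\<^sup>+z. h (- 1 / z + of_real (- 1)) \<partial>hyp_area)))"
    by (subst nn_integral_add, measurable, subst nn_integral_add, measurable, subst nn_integral_add) auto
  also have "\<dots> = (\<integral>\<^sup>+z. h z \<partial>hyp_area) + ((\<integral>\<^sup>+z. h z \<partial>hyp_area) + ((\<integral>\<^sup>+z. h z \<partial>hyp_area) + (\<integral>\<^sup>+z. h z \<partial>hyp_area)))"
    using nn_integral_hyp_area_inversion[of "\<lambda>z. h (z + of_real 1)"] nn_integral_hyp_area_inversion[of "\<lambda>z. h (z + of_real (- 1))"]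
      nn_integral_hyp_area_inversion[of h] nn_integral_hyp_area_translate[of h 1] nn_integral_hyp_area_translate[of h "- 1"]
    by simp
  also have "\<dots> = 4 * (\<integral>\<^sup>+z. h z \<partial>hyp_area)" 
  proof -
    have "(4 :: ennreal) = 1 + (1 + (1 + 1))" by simp
    then have "a + (a + (a + a)) = 4 * a" for a :: ennreal by (simp only: distrib_right mult_1)
    then show ?thesis by simp
  qed
  finally show ?thesis by (simp add: h_def)
qed

text \<open>Integer translates of the strip cover the disc; with
  \<open>m = \<lceil>r\<rceil>\<close> there are \<open>2 * m + 3 \<le> 2 * r + 5\<close> of them,
  and each costs a factor 4. The linear growth in \<open>r\<close> is what produces the term
  \<open>y / sqrt k\<close> in the kernel bound.\<close>

lemma ball_integral_le:
  assumes meas [measurable]: "\<Phi> \<in> borel_measurable borel"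
    and T: "\<And>z n. z \<in> upper_half_plane \<Longrightarrow> \<Phi> (z + of_int n) = \<Phi> z"
    and S: "\<And>z. z \<in> upper_half_plane \<Longrightarrow> \<Phi> (- 1 / z) = \<Phi> z"
    and z: "z \<in> fund_domain" and r: "0 < r" "r \<le> 3/10 * Im z"
  shows "(\<integral>\<^sup>+w. \<Phi> w * indicator (ball z r) w \<partial>hyp_area) \<le> ennreal (8 * r + 20) * (\<integral>\<^sup>+w. \<Phi> w * indicator fund_domain w \<partial>hyp_area)"
proof -
  define m where "m = \<lceil>r\<rceil>"
  have m: "r \<le> m" "m < r + 1" unfolding m_def by linarith+
  have x: "\<bar>Re z\<bar> \<le> 1/2" using z by (simp add: fund_domain_def)
  have y: "Im z > 6/7"
  proof -
    have "(Re z)\<^sup>2 + (Im z)\<^sup>2 \<ge> 1" using z one_le_power[of "cmod z" 2] by (simp add: fund_domain_def cmod_power2)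
    moreover have "(Re z)\<^sup>2 \<le> (1/2)\<^sup>2" using x abs_le_square_iff[of "Re z" "1/2"] by simp
    ultimately have "(Im z)\<^sup>2 \<ge> 3/4" by (simp add: power2_eq_square)
    then have "(6/7)\<^sup>2 < (Im z)\<^sup>2" by (simp add: power2_eq_square)
    moreover have "Im z > 0" using z by (simp add: fund_domain_def upper_half_plane_def)
    ultimately show ?thesis by (meson less_imp_le power2_less_imp_less)
  qed
  have "(\<integral>\<^sup>+w. \<Phi> w * indicator (ball z r) w \<partial>hyp_area) \<le> (\<integral>\<^sup>+w. (\<Sum>n\<in>{-m-1..m+1}. \<Phi> (w + of_real (of_int n)) * indicator uhp_strip (w + of_real (of_int n))) \<partial>hyp_area)"
  proof (rule nn_integral_mono_AE, use AE_hyp_area in eventually_elim)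
    fix w assume w: "w \<in> upper_half_plane"
    show "\<Phi> w * indicator (ball z r) w \<le> (\<Sum>n\<in>{-m-1..m+1}. \<Phi> (w + of_real (of_int n)) * indicator uhp_strip (w + of_real (of_int n)))"
    proof (cases "w \<in> ball z r")
      case True
      have d: "\<bar>Re w - Re z\<bar> < r" "\<bar>Im w - Im z\<bar> < r"
        using True abs_Re_le_cmod[of "w - z"] abs_Im_le_cmod[of "w - z"] by (auto simp: dist_norm norm_minus_commute)
      define n where "n = - round (Re w)"
      have n: "\<bar>Re w + of_int n\<bar> \<le> 1/2" using of_int_round_abs_le[of "Re w"] by (simp add: n_def abs_minus_commute)
      then have "\<bar>real_of_int n\<bar> \<le> r + 1" using d x by linarith
      then have nm: "n \<in> {-m-1..m+1}" using m(1) by auto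
      have "w + of_real (of_int n) \<in> uhp_strip" using n d r y by (simp add: uhp_strip_def)
      then have "\<Phi> w * indicator (ball z r) w = \<Phi> (w + of_real (of_int n)) * indicator uhp_strip (w + of_real (of_int n))"
        using True T[OF w, of n] by simp
      also have "\<dots> \<le> (\<Sum>n\<in>{-m-1..m+1}. \<Phi> (w + of_real (of_int n)) * indicator uhp_strip (w + of_real (of_int n)))"
        using nm by (intro member_le_sum) auto
      finally show ?thesis .
    qed simp
  qed
  also have "\<dots> = (\<Sum>n\<in>{-m-1..m+1}. \<integral>\<^sup>+w. \<Phi> (w + of_real (of_int n)) * indicator uhp_strip (w + of_real (of_int n)) \<partial>hyp_area)"
    by (subst nn_integral_sum) auto
  also have "\<dots> = (\<Sum>n\<in>{-m-1..m+1}. \<integral>\<^sup>+w. \<Phi> w * indicator uhp_strip w \<partial>hyp_area)"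
    by (intro sum.cong refl nn_integral_hyp_area_translate) measurable
  also have "\<dots> = ennreal (2 * m + 3) * (\<integral>\<^sup>+w. \<Phi> w * indicator uhp_strip w \<partial>hyp_area)"
  proof -
    have "m \<ge> 0" using m r by linarith
    then have "of_nat (card {-m-1..m+1}) = ennreal (2 * m + 3)"
      by (simp add: ennreal_of_nat_eq_real_of_nat algebra_simps)
    then show ?thesis by simp
  qed
  also have "\<dots> \<le> ennreal (2 * r + 5) * (4 * (\<integral>\<^sup>+w. \<Phi> w * indicator fund_domain w \<partial>hyp_area))"
    using m r strip_integral_le[OF meas T S] by (intro mult_mono ennreal_leI) auto
  also have "\<dots> = ennreal (8 * r + 20) * (\<integral>\<^sup>+w. \<Phi> w * indicator fund_domain w \<partial>hyp_area)"
  proof -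
    have "ennreal (8 * r + 20) = ennreal (2 * r + 5) * ennreal 4" using r by (subst ennreal_mult[symmetric]) auto
    then show ?thesis by (simp add: mult.assoc)
  qed
  finally show ?thesis .
qed

section \<open>Pointwise bounds for cusp forms\<close>

lemma cusp_formsD:
  assumes "g \<in> cusp_forms k"
  shows cusp_holomorphic: "g holomorphic_on upper_half_plane"
    and cusp_outside: "z \<notin> upper_half_plane \<Longrightarrow> g z = 0"
    and cusp_translate: "z \<in> upper_half_plane \<Longrightarrow> g (z + of_int n) = g z"
    and cusp_inversion: "z \<in> upper_half_plane \<Longrightarrow> g (- 1 / z) = z ^ k * g z"
proof -
  have M: "g ((of_int a * z + of_int b) / (of_int c * z + of_int d)) = (of_int c * z + of_int d) ^ k * g z"
    if "a * d - b * c = 1" "z \<in> upper_half_plane" for a b c d :: int and z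
    using assms that unfolding cusp_forms_def by blast
  show "g holomorphic_on upper_half_plane" "z \<notin> upper_half_plane \<Longrightarrow> g z = 0"
    using assms by (auto simp: cusp_forms_def)
  show "z \<in> upper_half_plane \<Longrightarrow> g (z + of_int n) = g z" using M[of 1 1 n 0 z] by simp
  show "z \<in> upper_half_plane \<Longrightarrow> g (- 1 / z) = z ^ k * g z" using M[of 0 0 "-1" 1 z] by simp
qed

lemma open_uhp: "open upper_half_plane"
  unfolding upper_half_plane_def by (simp add: open_halfspace_Im_gt)

lemma cusp_measurable:
  assumes g: "g \<in> cusp_forms k"
  shows "g \<in> borel_measurable borel"
proof -
  have "(\<lambda>z. indicat_real upper_half_plane z *\<^sub>R g z) \<in> borel_measurable borel"
    using g open_uhp
    by (intro borel_measurable_continuous_on_indicator holomorphic_on_imp_continuous_on cusp_holomorphic) auto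
  also have "(\<lambda>z. indicat_real upper_half_plane z *\<^sub>R g z) = g"
    using cusp_outside[OF g] by (auto simp: indicator_def fun_eq_iff)
  finally show ?thesis .
qed

definition cusp_density :: "nat \<Rightarrow> (complex \<Rightarrow> complex) \<Rightarrow> complex \<Rightarrow> ennreal" where
  "cusp_density k g z = ennreal ((cmod (g z))\<^sup>2 * Im z ^ k)"

definition cusp_norm :: "nat \<Rightarrow> (complex \<Rightarrow> complex) \<Rightarrow> ennreal" where
  "cusp_norm k g = (\<integral>\<^sup>+z. cusp_density k g z * indicator fund_domain z \<partial>hyp_area)"

lemma cusp_density_measurable [measurable]:
  assumes "g \<in> cusp_forms k"
  shows "cusp_density k g \<in> borel_measurable borel"
proof -
  note [measurable] = cusp_measurable[OF assms]
  show ?thesis unfolding cusp_density_def by measurable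
qed

lemma cusp_density_translate:
  "g \<in> cusp_forms k \<Longrightarrow> z \<in> upper_half_plane \<Longrightarrow> cusp_density k g (z + of_int n) = cusp_density k g z"
  by (simp add: cusp_density_def cusp_translate)

lemma cusp_density_inversion:
  assumes g: "g \<in> cusp_forms k" and z: "z \<in> upper_half_plane"
  shows "cusp_density k g (- 1 / z) = cusp_density k g z"
proof -
  have z0: "cmod z > 0" using z by (auto simp: upper_half_plane_def)
  have im: "Im (- 1 / z) = Im z / (cmod z)\<^sup>2" by (simp add: Im_divide cmod_power2)
  have "(cmod (g (- 1 / z)))\<^sup>2 * Im (- 1 / z) ^ k = ((cmod z)\<^sup>2) ^ k * (cmod (g z))\<^sup>2 * (Im z ^ k / ((cmod z)\<^sup>2) ^ k)"
    unfolding im cusp_inversion[OF g z]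
    by (simp add: norm_mult norm_power power_mult_distrib power_divide mult.commute flip: power_mult)
  also have "\<dots> = (cmod (g z))\<^sup>2 * Im z ^ k" using z0 by simp
  finally show ?thesis by (simp add: cusp_density_def)
qed

text \<open>Uses \<open>ln (1 + t) \<ge> t - 2 * t\<^sup>2\<close> and
  \<open>exp (1/3) \<le> 2\<close>. With \<open>t\<close> the relative change of height, the k-th
  power of the height is at least half of its first-order exponential.\<close>

lemma one_plus_power_ge:
  fixes t :: real
  assumes t: "\<bar>t\<bar> \<le> 1/2" "k * t\<^sup>2 \<le> 1/6"
  shows "exp (k * t) \<le> 2 * (1 + t) ^ k"
proof -
  have "\<bar>ln (1 + t) - t\<bar> \<le> 2 * t\<^sup>2" using t by (intro abs_ln_one_plus_x_minus_x_bound)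
  then have "t \<le> ln (1 + t) + 2 * t\<^sup>2" by linarith
  then have "k * t \<le> k * (ln (1 + t) + 2 * t\<^sup>2)" by (intro mult_left_mono) auto
  also have "\<dots> \<le> k * ln (1 + t) + 1/3" using t(2) by (simp add: distrib_left)
  finally have "exp (k * t) \<le> exp (k * ln (1 + t) + 1/3)" by simp
  also have "\<dots> = exp (1/3) * (1 + t) ^ k" using t by (simp add: exp_add exp_of_nat_mult)
  also have "\<dots> \<le> 2 * (1 + t) ^ k"
  proof (rule mult_right_mono)
    show "exp (1/3) \<le> (2::real)" using exp_bound[of "1/3"] by (simp add: power2_eq_square)
  qed (use t in auto)
  finally show ?thesis .
qed

lemma fund_domain_Im: "z \<in> fund_domain \<Longrightarrow> Im z > 0"
  by (simp add: fund_domain_def upper_half_plane_def)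

text \<open>Multiplying by \<open>exp (- i k (w - z) / (2 y))\<close> compensates the factor \<open>(Im w)\<^sup>k\<close> to first order,
  so that on a disc of radius \<open>y / sqrt (6 k)\<close> the density is comparable to the square of the modulus
  of a holomorphic function.\<close>

lemma cusp_density_bound:
  assumes g: "g \<in> cusp_forms k" and k: "k \<ge> 2" and z: "z \<in> fund_domain"
  shows "cusp_density k g z \<le> ennreal (224 * real k * (1 + Im z / sqrt k)) * cusp_norm k g"
proof -
  define y where "y = Im z"
  have y: "y > 0" using fund_domain_Im[OF z] by (simp add: y_def)
  have k2: "real k \<ge> 2" using k by simp
  define r where "r = y / sqrt (6 * real k)"
  have r: "r > 0" using y k by (simp add: r_def)
  \<comment> \<open>For \<open>k \<ge> 2\<close> this makes the radius at most 3/10 of the height,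
    as \<open>ball_integral_le\<close> demands.\<close>
  have sq: "sqrt (6 * real k) \<ge> 10/3"
  proof (rule real_le_rsqrt)
    show "(10/3)\<^sup>2 \<le> 6 * real k" using k2 by (simp add: power2_eq_square)
  qed
  have ry: "r \<le> 3/10 * y"
  proof -
    have "r \<le> y / (10/3)" unfolding r_def using y sq k2 by (intro divide_left_mono) auto
    then show ?thesis by simp
  qed
  have r2: "r\<^sup>2 = y\<^sup>2 / (6 * real k)" by (simp add: r_def power_divide)
  have inb: "\<bar>Im w - y\<bar> < r" "Im w > 0" "Im w \<le> 13/10 * y" if "w \<in> ball z r" for w
  proof -
    show "\<bar>Im w - y\<bar> < r" using that abs_Im_le_cmod[of "w - z"] by (auto simp: dist_norm norm_minus_commute y_def)
    then show "Im w > 0" "Im w \<le> 13/10 * y" using ry y by linarith+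
  qed
  define f where "f w = (g w * exp (- \<i> * of_nat k * (w - z) / (2 * of_real y)))\<^sup>2" for w
  have "f holomorphic_on ball z r"
  proof -
    have "ball z r \<subseteq> upper_half_plane" using inb by (auto simp: upper_half_plane_def)
    then have "g holomorphic_on ball z r" using cusp_holomorphic[OF g] holomorphic_on_subset by blast
    then show ?thesis unfolding f_def using y by (intro holomorphic_intros) auto
  qed
  then have mv: "ennreal (pi * r\<^sup>2) * ennreal (cmod (f z)) \<le> (\<integral>\<^sup>+w. ennreal (cmod (f w)) * indicator (ball z r) w \<partial>lborel)"
    using r by (rule area_mean_value)
  have [measurable]: "ball z r \<in> sets borel" by simp
  note [measurable] = cusp_density_measurable[OF g]
  have fz: "cmod (f z) = (cmod (g z))\<^sup>2" by (simp add: f_def norm_power)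
  have fw: "y ^ k * cmod (f w) \<le> 2 * ((cmod (g w))\<^sup>2 * Im w ^ k)" if w: "w \<in> ball z r" for w
  proof -
    define t where "t = (Im w - y) / y"
    have t: "\<bar>t\<bar> \<le> r / y" using inb(1)[OF w] y by (simp add: t_def field_simps)
    also have "r / y \<le> 3/10" using ry y by (simp add: field_simps)
    finally have t1: "\<bar>t\<bar> \<le> 1/2" by simp
    have "t\<^sup>2 \<le> (r / y)\<^sup>2" using t y r abs_le_square_iff[of t "r / y"] by simp
    also have "(r / y)\<^sup>2 = 1 / (6 * real k)" using y by (simp add: power_divide r2)
    finally have t2: "k * t\<^sup>2 \<le> 1/6" using k by (simp add: field_simps)
    have e: "- \<i> * of_nat k * (w - z) / (2 * of_real y) = of_real (k / (2 * y)) * (- \<i> * (w - z))"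
      using y by (simp add: field_simps)
    have "Re (- \<i> * of_nat k * (w - z) / (2 * of_real y)) = k * t / 2"
      unfolding e using y by (simp add: t_def y_def field_simps)
    then have "cmod (f w) = (cmod (g w))\<^sup>2 * exp (k * t)"
      by (simp only: f_def norm_power norm_mult norm_exp_eq_Re power_mult_distrib) (simp flip: exp_double)
    also have "\<dots> \<le> (cmod (g w))\<^sup>2 * (2 * (1 + t) ^ k)"
      using one_plus_power_ge[OF t1 t2] by (intro mult_left_mono) auto
    finally have "y ^ k * cmod (f w) \<le> y ^ k * ((cmod (g w))\<^sup>2 * (2 * (1 + t) ^ k))"
      using y by (intro mult_left_mono) auto
    also have "\<dots> = 2 * ((cmod (g w))\<^sup>2 * (y * (1 + t)) ^ k)" by (simp add: power_mult_distrib)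
    also have "y * (1 + t) = Im w" using y by (simp add: t_def field_simps)
    finally show ?thesis .
  qed
  have "ennreal (y ^ k) * (ennreal (pi * r\<^sup>2) * ennreal (cmod (f z))) \<le> ennreal (y ^ k) * (\<integral>\<^sup>+w. ennreal (cmod (f w)) * indicator (ball z r) w \<partial>lborel)"
    using mv by (rule mult_left_mono) simp
  also have "\<dots> = (\<integral>\<^sup>+w. ennreal (y ^ k) * (ennreal (cmod (f w)) * indicator (ball z r) w) \<partial>lborel)"
  proof (rule nn_integral_cmult[symmetric])
    have [measurable]: "ball z r \<in> sets borel" by simp
    note [measurable] = cusp_measurable[OF g]
    show "(\<lambda>w. ennreal (cmod (f w)) * indicator (ball z r) w) \<in> borel_measurable lborel"
      unfolding f_def by measurable
  qed
  also have "\<dots> \<le> (\<integral>\<^sup>+w. indicator upper_half_plane w * ennreal (1 / (Im w)\<^sup>2) * (ennreal (4 * y\<^sup>2) * (cusp_density k g w * indicator (ball z r) w)) \<partial>lborel)"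
  proof (rule nn_integral_mono)
    fix w
    show "ennreal (y ^ k) * (ennreal (cmod (f w)) * indicator (ball z r) w)
      \<le> indicator upper_half_plane w * ennreal (1 / (Im w)\<^sup>2) * (ennreal (4 * y\<^sup>2) * (cusp_density k g w * indicator (ball z r) w))"
    proof (cases "w \<in> ball z r")
      case True
      note i = inb[OF True]
      have "(Im w)\<^sup>2 \<le> (13/10 * y)\<^sup>2" using i by (intro power_mono) auto
      also have "\<dots> \<le> 2 * y\<^sup>2" by (simp add: power2_eq_square)
      finally have 1: "1 \<le> 1 / (Im w)\<^sup>2 * (2 * y\<^sup>2)" using i by (simp add: field_simps)
      have nn: "0 \<le> (cmod (g w))\<^sup>2 * Im w ^ k" using i by simp
      have "y ^ k * cmod (f w) \<le> 1 * (2 * ((cmod (g w))\<^sup>2 * Im w ^ k))" using fw[OF True] by simp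
      also have "\<dots> \<le> 1 / (Im w)\<^sup>2 * (2 * y\<^sup>2) * (2 * ((cmod (g w))\<^sup>2 * Im w ^ k))"
        using 1 nn by (intro mult_right_mono) auto
      also have "\<dots> = 1 / (Im w)\<^sup>2 * (4 * y\<^sup>2 * ((cmod (g w))\<^sup>2 * Im w ^ k))" by simp
      finally have "ennreal (y ^ k * cmod (f w)) \<le> ennreal (1 / (Im w)\<^sup>2 * (4 * y\<^sup>2 * ((cmod (g w))\<^sup>2 * Im w ^ k)))"
        by (rule ennreal_leI)
      then show ?thesis using True i nn y by (simp add: upper_half_plane_def cusp_density_def flip: ennreal_mult)
    qed simp
  qed
  also have "\<dots> = (\<integral>\<^sup>+w. ennreal (4 * y\<^sup>2) * (cusp_density k g w * indicator (ball z r) w) \<partial>hyp_area)"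
    using g by (subst nn_integral_hyp_area) auto
  also have "\<dots> = ennreal (4 * y\<^sup>2) * (\<integral>\<^sup>+w. cusp_density k g w * indicator (ball z r) w \<partial>hyp_area)"
    using g by (intro nn_integral_cmult) auto
  also have "\<dots> \<le> ennreal (4 * y\<^sup>2) * (ennreal (8 * r + 20) * cusp_norm k g)"
    unfolding cusp_norm_def using g cusp_density_translate[OF g] cusp_density_inversion[OF g] z r ry
    by (intro mult_left_mono ball_integral_le) (auto simp: y_def)
  finally have main: "ennreal (y ^ k) * (ennreal (pi * r\<^sup>2) * ennreal ((cmod (g z))\<^sup>2)) \<le> ennreal (4 * y\<^sup>2) * (ennreal (8 * r + 20) * cusp_norm k g)"
    unfolding fz .
  show ?thesis
  proof (cases "cusp_norm k g")
    case top
    \<comment> \<open>For infinite norm the claim is trivial once the constant is nonzero; in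
      \<open>ennreal\<close> the product of 0 and infinity is 0.\<close>
    have "224 * real k * (1 + Im z / sqrt k) > 0" using y k2 by (intro mult_pos_pos add_pos_nonneg) (auto simp: y_def)
    then have "ennreal (224 * real k * (1 + Im z / sqrt k)) \<noteq> 0" by (simp only: ennreal_eq_0_iff not_le)
    then show ?thesis by (simp only: top ennreal_mult_top if_False top_greatest)
  next
    case (real I)
    have "y ^ k * (pi * r\<^sup>2 * (cmod (g z))\<^sup>2) \<le> 4 * y\<^sup>2 * ((8 * r + 20) * I)"
      using main real y r by (simp add: ennreal_le_iff del: ennreal_plus flip: ennreal_mult)
    also have "8 * r + 20 \<le> 28 * (1 + y / sqrt k)"
    proof -
      have "r \<le> y / sqrt k" unfolding r_def using y k2 by (intro divide_left_mono) auto
      moreover have "y / sqrt k \<ge> 0" using y by simp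
      ultimately have "8 * r + 20 \<le> 28 + 28 * (y / sqrt k)" by linarith
      then show ?thesis by (simp only: distrib_left mult_1_right)
    qed
    finally have "y ^ k * (pi * r\<^sup>2 * (cmod (g z))\<^sup>2) \<le> 4 * y\<^sup>2 * (28 * (1 + y / sqrt k) * I)"
      using real y by (simp add: mult_left_mono mult_right_mono)
    \<comment> \<open>Clearing the denominator of the area \<open>pi * y\<^sup>2 / (6 * k)\<close>
      gives the constant \<open>4 * 28 * 6 = 3 * 224\<close>, and the 3 is then cancelled by
      \<open>pi > 3\<close>.\<close>
    then have "y\<^sup>2 * (pi * (y ^ k * (cmod (g z))\<^sup>2)) \<le> y\<^sup>2 * (3 * (224 * real k * (1 + y / sqrt k) * I))"
      using k2 unfolding r2 by (simp add: field_simps)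
    then have *: "pi * (y ^ k * (cmod (g z))\<^sup>2) \<le> 3 * (224 * real k * (1 + y / sqrt k) * I)"
      using y by (subst (asm) mult_le_cancel_left_pos) auto
    have "3 * (y ^ k * (cmod (g z))\<^sup>2) \<le> pi * (y ^ k * (cmod (g z))\<^sup>2)"
      using pi_gt3 y by (intro mult_right_mono) auto
    from this * have "3 * (y ^ k * (cmod (g z))\<^sup>2) \<le> 3 * (224 * real k * (1 + y / sqrt k) * I)"
      by (rule order_trans)
    then have "y ^ k * (cmod (g z))\<^sup>2 \<le> 224 * real k * (1 + y / sqrt k) * I"
      by (rule mult_left_le_imp_le) simp
    then have "(cmod (g z))\<^sup>2 * Im z ^ k \<le> 224 * real k * (1 + Im z / sqrt k) * I"
      by (simp only: y_def mult.commute[of "(cmod (g z))\<^sup>2"])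
    then have "ennreal ((cmod (g z))\<^sup>2 * Im z ^ k) \<le> ennreal (224 * real k * (1 + Im z / sqrt k) * I)" by (rule ennreal_leI)
    then show ?thesis using real y k2 by (simp add: cusp_density_def ennreal_mult y_def)
  qed
qed

text \<open>The exponential factor is the modulus of \<open>1 / q\<close>. The comparison point is
  found with the principal logarithm, so its real part is at most 1/2 in modulus, and it lies in the
  fundamental domain as soon as \<open>y0 \<ge> 1\<close>.\<close>

lemma cusp_decay:
  assumes g: "g \<in> cusp_forms k" and y0: "0 < y0" and z: "y0 \<le> Im z"
  shows "\<exists>x. \<bar>x\<bar> \<le> 1/2 \<and> cmod (g z) * exp (2 * pi * Im z) \<le> cmod (g (Complex x y0)) * exp (2 * pi * y0)"
proof -
  obtain q where q0: "q 0 = 0" and q: "\<And>z. z \<in> upper_half_plane \<Longrightarrow> (\<lambda>n. q n * exp (2 * of_real pi * \<i> * of_nat n * z)) sums g z"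
    using g unfolding cusp_forms_def by blast
  define e where "e z = exp (2 * of_real pi * \<i> * z)" for z :: complex
  have ne: "cmod (e z) = exp (- 2 * pi * Im z)" for z by (simp add: e_def norm_exp_eq_Re)
  have qe: "(\<lambda>n. q n * e z ^ n) sums g z" if "Im z > 0" for z
    using q[of z] that by (simp add: e_def upper_half_plane_def mult_ac flip: exp_of_nat_mult)
  have surj: "\<exists>z. e z = \<zeta> \<and> exp (- 2 * pi * Im z) = cmod \<zeta> \<and> \<bar>Re z\<bar> \<le> 1/2" if "\<zeta> \<noteq> 0" for \<zeta>
  proof (intro exI conjI)
    define z where "z = Ln \<zeta> / (2 * of_real pi * \<i>)"
    show e: "e z = \<zeta>" using that by (simp add: z_def e_def)
    show "exp (- 2 * pi * Im z) = cmod \<zeta>" using ne[of z] e by simp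
    have "Re z = Im (Ln \<zeta>) / (2 * pi)" by (simp add: z_def Re_divide power2_eq_square)
    then have "\<bar>Re z\<bar> = \<bar>Im (Ln \<zeta>)\<bar> / (2 * pi)" by (simp only: abs_divide) simp
    moreover have "\<bar>Im (Ln \<zeta>)\<bar> \<le> pi" using that mpi_less_Im_Ln[of \<zeta>] Im_Ln_le_pi[of \<zeta>] by linarith
    ultimately show "\<bar>Re z\<bar> \<le> 1/2" by (simp add: divide_le_eq)
  qed
  \<comment> \<open>Every nonzero point of the disc is \<open>e w\<close> for some \<open>w\<close>
    in the upper half plane, so convergence of the expansion there is convergence of the power
    series.\<close>
  have summ: "summable (\<lambda>n. q n * \<zeta> ^ n)" if "cmod \<zeta> < 1" for \<zeta>
  proof (cases "\<zeta> = 0")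
    case True then show ?thesis using summable_0_powser[of q] by simp
  next
    case False
    then obtain w where w: "e w = \<zeta>" "exp (- 2 * pi * Im w) = cmod \<zeta>" using surj by blast
    then have "exp (- 2 * pi * Im w) < 1" using that by simp
    then have "Im w > 0" by (simp add: zero_less_mult_iff)
    from qe[OF this] w show ?thesis by (auto simp: sums_iff)
  qed
  define H where "H \<zeta> = (\<Sum>n. q (Suc n) * \<zeta> ^ n)" for \<zeta>
  have split: "summable (\<lambda>n. q (Suc n) * \<zeta> ^ n)" "(\<Sum>n. q n * \<zeta> ^ n) = H \<zeta> * \<zeta>" if "cmod \<zeta> < 1" for \<zeta>
    using powser_split_head[OF summ[OF that]] q0 by (auto simp: H_def)
  have hol: "H holomorphic_on ball 0 1"
  proof (rule power_series_holomorphic)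
    fix w :: complex assume "w \<in> ball 0 1"
    then show "(\<lambda>n. q (Suc n) * (w - 0) ^ n) sums H w"
      using split(1)[of w] by (simp add: H_def summable_sums)
  qed
  have gH: "cmod (g z) * exp (2 * pi * Im z) = cmod (H (e z))" if "Im z > 0" for z
  proof -
    have "cmod (e z) < 1" using that by (simp add: ne)
    then have "g z = H (e z) * e z" using split(2)[of "e z"] qe[OF that] by (simp add: sums_iff)
    then show ?thesis by (simp add: norm_mult ne mult.assoc flip: exp_add)
  qed
  define \<rho> where "\<rho> = exp (- 2 * pi * y0)"
  have \<rho>: "0 < \<rho>" "\<rho> < 1" using y0 by (auto simp: \<rho>_def)
  have sub: "cball 0 \<rho> \<subseteq> (ball 0 1 :: complex set)" using \<rho> by auto
  have cont: "continuous_on (cball 0 \<rho>) H"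
    using hol sub holomorphic_on_imp_continuous_on holomorphic_on_subset by blast
  have "\<exists>\<zeta>0\<in>sphere 0 \<rho>. \<forall>\<zeta>\<in>sphere 0 \<rho>. cmod (H \<zeta>) \<le> cmod (H \<zeta>0)"
  proof (rule continuous_attains_sup)
    show "continuous_on (sphere 0 \<rho>) (\<lambda>\<zeta>. cmod (H \<zeta>))"
      using cont by (intro continuous_intros) (auto elim: continuous_on_subset)
  qed (use \<rho> in auto)
  then obtain \<zeta>0 where z0: "cmod \<zeta>0 = \<rho>" and max: "\<And>\<zeta>. cmod \<zeta> = \<rho> \<Longrightarrow> cmod (H \<zeta>) \<le> cmod (H \<zeta>0)" by auto
  have "cmod (H (e z)) \<le> cmod (H \<zeta>0)"
  proof (rule maximum_modulus_frontier[where S="cball 0 \<rho>" and f=H])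
    show "H holomorphic_on interior (cball 0 \<rho>)"
      by (rule holomorphic_on_subset[OF hol]) (use \<rho> in auto)
    show "continuous_on (closure (cball 0 \<rho>)) H" using cont by simp
    show "e z \<in> cball 0 \<rho>" using z by (simp add: ne \<rho>_def)
    show "cmod (H \<zeta>) \<le> cmod (H \<zeta>0)" if "\<zeta> \<in> frontier (cball 0 \<rho>)" for \<zeta>
      using that max by (simp add: frontier_cball)
  qed auto
  moreover have "\<zeta>0 \<noteq> 0" using z0 \<rho> by auto
  then obtain w where w: "e w = \<zeta>0" "exp (- 2 * pi * Im w) = cmod \<zeta>0" "\<bar>Re w\<bar> \<le> 1/2" using surj by blast
  have "Im w = y0" using w(2) z0 by (simp add: \<rho>_def)
  then have "w = Complex (Re w) y0" by (simp add: complex_eq_iff)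
  ultimately show ?thesis using gH[of z] gH[of w] z y0 w \<open>Im w = y0\<close> by (intro exI[of _ "Re w"]) simp
qed

text \<open>Up to height \<open>k\<close> the pointwise bound is already of order
  \<open>k powr (3/2)\<close>, with \<open>448 = 2 * 224\<close>. Above it
  \<open>y ^ k * exp (- 4 * pi * y)\<close> is decreasing, so \<open>cusp_decay\<close> leads back
  to a point at height \<open>k\<close>.\<close>

lemma cusp_density_bound_uniform:
  assumes g: "g \<in> cusp_forms k" and k: "k \<ge> 2" and z: "z \<in> fund_domain"
  shows "cusp_density k g z \<le> ennreal (448 * real k powr (3/2)) * cusp_norm k g"
proof -
  have k1: "real k \<ge> 2" using k by simp
  have kp: "real k powr (3/2) = k * sqrt k"
    using k1 powr_add[of "real k" 1 "1/2"] by (simp add: powr_half_sqrt)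
  have low: "cusp_density k g z \<le> ennreal (448 * real k powr (3/2)) * cusp_norm k g"
    if z: "z \<in> fund_domain" and le: "Im z \<le> k" for z
  proof -
    have "Im z / sqrt k \<le> k / sqrt k" using le k1 by (intro divide_right_mono) auto
    also have "\<dots> = sqrt k" by (simp add: real_div_sqrt)
    finally have "1 + Im z / sqrt k \<le> 2 * sqrt k" using k1 real_sqrt_ge_1_iff[of "real k"] by linarith
    then have "224 * real k * (1 + Im z / sqrt k) \<le> 224 * real k * (2 * sqrt k)" by (intro mult_left_mono) auto
    then have "ennreal (224 * real k * (1 + Im z / sqrt k)) * cusp_norm k g \<le> ennreal (448 * real k powr (3/2)) * cusp_norm k g"
      unfolding kp by (intro mult_right_mono ennreal_leI) auto
    with cusp_density_bound[OF g k z] show ?thesis by (rule order_trans)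
  qed
  show ?thesis
  proof (cases "Im z \<le> k")
    case True then show ?thesis using low z by blast
  next
    case False
    define y where "y = Im z"
    have y: "y > k" using False by (simp add: y_def)
    obtain x where x: "\<bar>x\<bar> \<le> 1/2" "cmod (g z) * exp (2 * pi * y) \<le> cmod (g (Complex x k)) * exp (2 * pi * k)"
      using cusp_decay[OF g, of "real k" z] k1 y by (auto simp: y_def)
    have D: "Complex x k \<in> fund_domain"
    proof -
      have "1 \<le> (real k)\<^sup>2" using k1 one_le_power[of "real k" 2] by simp
      then have "1 \<le> x\<^sup>2 + (real k)\<^sup>2" using zero_le_power2[of x] by linarith
      then show ?thesis using x k1 by (simp add: fund_domain_def upper_half_plane_def cmod_def)
    qed
    have yk: "y ^ k \<le> real k ^ k * exp (4 * pi * (y - k))"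
    proof -
      have "y / k \<le> exp (y / k - 1)" using exp_ge_add_one_self[of "y / k - 1"] by simp
      then have "(y / k) ^ k \<le> exp (y / k - 1) ^ k" using y k1 by (intro power_mono) auto
      also have "\<dots> = exp (k * (y / k - 1))" by (simp add: exp_of_nat_mult)
      also have "k * (y / k - 1) = y - k" using k1 by (simp add: field_simps)
      also have "exp (y - k) \<le> exp (4 * pi * (y - k))"
        using y pi_gt3 mult_right_mono[of 1 "4 * pi" "y - k"] by simp
      finally have "y ^ k / real k ^ k \<le> exp (4 * pi * (y - k))" by (simp add: power_divide)
      then show ?thesis using k1 by (simp add: divide_le_eq mult.commute)
    qed
    have "cmod (g z) \<le> cmod (g (Complex x k)) * exp (2 * pi * k) / exp (2 * pi * y)"
      using x(2) by (simp add: field_simps)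
    also have "\<dots> = cmod (g (Complex x k)) * exp (- 2 * pi * (y - k))"
      by (simp add: algebra_simps exp_diff)
    finally have "(cmod (g z))\<^sup>2 \<le> (cmod (g (Complex x k)) * exp (- 2 * pi * (y - k)))\<^sup>2" by (intro power_mono) auto
    also have "\<dots> = (cmod (g (Complex x k)))\<^sup>2 * exp (- 4 * pi * (y - k))"
      by (simp add: power_mult_distrib flip: exp_double)
    finally have "(cmod (g z))\<^sup>2 * y ^ k \<le> ((cmod (g (Complex x k)))\<^sup>2 * exp (- 4 * pi * (y - k))) * (real k ^ k * exp (4 * pi * (y - k)))"
      using yk y k1 by (intro mult_mono) auto
    also have "\<dots> = (cmod (g (Complex x k)))\<^sup>2 * real k ^ k * (exp (- 4 * pi * (y - k)) * exp (4 * pi * (y - k)))" by simp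
    also have "exp (- 4 * pi * (y - k)) * exp (4 * pi * (y - k)) = 1" by (simp flip: exp_add)
    finally have "cusp_density k g z \<le> cusp_density k g (Complex x k)"
      by (simp add: cusp_density_def y_def ennreal_leI)
    also have "\<dots> \<le> ennreal (448 * real k powr (3/2)) * cusp_norm k g" using D by (intro low) auto
    finally show ?thesis .
  qed
qed

section \<open>Eisenstein series and the dimension of the space of cusp forms\<close>

definition im_infinity :: "complex filter" where
  "im_infinity = filtercomap Im at_top"

lemma eventually_im_infinity: "eventually P im_infinity \<longleftrightarrow> (\<exists>Y. \<forall>z. Im z \<ge> Y \<longrightarrow> P z)"
  unfolding im_infinity_def by (subst eventually_filtercomap_at_top_linorder) auto

text \<open>\<open>l\<close> is the value at the cusp. A limit in place of a q-expansion makes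
  products and differences immediate; the expansion is recovered only for
  \<open>l = 0\<close>.\<close>

definition modular_form :: "nat \<Rightarrow> complex \<Rightarrow> (complex \<Rightarrow> complex) \<Rightarrow> bool" where
  "modular_form k l f \<longleftrightarrow>
     f holomorphic_on upper_half_plane \<and>
     (\<forall>z. z \<notin> upper_half_plane \<longrightarrow> f z = 0) \<and>
     (\<forall>a b c d :: int. a * d - b * c = 1 \<longrightarrow>
        (\<forall>z \<in> upper_half_plane.
           f ((of_int a * z + of_int b) / (of_int c * z + of_int d)) = (of_int c * z + of_int d) ^ k * f z)) \<and>
     (f \<longlongrightarrow> l) im_infinity"

lemma modular_form_mult:
  "modular_form k l f \<Longrightarrow> modular_form k' l' g \<Longrightarrow> modular_form (k + k') (l * l') (\<lambda>z. f z * g z)"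
  unfolding modular_form_def
  by (auto intro!: holomorphic_intros tendsto_intros simp: power_add)

lemma modular_form_power:
  assumes "modular_form k l f" "n \<ge> 1"
  shows "modular_form (k * n) (l ^ n) (\<lambda>z. f z ^ n)"
  using assms(2)
proof (induction n rule: dec_induct)
  case base
  then show ?case using assms by simp
next
  case (step n)
  from modular_form_mult[OF assms(1) step.IH] show ?case by (simp add: algebra_simps)
qed

lemma modular_form_diff:
  "modular_form k l f \<Longrightarrow> modular_form k l' g \<Longrightarrow> modular_form k (l - l') (\<lambda>z. f z - g z)"
  unfolding modular_form_def
  by (auto intro!: holomorphic_intros tendsto_intros simp: algebra_simps)

lemma modular_form_cmult:
  "modular_form k l f \<Longrightarrow> modular_form k (c * l) (\<lambda>z. c * f z)"
  unfolding modular_form_def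
  by (auto intro!: holomorphic_intros tendsto_intros)

text \<open>By periodicity \<open>f\<close> is a function of \<open>q\<close> on the punctured disc.
  The limit 0 at the cusp makes the singularity removable with value 0, and the Taylor coefficients
  are those of the expansion.\<close>

lemma modular_form_0_imp_cusp:
  assumes f: "modular_form k 0 f"
  shows "f \<in> cusp_forms k"
proof -
  have hol: "f holomorphic_on upper_half_plane" and lim: "(f \<longlongrightarrow> 0) im_infinity"
    using f by (auto simp: modular_form_def)
  have M: "f ((of_int a * z + of_int b) / (of_int c * z + of_int d)) = (of_int c * z + of_int d) ^ k * f z"
    if "a * d - b * c = 1" "z \<in> upper_half_plane" for a b c d :: int and z
    using f that unfolding modular_form_def by blast
  have per: "f (z + of_int n) = f z" if "Im z > 0" for z n
    using M[of 1 1 n 0 z] that by (simp add: upper_half_plane_def)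
  define c where "c = 2 * of_real pi * \<i>"
  have c0: "c \<noteq> 0" by (simp add: c_def)
  have exp_per: "f z = f w" if "Im z > 0" "exp (c * z) = exp (c * w)" for z w
  proof -
    from that(2) obtain n :: int where "c * z = c * w + (of_int (2 * n) * pi) * \<i>"
      unfolding exp_eq by auto
    also have "\<dots> = c * (w + of_int n)" by (simp add: c_def algebra_simps)
    finally have zw: "z = w + of_int n" using c0 by simp
    then have "Im w > 0" using that by simp
    from per[OF this, of n] zw show ?thesis by simp
  qed
  define h where "h \<zeta> = f (Ln \<zeta> / c)" for \<zeta>
  have imc: "Im (w / c) = - Re w / (2 * pi)" for w by (simp add: c_def Im_divide power2_eq_square field_simps)
  have hexp: "h (exp (c * z)) = f z" if "Im z > 0" for z
    unfolding h_def by (rule exp_per[symmetric, OF that]) (simp add: c0)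
  have imL: "Im (Ln \<zeta> / c) = - ln (cmod \<zeta>) / (2 * pi)" if "\<zeta> \<noteq> 0" for \<zeta>
    using that by (simp add: imc Re_Ln)
  have "h holomorphic_on ball 0 1 - {0}"
    unfolding holomorphic_on_open[OF open_delete[OF open_ball]]
  proof
    fix \<zeta>0 :: complex assume z0: "\<zeta>0 \<in> ball 0 1 - {0}"
    \<comment> \<open>A branch of the logarithm centred at \<open>\<zeta>0\<close>, because the
      principal branch jumps across the negative axis. By periodicity \<open>f\<close> takes the
      same value on both branches.\<close>
    define \<Lambda> where "\<Lambda> \<zeta> = (Ln (\<zeta> / \<zeta>0) + Ln \<zeta>0) / c" for \<zeta>
    define U where "U = ball 0 1 \<inter> ball \<zeta>0 (cmod \<zeta>0)"
    have U: "open U" "\<zeta>0 \<in> U" using z0 by (auto simp: U_def)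
    have Unz: "\<zeta> \<noteq> 0" "\<zeta> / \<zeta>0 \<notin> \<real>\<^sub>\<le>\<^sub>0" "cmod \<zeta> < 1" if "\<zeta> \<in> U" for \<zeta>
    proof -
      show "cmod \<zeta> < 1" "\<zeta> \<noteq> 0" using that by (auto simp: U_def)
      have "cmod (1 - \<zeta> / \<zeta>0) = cmod (\<zeta>0 - \<zeta>) / cmod \<zeta>0" using z0 by (simp add: norm_divide[symmetric] diff_divide_distrib)
      also have "\<dots> < 1" using that z0 by (simp add: U_def dist_norm divide_less_eq_1)
      finally have "Re (1 - \<zeta> / \<zeta>0) < 1" using complex_Re_le_cmod[of "1 - \<zeta> / \<zeta>0"] by linarith
      then have "Re (\<zeta> / \<zeta>0) > 0" by simp
      then show "\<zeta> / \<zeta>0 \<notin> \<real>\<^sub>\<le>\<^sub>0" by (auto simp: complex_nonpos_Reals_iff)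
    qed
    have expL: "exp (c * \<Lambda> \<zeta>) = \<zeta>" if "\<zeta> \<in> U" for \<zeta>
      using Unz[OF that] z0 c0 by (simp add: \<Lambda>_def exp_add)
    have im\<Lambda>: "Im (\<Lambda> \<zeta>) > 0" if "\<zeta> \<in> U" for \<zeta>
    proof -
      have "cmod (exp (c * \<Lambda> \<zeta>)) = exp (- 2 * pi * Im (\<Lambda> \<zeta>))" by (simp add: norm_exp_eq_Re c_def)
      then have "exp (- 2 * pi * Im (\<Lambda> \<zeta>)) < 1" using expL[OF that] Unz[OF that] by simp
      then show ?thesis by (simp add: zero_less_mult_iff)
    qed
    have "(\<lambda>\<zeta>. f (\<Lambda> \<zeta>)) holomorphic_on U"
    proof (rule holomorphic_on_compose_gen[OF _ hol, unfolded o_def])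
      show "\<Lambda> holomorphic_on U" unfolding \<Lambda>_def using Unz z0 c0 by (intro holomorphic_intros) auto
      show "\<Lambda> ` U \<subseteq> upper_half_plane" using im\<Lambda> by (auto simp: upper_half_plane_def)
    qed
    then have "(\<lambda>\<zeta>. f (\<Lambda> \<zeta>)) field_differentiable (at \<zeta>0)"
      using U holomorphic_on_imp_differentiable_at by blast
    then obtain D where D: "((\<lambda>\<zeta>. f (\<Lambda> \<zeta>)) has_field_derivative D) (at \<zeta>0)" by (auto simp: field_differentiable_def)
    have "(h has_field_derivative D) (at \<zeta>0)"
    proof (rule has_field_derivative_transform_within_open[OF D U])
      fix \<zeta> assume "\<zeta> \<in> U"
      then show "f (\<Lambda> \<zeta>) = h \<zeta>" using hexp[OF im\<Lambda>] expL by metis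
    qed
    then show "\<exists>f'. (h has_field_derivative f') (at \<zeta>0)" by blast
  qed
  moreover have "h \<midarrow>0\<rightarrow> 0"
    unfolding LIM_eq
  proof (intro allI impI)
    fix \<epsilon> :: real assume "\<epsilon> > 0"
    then have "eventually (\<lambda>z. dist (f z) 0 < \<epsilon>) im_infinity" using lim by (auto simp: tendsto_iff)
    then obtain Y where Y: "\<And>z. Im z \<ge> Y \<Longrightarrow> dist (f z) 0 < \<epsilon>" by (auto simp: eventually_im_infinity)
    show "\<exists>s>0. \<forall>\<zeta>. \<zeta> \<noteq> 0 \<and> norm (\<zeta> - 0) < s \<longrightarrow> norm (h \<zeta> - 0) < \<epsilon>"
    proof (intro exI[of _ "exp (- 2 * pi * Y)"] conjI allI impI)
      fix \<zeta> :: complex assume "\<zeta> \<noteq> 0 \<and> norm (\<zeta> - 0) < exp (- 2 * pi * Y)"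
      then have "\<zeta> \<noteq> 0" "ln (cmod \<zeta>) < ln (exp (- 2 * pi * Y))" by (auto simp del: ln_exp)
      then have "Im (Ln \<zeta> / c) \<ge> Y" by (simp add: imL field_simps)
      from Y[OF this] show "norm (h \<zeta> - 0) < \<epsilon>" by (simp add: h_def)
    qed simp
  qed
  ultimately have "(\<lambda>y. if y = 0 then 0 else h y) holomorphic_on ball 0 1"
    by (intro removable_singularity) auto
  then have ps: "(\<lambda>n. (deriv ^^ n) (\<lambda>y. if y = 0 then 0 else h y) 0 / fact n * (\<zeta> - 0) ^ n) sums (if \<zeta> = 0 then 0 else h \<zeta>)" if "\<zeta> \<in> ball 0 1" for \<zeta>
    using that by (rule holomorphic_power_series)
  define q where "q n = (deriv ^^ n) (\<lambda>y. if y = 0 then 0 else h y) 0 / fact n" for n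
  have "q 0 = 0" by (simp add: q_def)
  moreover have "(\<lambda>n. q n * exp (2 * of_real pi * \<i> * of_nat n * z)) sums f z" if "z \<in> upper_half_plane" for z
  proof -
    have z: "Im z > 0" using that by (simp add: upper_half_plane_def)
    have "cmod (exp (c * z)) < 1" using z by (simp add: norm_exp_eq_Re c_def)
    from ps[of "exp (c * z)"] this have "(\<lambda>n. q n * exp (c * z) ^ n) sums f z"
      by (simp add: q_def hexp[OF z])
    then show ?thesis by (simp add: c_def mult_ac flip: exp_of_nat_mult)
  qed
  ultimately show ?thesis using f unfolding cusp_forms_def modular_form_def by blast
qed

section \<open>Eisenstein series\<close>

definition eis_index :: "(int \<times> int) set" where
  "eis_index = UNIV - {(0, 0)}"

definition recip_sq :: "int \<Rightarrow> real" where
  "recip_sq n = 1 / (1 + (real_of_int n)\<^sup>2)"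

lemma recip_sq_pos: "recip_sq n > 0"
  unfolding recip_sq_def by (simp add: add_pos_nonneg)

lemma recip_sq_summable: "recip_sq summable_on UNIV"
proof -
  have s: "summable (\<lambda>n. recip_sq (int n))"
  proof (rule summable_comparison_test')
    show "summable (\<lambda>n. inverse ((real n)\<^sup>2))" by (rule inverse_power_summable) simp
    show "norm (recip_sq (int n)) \<le> inverse ((real n)\<^sup>2)" if "n \<ge> 1" for n
      using that by (simp add: recip_sq_def field_simps add_pos_nonneg)
  qed
  have a: "(recip_sq \<circ> int) summable_on UNIV"
    using s recip_sq_pos by (intro norm_summable_imp_summable_on) (simp add: o_def abs_of_pos)
  have b: "(recip_sq \<circ> (\<lambda>n. - int n)) summable_on UNIV"
    using a by (simp add: o_def recip_sq_def)
  have "recip_sq summable_on (range int \<union> range (\<lambda>n. - int n))"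
    using a b by (intro summable_on_union) (auto simp: summable_on_reindex inj_on_def)
  also have "range int \<union> range (\<lambda>n. - int n) = UNIV"
  proof -
    have "x \<in> range int \<union> range (\<lambda>n. - int n)" for x :: int
    proof (cases "x \<ge> 0")
      case True
      then have "x = int (nat x)" by simp
      then show ?thesis by blast
    next
      case False
      then have "x = - int (nat (- x))" by simp
      then show ?thesis by blast
    qed
    then show ?thesis by blast
  qed
  finally show ?thesis .
qed

text \<open>A product, so that summability over pairs of integers reduces to one variable.\<close>

definition eis_majorant :: "int \<times> int \<Rightarrow> real" where
  "eis_majorant p = recip_sq (fst p) * recip_sq (snd p)"

lemma eis_majorant_pos: "eis_majorant p > 0"
  by (simp add: eis_majorant_def recip_sq_pos)

lemma eis_majorant_summable: "eis_majorant summable_on A"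
proof -
  have "eis_majorant summable_on (UNIV \<times> UNIV)"
  proof (rule summable_on_SigmaI[where g="\<lambda>c. recip_sq c * infsum recip_sq UNIV"])
    fix c :: int
    show "((\<lambda>d. eis_majorant (c, d)) has_sum recip_sq c * infsum recip_sq UNIV) UNIV"
      unfolding eis_majorant_def using recip_sq_summable by (auto intro!: has_sum_cmult_right has_sum_infsum)
    show "(\<lambda>c. recip_sq c * infsum recip_sq UNIV) summable_on UNIV"
      using recip_sq_summable by (rule summable_on_cmult_left)
  qed (simp add: less_imp_le[OF eis_majorant_pos])
  then show ?thesis by (rule summable_on_subset_banach) auto
qed

definition eis_const :: "complex \<Rightarrow> real" where
  "eis_const z = 1 / Im z + (1 + cmod z / Im z)"

lemma eis_const_pos: "Im z > 0 \<Longrightarrow> eis_const z > 0"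
  by (simp add: eis_const_def add_pos_nonneg)

text \<open>With \<open>s\<close> the sum of squares, \<open>1 + c\<^sup>2\<close> and
  \<open>1 + d\<^sup>2\<close> are at most \<open>1 + s\<close>, hence at most
  \<open>2 * s\<close>.\<close>

lemma sum_sq_le:
  assumes "(c, d) \<in> eis_index"
  shows "1 \<le> (real_of_int c)\<^sup>2 + (real_of_int d)\<^sup>2"
    and "1 / ((real_of_int c)\<^sup>2 + (real_of_int d)\<^sup>2)\<^sup>2 \<le> 4 * eis_majorant (c, d)"
proof -
  define s where "s = (real_of_int c)\<^sup>2 + (real_of_int d)\<^sup>2"
  have "c\<^sup>2 + d\<^sup>2 > 0" using assms by (auto simp: eis_index_def sum_power2_gt_zero_iff)
  then have "1 \<le> c\<^sup>2 + d\<^sup>2" by linarith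
  then have "real_of_int 1 \<le> real_of_int (c\<^sup>2 + d\<^sup>2)" by (simp only: of_int_le_iff)
  then show s: "1 \<le> (real_of_int c)\<^sup>2 + (real_of_int d)\<^sup>2" by simp
  have "(1 + (real_of_int c)\<^sup>2) * (1 + (real_of_int d)\<^sup>2) \<le> (1 + s) * (1 + s)"
    unfolding s_def by (intro mult_mono) auto
  also have "\<dots> \<le> (2 * s) * (2 * s)" using s unfolding s_def[symmetric] by (intro mult_mono) auto
  finally have le: "(1 + (real_of_int c)\<^sup>2) * (1 + (real_of_int d)\<^sup>2) \<le> 4 * s\<^sup>2" by (simp add: power2_eq_square)
  have pos: "0 < (1 + (real_of_int c)\<^sup>2) * (1 + (real_of_int d)\<^sup>2)" by (simp add: add_pos_nonneg)
  have s0: "s\<^sup>2 > 0" using s unfolding s_def[symmetric] by simp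
  have "1 / s\<^sup>2 \<le> 4 / ((1 + (real_of_int c)\<^sup>2) * (1 + (real_of_int d)\<^sup>2))"
    using le pos s0 by (simp add: divide_le_eq le_divide_eq field_simps)
  then show "1 / ((real_of_int c)\<^sup>2 + (real_of_int d)\<^sup>2)\<^sup>2 \<le> 4 * eis_majorant (c, d)"
    by (simp add: s_def eis_majorant_def recip_sq_def)
qed

text \<open>The imaginary part of \<open>c * z + d\<close> controls \<open>c\<close>; subtracting
  \<open>c * z\<close> then controls \<open>d\<close>.\<close>

lemma eis_lower:
  assumes z: "Im z > 0"
  shows "sqrt ((real_of_int c)\<^sup>2 + (real_of_int d)\<^sup>2) \<le> eis_const z * cmod (of_int c * z + of_int d)"
proof -
  define w where "w = of_int c * z + of_int d"
  have "\<bar>Im w\<bar> = \<bar>real_of_int c\<bar> * Im z" using z by (simp add: w_def abs_mult)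
  then have "\<bar>real_of_int c\<bar> * Im z \<le> cmod w" using abs_Im_le_cmod[of w] by simp
  then have c: "\<bar>real_of_int c\<bar> \<le> cmod w / Im z" using z by (simp add: field_simps)
  have "of_int d = w - of_int c * z" by (simp add: w_def)
  then have "cmod (of_int d) \<le> cmod w + cmod (of_int c * z)" by (metis norm_triangle_ineq4)
  then have "\<bar>real_of_int d\<bar> \<le> cmod w + \<bar>real_of_int c\<bar> * cmod z" by (simp add: norm_mult)
  also have "\<dots> \<le> cmod w + cmod w / Im z * cmod z" using c by (intro add_left_mono mult_right_mono) auto
  finally have d: "\<bar>real_of_int d\<bar> \<le> cmod w * (1 + cmod z / Im z)" by (simp add: field_simps)
  have "sqrt ((real_of_int c)\<^sup>2 + (real_of_int d)\<^sup>2) \<le> \<bar>real_of_int c\<bar> + \<bar>real_of_int d\<bar>"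
    by (rule sqrt_sum_squares_le_sum_abs)
  also have "\<dots> \<le> cmod w / Im z + cmod w * (1 + cmod z / Im z)" using c d by linarith
  also have "\<dots> = eis_const z * cmod w" by (simp add: eis_const_def algebra_simps)
  finally show ?thesis by (simp add: w_def)
qed

definition eis_term :: "nat \<Rightarrow> complex \<Rightarrow> int \<times> int \<Rightarrow> complex" where
  "eis_term k z p = 1 / (of_int (fst p) * z + of_int (snd p)) ^ k"

lemma eis_term4_le:
  assumes z: "Im z > 0" and p: "p \<in> eis_index"
  shows "of_int (fst p) * z + of_int (snd p) \<noteq> 0"
    and "1 / cmod (of_int (fst p) * z + of_int (snd p)) \<le> eis_const z"
    and "(1 / cmod (of_int (fst p) * z + of_int (snd p))) ^ 4 \<le> eis_const z ^ 4 * (4 * eis_majorant p)"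
proof -
  obtain c d where pcd: "p = (c, d)" by (cases p)
  define w where "w = of_int c * z + of_int d"
  define s where "s = (real_of_int c)\<^sup>2 + (real_of_int d)\<^sup>2"
  define K where "K = eis_const z"
  have K: "K > 0" using eis_const_pos[OF z] by (simp add: K_def)
  have s1: "1 \<le> s" and s2: "1 / s\<^sup>2 \<le> 4 * eis_majorant (c, d)" using sum_sq_le[of c d] p by (auto simp: pcd s_def)
  have low: "sqrt s \<le> K * cmod w" using eis_lower[OF z, of c d] by (simp add: s_def w_def K_def)
  have sq1: "1 \<le> sqrt s" using s1 by simp
  have w0: "cmod w > 0"
  proof (rule ccontr)
    assume "\<not> cmod w > 0"
    then have "sqrt s \<le> 0" using low by simp
    then show False using sq1 by linarith
  qed
  then show "of_int (fst p) * z + of_int (snd p) \<noteq> 0" by (auto simp: pcd w_def)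
  have inv: "1 / cmod w \<le> K / sqrt s" using low w0 sq1 by (simp add: field_simps)
  also have "\<dots> \<le> K" using K sq1 by (simp add: divide_le_eq)
  finally show "1 / cmod (of_int (fst p) * z + of_int (snd p)) \<le> eis_const z" by (simp add: pcd w_def K_def)
  have "(1 / cmod w) ^ 4 \<le> (K / sqrt s) ^ 4" using inv w0 by (intro power_mono) auto
  also have "\<dots> = K ^ 4 * (1 / s\<^sup>2)"
  proof -
    have "sqrt s ^ 4 = (sqrt s ^ 2) ^ 2" by (simp flip: power_mult)
    also have "\<dots> = s\<^sup>2" using s1 by simp
    finally show ?thesis by (simp add: power_divide)
  qed
  also have "\<dots> \<le> K ^ 4 * (4 * eis_majorant (c, d))" using s2 K by (intro mult_left_mono) auto
  finally show "(1 / cmod (of_int (fst p) * z + of_int (snd p))) ^ 4 \<le> eis_const z ^ 4 * (4 * eis_majorant p)"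
    by (simp add: pcd w_def K_def)
qed

text \<open>Four powers are spent on summability, the others are bounded by powers of
  \<open>eis_const\<close>. The free bound \<open>K\<close> makes the majorant uniform on discs, as
  the Weierstrass test requires.\<close>

lemma eis_term_le:
  assumes z: "Im z > 0" and p: "p \<in> eis_index" and k: "k \<ge> 4" and K: "eis_const z \<le> K"
  shows "cmod (eis_term k z p) \<le> 4 * K ^ k * eis_majorant p"
proof -
  define i where "i = 1 / cmod (of_int (fst p) * z + of_int (snd p))"
  have i: "0 \<le> i" "i \<le> eis_const z" "i ^ 4 \<le> eis_const z ^ 4 * (4 * eis_majorant p)"
    using eis_term4_le[OF z p] by (auto simp: i_def)
  have "cmod (eis_term k z p) = i ^ k"
    by (simp add: eis_term_def i_def norm_divide norm_power power_one_over)
  also have "\<dots> = i ^ (k - 4) * i ^ 4" using k by (simp flip: power_add)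
  also have "\<dots> \<le> eis_const z ^ (k - 4) * (eis_const z ^ 4 * (4 * eis_majorant p))"
    using i by (intro mult_mono power_mono) auto
  also have "\<dots> = eis_const z ^ k * (4 * eis_majorant p)" using k by (simp flip: power_add mult.assoc)
  also have "\<dots> \<le> K ^ k * (4 * eis_majorant p)"
    using K eis_const_pos[OF z] eis_majorant_pos[of p] by (intro mult_right_mono power_mono) auto
  finally show ?thesis by (simp add: mult_ac)
qed

lemma eis_term_abs_summable:
  assumes z: "Im z > 0" and k: "k \<ge> 4" and A: "A \<subseteq> eis_index"
  shows "(\<lambda>p. norm (eis_term k z p)) summable_on A"
proof (rule Infinite_Sum.abs_summable_on_comparison_test)
  show "(\<lambda>p. norm (4 * eis_const z ^ k * eis_majorant p)) summable_on A"
    using eis_majorant_summable[of A] eis_majorant_pos eis_const_pos[OF z]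
    by (simp add: abs_mult abs_of_pos summable_on_cmult_right)
  show "norm (eis_term k z p) \<le> norm (4 * eis_const z ^ k * eis_majorant p)" if "p \<in> A" for p
    using eis_term_le[OF z _ k order_refl, of p] that A eis_majorant_pos[of p] eis_const_pos[OF z]
    by (auto simp: abs_mult abs_of_pos)
qed

text \<open>All nonzero pairs are summed, not only the coprime ones; \<open>E_norm\<close> corrects
  this by dividing by the limit at the cusp.\<close>

definition Eis :: "nat \<Rightarrow> complex \<Rightarrow> complex" where
  "Eis k z = (if Im z > 0 then infsum (eis_term k z) eis_index else 0)"

lemma Eis_holomorphic:
  assumes k: "k \<ge> 4"
  shows "Eis k holomorphic_on upper_half_plane"
proof -
  have "(\<lambda>z. infsum (eis_term k z) eis_index) holomorphic_on ball z0 (Im z0 / 2)" if z0: "Im z0 > 0" for z0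
  proof -
    define r where "r = Im z0 / 2"
    define K where "K = 1 / r + (1 + (cmod z0 + r) / r)"
    have r: "r > 0" using z0 by (simp add: r_def)
    have imz: "Im z \<ge> r" if "z \<in> cball z0 r" for z
      using that abs_Im_le_cmod[of "z - z0"] by (auto simp: dist_norm norm_minus_commute r_def)
    have eK: "eis_const z \<le> K" if "z \<in> cball z0 r" for z
    proof -
      have "cmod z \<le> cmod z0 + r" using that norm_triangle_ineq2[of z z0] by (auto simp: dist_norm norm_minus_commute)
      then have "cmod z / Im z \<le> (cmod z0 + r) / r" using imz[OF that] r by (intro frac_le) auto
      moreover have "1 / Im z \<le> 1 / r" using imz[OF that] r by (intro frac_le) auto
      ultimately show ?thesis by (simp add: eis_const_def K_def)
    qed
    have ul: "uniform_limit (cball z0 r) (\<lambda>X z. \<Sum>p\<in>X. eis_term k z p) (\<lambda>z. infsum (eis_term k z) eis_index) (finite_subsets_at_top eis_index)"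
    proof (rule Weierstrass_m_test_general)
      show "cmod (eis_term k z p) \<le> 4 * K ^ k * eis_majorant p" if "p \<in> eis_index" "z \<in> cball z0 r" for p z
        using that imz[OF that(2)] r k eK by (intro eis_term_le) auto
      show "(\<lambda>p. 4 * K ^ k * eis_majorant p) summable_on eis_index"
        by (intro summable_on_cmult_right eis_majorant_summable)
    qed
    have hol: "(\<lambda>z. \<Sum>p\<in>X. eis_term k z p) holomorphic_on cball z0 r" if "X \<subseteq> eis_index" for X
      unfolding eis_term_def
    proof (intro holomorphic_intros)
      fix p z assume "p \<in> X" "z \<in> cball z0 r"
      then have "of_int (fst p) * z + of_int (snd p) \<noteq> 0"
        using eis_term4_le(1)[of z p] imz[of z] r that by auto
      then show "(of_int (fst p) * z + of_int (snd p)) ^ k \<noteq> 0" by simp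
    qed
    have ev: "\<forall>\<^sub>F X in finite_subsets_at_top eis_index. continuous_on (cball z0 r) (\<lambda>z. \<Sum>p\<in>X. eis_term k z p) \<and> (\<lambda>z. \<Sum>p\<in>X. eis_term k z p) holomorphic_on ball z0 r"
      by (rule eventually_finite_subsets_at_top_weakI)
        (auto intro!: holomorphic_on_imp_continuous_on hol holomorphic_on_subset[OF hol])
    show ?thesis
      using holomorphic_uniform_limit[OF ev ul] unfolding r_def[symmetric] by auto
  qed
  then have "(\<lambda>z. infsum (eis_term k z) eis_index) holomorphic_on (\<Union>z0\<in>upper_half_plane. ball z0 (Im z0 / 2))"
    by (intro holomorphic_on_UN_open) (auto simp: upper_half_plane_def)
  then have "(\<lambda>z. infsum (eis_term k z) eis_index) holomorphic_on upper_half_plane"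
    by (rule holomorphic_on_subset) (force simp: upper_half_plane_def)
  then show ?thesis
    by (rule holomorphic_transform) (auto simp: Eis_def upper_half_plane_def)
qed

lemma moebius_Im:
  fixes a b c d :: int
  assumes det: "a * d - b * c = 1" and z: "Im z > 0"
  shows "of_int c * z + of_int d \<noteq> 0"
    and "Im ((of_int a * z + of_int b) / (of_int c * z + of_int d)) > 0"
proof -
  have "(c, d) \<in> eis_index" using det by (auto simp: eis_index_def)
  from eis_term4_le(1)[OF z this] show nz: "of_int c * z + of_int d \<noteq> 0" by simp
  define w where "w = of_int c * z + of_int d"
  have det': "real_of_int a * real_of_int d - real_of_int b * real_of_int c = 1"
    using det by (metis of_int_1 of_int_diff of_int_mult)
  have "Im ((of_int a * z + of_int b) / w) = Im ((of_int a * z + of_int b) * cnj w) / (cmod w)\<^sup>2"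
    by (subst complex_div_cnj) (simp only: Im_divide_of_real flip: of_real_power)
  also have "Im ((of_int a * z + of_int b) * cnj w) = (real_of_int a * real_of_int d - real_of_int b * real_of_int c) * Im z"
    by (simp add: w_def algebra_simps)
  finally have "Im ((of_int a * z + of_int b) / w) = Im z / (cmod w)\<^sup>2" by (simp add: det')
  then show "Im ((of_int a * z + of_int b) / (of_int c * z + of_int d)) > 0"
    using nz z by (simp add: w_def)
qed

text \<open>The matrix acts on index pairs from the right by \<open>\<tau>\<close>, a bijection
  whose inverse comes from the adjugate matrix. The denominators change by the factor
  \<open>c * z + d\<close>.\<close>

lemma Eis_modular:
  fixes a b c d :: int
  assumes det: "a * d - b * c = 1" and z: "Im z > 0"
  shows "Eis k ((of_int a * z + of_int b) / (of_int c * z + of_int d)) = (of_int c * z + of_int d) ^ k * Eis k z"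
proof -
  define j where "j = of_int c * z + of_int d"
  define w where "w = (of_int a * z + of_int b) / j"
  have j: "j \<noteq> 0" and w: "Im w > 0" using moebius_Im[OF det z] by (auto simp: j_def w_def)
  define \<tau> where "\<tau> p = (fst p * a + snd p * c, fst p * b + snd p * d)" for p :: "int \<times> int"
  define \<tau>' where "\<tau>' p = (fst p * d - snd p * c, snd p * a - fst p * b)" for p :: "int \<times> int"
  have inv: "\<tau> (\<tau>' p) = p" "\<tau>' (\<tau> p) = p" for p
  proof -
    obtain m n where p: "p = (m, n)" by (cases p)
    have "m * (a * d - b * c) = m" "n * (a * d - b * c) = n" using det by simp_all
    then show "\<tau> (\<tau>' p) = p" "\<tau>' (\<tau> p) = p" by (simp_all add: p \<tau>_def \<tau>'_def algebra_simps)
  qed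
  have t0: "\<tau> (0, 0) = (0, 0)" "\<tau>' (0, 0) = (0, 0)" by (simp_all add: \<tau>_def \<tau>'_def)
  have in1: "\<tau> p \<in> eis_index" and in2: "\<tau>' p \<in> eis_index" if "p \<in> eis_index" for p
    using that inv[of p] t0 by (auto simp: eis_index_def)
  have bij: "bij_betw \<tau> eis_index eis_index"
    by (rule bij_betw_byWitness[where f'=\<tau>']) (use inv in1 in2 in auto)
  have "eis_term k w p = j ^ k * eis_term k z (\<tau> p)" for p
  proof -
    have "of_int (fst p) * w + of_int (snd p) = (of_int (fst (\<tau> p)) * z + of_int (snd (\<tau> p))) / j"
      using j by (simp add: w_def \<tau>_def field_simps) (simp add: j_def algebra_simps)
    then show ?thesis by (simp add: eis_term_def power_divide)
  qed
  then have "infsum (eis_term k w) eis_index = infsum (\<lambda>p. j ^ k * eis_term k z (\<tau> p)) eis_index"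
    by (intro infsum_cong)
  also have "\<dots> = j ^ k * infsum (\<lambda>p. eis_term k z (\<tau> p)) eis_index" by (rule infsum_cmult_right')
  also have "infsum (\<lambda>p. eis_term k z (\<tau> p)) eis_index = infsum (eis_term k z) eis_index"
    by (rule infsum_reindex_bij_betw[OF bij])
  finally show ?thesis using w z by (simp add: Eis_def w_def j_def)
qed

text \<open>Terms with first index 0 do not depend on \<open>z\<close>, so the point
  \<open>\<i>\<close> is an arbitrary choice. For even positive \<open>k\<close> the value is twice
  the Riemann zeta function at \<open>k\<close>.\<close>

definition eis_limit :: "nat \<Rightarrow> complex" where
  "eis_limit k = infsum (eis_term k \<i>) (eis_index \<inter> {p. fst p = 0})"

text \<open>For even \<open>k\<close> all terms are positive reals, and the pair
  \<open>(0, 1)\<close> alone contributes 1.\<close>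

lemma eis_limit_neq_0:
  assumes k: "k \<ge> 4" "even k"
  shows "eis_limit k \<noteq> 0"
proof -
  let ?A = "eis_index \<inter> {p. fst p = 0}"
  let ?g = "\<lambda>p::int \<times> int. 1 / (real_of_int (snd p)) ^ k"
  have eq: "eis_term k \<i> p = of_real (?g p)" if "p \<in> ?A" for p
    using that by (simp add: eis_term_def)
  have s: "?g summable_on ?A"
  proof -
    have "(\<lambda>p. norm (eis_term k \<i> p)) summable_on ?A" using k by (intro eis_term_abs_summable) auto
    also have "?this \<longleftrightarrow> ?thesis"
      using k by (intro summable_on_cong) (simp add: eis_term_def norm_divide norm_power power_even_abs)
    finally show ?thesis .
  qed
  have "eis_limit k = infsum (\<lambda>p. complex_of_real (?g p)) ?A"
    unfolding eis_limit_def by (rule infsum_cong) (rule eq)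
  also have "\<dots> = of_real (infsum ?g ?A)" 
    using s by (intro infsumI has_sum_of_real has_sum_infsum)
  finally have e: "eis_limit k = of_real (infsum ?g ?A)" .
  have "sum ?g {(0, 1)} \<le> infsum ?g ?A"
    using k by (intro finite_sum_le_infsum s) (auto simp: eis_index_def)
  then show ?thesis unfolding e by (simp add: of_real_eq_0_iff)
qed

text \<open>When the first index is nonzero, the modulus of \<open>c * z + d\<close> is at least
  \<open>Im z\<close>. One such power gives the decay, four give summability, and any others are at
  most 1, so the argument takes more than four powers.\<close>

lemma Eis_limit:
  assumes k: "k \<ge> 6"
  shows "(Eis k \<longlongrightarrow> eis_limit k) im_infinity"
proof -
  let ?A = "eis_index \<inter> {p. fst p = 0}" and ?P = "eis_index \<inter> {p. fst p \<noteq> 0}"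
  define C where "C = 4 ^ 4 * (4 * infsum eis_majorant ?P)"
  have C: "C \<ge> 0" unfolding C_def using eis_majorant_pos by (intro mult_nonneg_nonneg infsum_nonneg) (auto simp: less_imp_le)
  have main: "cmod (Eis k z - eis_limit k) \<le> C / Im z" if x: "\<bar>Re z\<bar> \<le> 1/2" and y: "Im z \<ge> 1" for z
  proof -
    have z: "Im z > 0" using y by simp
    have K: "eis_const z \<le> 4"
    proof -
      have "cmod z \<le> \<bar>Re z\<bar> + \<bar>Im z\<bar>" by (rule cmod_le)
      then have "cmod z / Im z \<le> (1/2 + Im z) / Im z" using x y by (intro divide_right_mono) auto
      also have "\<dots> \<le> 2" using y by (simp add: field_simps)
      finally have "cmod z / Im z \<le> 2" .
      moreover have "1 / Im z \<le> 1" using y by simp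
      ultimately show ?thesis unfolding eis_const_def by linarith
    qed
    have sA: "eis_term k z summable_on ?A"
      using k by (intro abs_summable_summable[OF eis_term_abs_summable[OF z]]) auto
    have aP: "(\<lambda>p. norm (eis_term k z p)) summable_on ?P"
      using k by (intro eis_term_abs_summable[OF z]) auto
    have "Eis k z = infsum (eis_term k z) (?A \<union> ?P)"
      using z by (auto simp: Eis_def intro!: arg_cong[where f="infsum _"])
    also have "\<dots> = infsum (eis_term k z) ?A + infsum (eis_term k z) ?P"
      using sA abs_summable_summable[OF aP] by (intro infsum_Un_disjoint) auto
    also have "infsum (eis_term k z) ?A = eis_limit k"
      unfolding eis_limit_def by (intro infsum_cong) (simp add: eis_term_def)
    finally have "cmod (Eis k z - eis_limit k) = cmod (infsum (eis_term k z) ?P)" by simp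
    also have "\<dots> \<le> infsum (\<lambda>p. cmod (eis_term k z p)) ?P" by (rule norm_infsum_bound[OF aP])
    also have "\<dots> \<le> infsum (\<lambda>p. (4 ^ 4 * 4 / Im z) * eis_majorant p) ?P"
    proof (rule infsum_mono[OF aP])
      show "(\<lambda>p. (4 ^ 4 * 4 / Im z) * eis_majorant p) summable_on ?P" by (intro summable_on_cmult_right eis_majorant_summable)
      fix p assume p: "p \<in> ?P"
      define i where "i = 1 / cmod (of_int (fst p) * z + of_int (snd p))"
      have i: "0 \<le> i" "i ^ 4 \<le> eis_const z ^ 4 * (4 * eis_majorant p)"
        using eis_term4_le[OF z, of p] p by (auto simp: i_def)
      have iy: "i \<le> 1 / Im z"
      proof -
        have "1 \<le> \<bar>fst p\<bar>" using p by auto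
        then have "real_of_int 1 \<le> real_of_int \<bar>fst p\<bar>" by (simp only: of_int_le_iff)
        then have "Im z \<le> \<bar>real_of_int (fst p)\<bar> * Im z" using z by simp
        also have "\<dots> = \<bar>Im (of_int (fst p) * z + of_int (snd p))\<bar>" using z by (simp add: abs_mult)
        also have "\<dots> \<le> cmod (of_int (fst p) * z + of_int (snd p))" by (rule abs_Im_le_cmod)
        finally show ?thesis unfolding i_def using z by (intro frac_le) auto
      qed
      also have "1 / Im z \<le> 1" using y by simp
      finally have i1: "i \<le> 1" .
      have "cmod (eis_term k z p) = i ^ k"
        by (simp add: eis_term_def i_def norm_divide norm_power power_one_over)
      also have "\<dots> = i ^ (k - 5) * (i * i ^ 4)" using k by (simp flip: power_Suc power_add)
      also have "\<dots> \<le> 1 * (1 / Im z * (eis_const z ^ 4 * (4 * eis_majorant p)))"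
        using i i1 iy z by (intro mult_mono power_le_one) auto
      also have "\<dots> \<le> 1 * (1 / Im z * (4 ^ 4 * (4 * eis_majorant p)))"
        using K eis_const_pos[OF z] z eis_majorant_pos[of p] by (intro mult_left_mono mult_right_mono power_mono) auto
      finally show "cmod (eis_term k z p) \<le> (4 ^ 4 * 4 / Im z) * eis_majorant p" by simp
    qed
    also have "\<dots> = C / Im z" by (subst infsum_cmult_right') (simp add: C_def)
    finally show ?thesis .
  qed
  \<comment> \<open>\<open>eis_const\<close> grows with the real part, so the estimate was made for
    real part at most 1/2 in modulus and is extended by periodicity.\<close>
  have all: "cmod (Eis k z - eis_limit k) \<le> C / Im z" if y: "Im z \<ge> 1" for z
  proof -
    define n where "n = round (Re z)"
    define w where "w = z - of_int n"
    have "Eis k ((of_int 1 * w + of_int n) / (of_int 0 * w + of_int 1)) = (of_int 0 * w + of_int 1) ^ k * Eis k w"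
      using y by (intro Eis_modular) (auto simp: w_def)
    then have "Eis k z = Eis k w" by (simp add: w_def)
    moreover have "\<bar>Re w\<bar> \<le> 1/2" using of_int_round_abs_le[of "Re z"] by (simp add: w_def n_def abs_minus_commute)
    ultimately show ?thesis using main[of w] y by (simp add: w_def)
  qed
  show ?thesis
  proof (rule tendstoI)
    fix e :: real assume e: "e > 0"
    show "\<forall>\<^sub>F z in im_infinity. dist (Eis k z) (eis_limit k) < e"
      unfolding eventually_im_infinity
    proof (intro exI allI impI)
      fix z assume z: "Im z \<ge> max 1 ((C + 1) / e)"
      then have z1: "Im z \<ge> 1" "C + 1 \<le> e * Im z" using e by (auto simp: field_simps)
      have "C / Im z < e" using z1 by (simp add: field_simps)
      then show "dist (Eis k z) (eis_limit k) < e" using all[OF z1(1)] by (simp add: dist_norm)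
    qed
  qed
qed

definition E_norm :: "nat \<Rightarrow> complex \<Rightarrow> complex" where
  "E_norm k z = (1 / eis_limit k) * Eis k z"

lemma modular_form_E_norm:
  assumes k: "k \<ge> 6" "even k"
  shows "modular_form k 1 (E_norm k)"
proof -
  have "modular_form k (eis_limit k) (Eis k)"
    unfolding modular_form_def
  proof (intro conjI allI impI ballI)
    show "Eis k holomorphic_on upper_half_plane" using k by (intro Eis_holomorphic) auto
    show "Eis k z = 0" if "z \<notin> upper_half_plane" for z using that by (simp add: Eis_def upper_half_plane_def)
    show "(Eis k \<longlongrightarrow> eis_limit k) im_infinity" using k by (intro Eis_limit)
  qed (auto simp: upper_half_plane_def intro: Eis_modular)
  from modular_form_cmult[OF this, of "1 / eis_limit k"] show ?thesis
    using eis_limit_neq_0[of k] k by (simp add: E_norm_def[abs_def])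
qed

text \<open>The point \<open>\<i>\<close> is fixed by inversion, and the automorphy factor there is
  \<open>\<i> ^ k = -1\<close>.\<close>

lemma Eis_at_i_zero:
  assumes "k mod 4 = 2"
  shows "Eis k \<i> = 0"
proof -
  have "Eis k ((of_int 0 * \<i> + of_int (-1)) / (of_int 1 * \<i> + of_int 0)) = (of_int 1 * \<i> + of_int 0) ^ k * Eis k \<i>"
    by (rule Eis_modular) auto
  moreover have "\<i> ^ k = (-1 :: complex)"
  proof -
    define m where "m = k div 4"
    have k: "k = 4 * m + 2" using assms unfolding m_def by presburger
    have "\<i> ^ k = (\<i> ^ 4) ^ m * \<i> ^ 2" unfolding k by (simp only: power_add power_mult)
    also have "\<i> ^ 4 = (1::complex)" by (simp add: power4_eq_xxxx)
    finally show ?thesis by simp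
  qed
  ultimately have "Eis k \<i> = - Eis k \<i>" by simp
  then show ?thesis by simp
qed

text \<open>The four shortest lattice vectors contribute 1 each because the weight is a multiple of
  4. All others have squared length at least 2, so their total decays exponentially in
  \<open>m\<close>.\<close>

lemma Eis_at_i_nonzero: "\<exists>m\<ge>2. Eis (4 * m) \<i> \<noteq> 0"
proof -
  define U where "U = {(1, 0), (-1, 0), (0, 1), (0, -1) :: int \<times> int}"
  define V where "V = eis_index - U"
  have UV: "U \<subseteq> eis_index" "finite U" by (auto simp: U_def eis_index_def)
  define M where "M = 4 * infsum eis_majorant V"
  obtain m0 :: nat where m0: "M < 2 ^ m0" using real_arch_pow[of 2 M] by auto
  define m where "m = m0 + 2"
  have "Eis (4 * m) \<i> \<noteq> 0"
  proof
    assume 0: "Eis (4 * m) \<i> = 0"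
    have as: "(\<lambda>p. norm (eis_term (4 * m) \<i> p)) summable_on V"
      by (rule eis_term_abs_summable) (auto simp: V_def m_def)
    have "Eis (4 * m) \<i> = infsum (eis_term (4 * m) \<i>) (U \<union> V)"
      using UV by (auto simp: Eis_def V_def intro!: arg_cong[where f="infsum _"])
    also have "\<dots> = sum (eis_term (4 * m) \<i>) U + infsum (eis_term (4 * m) \<i>) V"
      using UV as by (subst infsum_Un_disjoint) (auto simp: V_def intro: abs_summable_summable)
    also have "sum (eis_term (4 * m) \<i>) U = 4"
    proof -
      have "\<i> ^ (4 * m) = (1::complex)" by (simp add: power_mult power4_eq_xxxx)
      then show ?thesis by (simp add: U_def eis_term_def)
    qed
    finally have "infsum (eis_term (4 * m) \<i>) V = - 4" using 0 by (simp add: add_eq_0_iff)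
    then have "4 = cmod (infsum (eis_term (4 * m) \<i>) V)" by simp
    also have "\<dots> \<le> infsum (\<lambda>p. cmod (eis_term (4 * m) \<i> p)) V" by (rule norm_infsum_bound[OF as])
    also have "\<dots> \<le> infsum (\<lambda>p. (4 / 2 ^ (2 * m - 2)) * eis_majorant p) V"
    proof (rule infsum_mono[OF as])
      show "(\<lambda>p. (4 / 2 ^ (2 * m - 2)) * eis_majorant p) summable_on V" by (intro summable_on_cmult_right eis_majorant_summable)
      fix p assume p: "p \<in> V"
      obtain c d where pcd: "p = (c, d)" by (cases p)
      define s where "s = (real_of_int c)\<^sup>2 + (real_of_int d)\<^sup>2"
      have pe: "(c, d) \<in> eis_index" using p by (simp add: V_def pcd)
      have "c\<^sup>2 + d\<^sup>2 \<ge> 2"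
      proof (rule ccontr)
        assume "\<not> c\<^sup>2 + d\<^sup>2 \<ge> 2"
        then have lt: "c\<^sup>2 + d\<^sup>2 \<le> 1" by linarith
        have "c\<^sup>2 \<le> 1" "d\<^sup>2 \<le> 1" using lt zero_le_power2[of c] zero_le_power2[of d] by linarith+
        then have "\<bar>c\<bar> \<le> 1" "\<bar>d\<bar> \<le> 1" by (simp_all add: abs_square_le_1)
        then have "c \<in> {-1, 0, 1}" "d \<in> {-1, 0, 1}" by auto
        then show False using lt p pe by (auto simp: V_def U_def pcd eis_index_def)
      qed
      then have "real_of_int 2 \<le> real_of_int (c\<^sup>2 + d\<^sup>2)" by (simp only: of_int_le_iff)
      then have s2: "s \<ge> 2" by (simp add: s_def)
      define v where "v = cmod (of_int c * \<i> + of_int d)"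
      have "v ^ (4 * m) = (v\<^sup>2) ^ (2 * m)" by (simp flip: power_mult)
      also have "v\<^sup>2 = s" unfolding v_def cmod_power2 s_def by simp
      finally have "cmod (eis_term (4 * m) \<i> p) = 1 / s ^ (2 * m)"
        by (simp add: eis_term_def pcd norm_divide norm_power v_def)
      also have "s ^ (2 * m) = s ^ (2 * m - 2) * s\<^sup>2" by (simp add: m_def flip: power_add)
      also have "1 / (s ^ (2 * m - 2) * s\<^sup>2) = 1 / s ^ (2 * m - 2) * (1 / s\<^sup>2)" by simp
      also have "\<dots> \<le> 1 / 2 ^ (2 * m - 2) * (4 * eis_majorant (c, d))"
        using s2 sum_sq_le(2)[OF pe] by (intro mult_mono frac_le power_mono) (auto simp: s_def)
      finally show "cmod (eis_term (4 * m) \<i> p) \<le> (4 / 2 ^ (2 * m - 2)) * eis_majorant p" by (simp add: pcd)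
    qed
    also have "\<dots> = M / 2 ^ (2 * m - 2)" by (subst infsum_cmult_right') (simp add: M_def)
    also have "\<dots> < 2 ^ m0 / 2 ^ (2 * m - 2)" using m0 by (intro divide_strict_right_mono) auto
    also have "\<dots> \<le> 1"
    proof -
      have "(2::real) ^ m0 \<le> 2 ^ (2 * m - 2)" by (rule power_increasing) (auto simp: m_def)
      then show ?thesis by simp
    qed
    finally show False by simp
  qed
  then show ?thesis by (intro exI[of _ m]) (simp add: m_def)
qed

section \<open>Linear growth of the dimension\<close>

lemma E_norm_tendsto: "k \<ge> 6 \<Longrightarrow> even k \<Longrightarrow> (E_norm k \<longlongrightarrow> 1) im_infinity"
  using modular_form_E_norm[of k] by (simp add: modular_form_def)

lemma connected_uhp: "connected upper_half_plane"
  unfolding upper_half_plane_def by (intro convex_connected convex_halfspace_Im_gt)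

text \<open>Dividing a relation by the lowest power of \<open>\<Delta>\<close> that occurs and letting \<open>Im z\<close> tend to infinity
  isolates the corresponding coefficient.\<close>

lemma Delta_Eis_independent:
  fixes J W k :: nat and x :: "nat \<Rightarrow> complex"
  assumes \<Delta>: "modular_form W 0 \<Delta>" and nz: "Im z0 > 0" "\<Delta> z0 \<noteq> 0"
    and k: "even k" "even W" "J * W + 6 \<le> k"
    and rel: "\<And>z. (\<Sum>j\<in>{1..J}. x j * (\<Delta> z ^ j * E_norm (k - j * W) z)) = 0"
    and j: "j \<in> {1..J}"
  shows "x j = 0"
proof (rule ccontr)
  assume "x j \<noteq> 0"
  define j0 where "j0 = (LEAST i. i \<in> {1..J} \<and> x i \<noteq> 0)"
  have j0: "j0 \<in> {1..J}" "x j0 \<noteq> 0"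
    using LeastI[of "\<lambda>i. i \<in> {1..J} \<and> x i \<noteq> 0" j] \<open>x j \<noteq> 0\<close> j by (auto simp: j0_def)
  have low: "x i = 0" if "i \<in> {1..J}" "i < j0" for i
    using not_less_Least[of i "\<lambda>i. i \<in> {1..J} \<and> x i \<noteq> 0"] that by (auto simp: j0_def)
  define G where "G z = (\<Sum>i\<in>{j0..J}. x i * (\<Delta> z ^ (i - j0) * E_norm (k - i * W) z))" for z
  have W: "k - i * W \<ge> 6" "even (k - i * W)" if "i \<le> J" for i
  proof -
    have "i * W \<le> J * W" using that by simp
    then have "i * W + 6 \<le> k" using k(3) by linarith
    then show "k - i * W \<ge> 6" "even (k - i * W)" using k by auto
  qed
  have "(G \<longlongrightarrow> (\<Sum>i\<in>{j0..J}. x i * (0 ^ (i - j0) * 1))) im_infinity"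
    unfolding G_def
    using \<Delta> W by (intro tendsto_sum tendsto_mult tendsto_power tendsto_const E_norm_tendsto)
      (auto simp: modular_form_def)
  also have "(\<Sum>i\<in>{j0..J}. x i * (0 ^ (i - j0) * 1)) = (\<Sum>i\<in>{j0..J}. if i = j0 then x j0 else 0)"
    by (intro sum.cong) (auto simp: power_0_left)
  also have "\<dots> = x j0" using j0 by simp
  finally have "eventually (\<lambda>z. G z \<noteq> 0) im_infinity"
    using j0(2) by (rule tendsto_imp_eventually_ne)
  then obtain Y where Y: "\<And>z. Im z \<ge> Y \<Longrightarrow> G z \<noteq> 0" by (auto simp: eventually_im_infinity)
  \<comment> \<open>Where \<open>\<Delta>\<close> is nonzero the relation would force
    \<open>G = 0\<close>. So \<open>\<Delta>\<close> vanishes high up, hence everywhere by the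
    identity theorem, against the choice of \<open>z0\<close>.\<close>
  have D0: "\<Delta> z = 0" if "Im z \<ge> Y" for z
  proof (rule ccontr)
    assume nz: "\<Delta> z \<noteq> 0"
    have "(\<Sum>i\<in>{1..J}. x i * (\<Delta> z ^ i * E_norm (k - i * W) z)) = (\<Sum>i\<in>{j0..J}. x i * (\<Delta> z ^ i * E_norm (k - i * W) z))"
      using j0 low by (intro sum.mono_neutral_right) auto
    also have "\<dots> = (\<Sum>i\<in>{j0..J}. \<Delta> z ^ j0 * (x i * (\<Delta> z ^ (i - j0) * E_norm (k - i * W) z)))"
    proof (rule sum.cong)
      fix i assume "i \<in> {j0..J}"
      then have "\<Delta> z ^ i = \<Delta> z ^ j0 * \<Delta> z ^ (i - j0)" by (simp flip: power_add)
      then show "x i * (\<Delta> z ^ i * E_norm (k - i * W) z) = \<Delta> z ^ j0 * (x i * (\<Delta> z ^ (i - j0) * E_norm (k - i * W) z))"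
        by (simp only: mult_ac)
    qed simp
    also have "\<dots> = \<Delta> z ^ j0 * G z" by (simp add: G_def sum_distrib_left)
    finally have "\<Delta> z ^ j0 * G z = 0" using rel[of z] by simp
    then show False using nz Y[OF that] by simp
  qed
  have "\<Delta> z0 = 0"
  proof (rule analytic_continuation_open[where f=\<Delta> and g="\<lambda>_. 0" and s="{z. Im z > max Y 0}" and s'=upper_half_plane])
    show "open {z. Im z > max Y 0}" by (rule open_halfspace_Im_gt)
    show "open upper_half_plane" by (rule open_uhp)
    have "Complex 0 (max Y 0 + 1) \<in> {z. Im z > max Y 0}" by (simp add: max_def)
    then show "{z. Im z > max Y 0} \<noteq> {}" by blast
    show "\<Delta> holomorphic_on upper_half_plane" using \<Delta> by (simp add: modular_form_def)
  qed (use D0 nz connected_uhp in \<open>auto simp: upper_half_plane_def\<close>)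
  with nz show False by simp
qed

lemma sum_fun_apply: "finite A \<Longrightarrow> (\<Sum>j\<in>A. F j) z = (\<Sum>j\<in>A. F j z)"
  for F :: "'b \<Rightarrow> complex \<Rightarrow> complex"
  by (induction A rule: finite_induct) auto

text \<open>The products of powers of \<open>\<Delta>\<close> with Eisenstein series are independent
  cusp forms of weight \<open>k\<close>. The basis \<open>f\<close> provides a spanning set of at
  most \<open>cusp_dim k\<close> functions, which bounds the size of every independent set.\<close>

lemma cusp_dim_ge:
  fixes J W k :: nat
  assumes \<Delta>: "modular_form W 0 \<Delta>" and nz: "Im z0 > 0" "\<Delta> z0 \<noteq> 0"
    and k: "even k" "even W" "J * W + 6 \<le> k"
    and f: "orthonormal_basis k f"
  shows "J \<le> cusp_dim k"
proof -
  define \<phi> where "\<phi> j = (\<lambda>z. \<Delta> z ^ j * E_norm (k - j * W) z)" for j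
  have cusp: "\<phi> j \<in> cusp_forms k" if j: "j \<in> {1..J}" for j
  proof -
    have le: "j * W \<le> J * W" using j by simp
    then have jk: "j * W + 6 \<le> k" using k(3) by linarith
    then have "k - j * W \<ge> 6" "even (k - j * W)" using k by auto
    then have "modular_form (W * j + (k - j * W)) (0 ^ j * 1) (\<phi> j)"
      unfolding \<phi>_def using j by (intro modular_form_mult modular_form_power[OF \<Delta>] modular_form_E_norm) auto
    moreover have "W * j + (k - j * W) = k" using jk by (simp add: mult.commute)
    ultimately show ?thesis using j by (intro modular_form_0_imp_cusp) (simp add: power_0_left)
  qed
  have zero: "x j = 0" if "\<And>z. (\<Sum>j\<in>{1..J}. x j * \<phi> j z) = 0" "j \<in> {1..J}" for x j
    using Delta_Eis_independent[OF \<Delta> nz k, of x j] that by (simp add: \<phi>_def)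
  \<comment> \<open>Independence concerns the set of functions, so distinct indices must first be
    seen to give distinct functions; a coincidence would be a relation with coefficients 1 and
    -1.\<close>
  have inj: "inj_on \<phi> {1..J}"
  proof (rule inj_onI, rule ccontr)
    fix i j assume ij: "i \<in> {1..J}" "j \<in> {1..J}" "\<phi> i = \<phi> j" "i \<noteq> j"
    define x where "x l = (if l = i then 1 else if l = j then -1 else 0 :: complex)" for l
    have "(\<Sum>l\<in>{1..J}. x l * \<phi> l z) = 0" for z
    proof -
      have "(\<Sum>l\<in>{1..J}. x l * \<phi> l z) = (\<Sum>l\<in>{1..J}. (if l = i then \<phi> i z else 0) - (if l = j then \<phi> j z else 0))"
        using ij(4) by (intro sum.cong) (auto simp: x_def)
      also have "\<dots> = \<phi> i z - \<phi> j z" using ij(1,2) by (simp add: sum_subtractf)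
      also have "\<dots> = 0" using ij(3) by simp
      finally show ?thesis .
    qed
    then have "x i = 0" using ij(1) by (rule zero)
    then show False by (simp add: x_def)
  qed
  have indep: "cfun.independent (\<phi> ` {1..J})"
  proof (rule cfun.independent_if_scalars_zero)
    fix u v assume s: "(\<Sum>v\<in>\<phi> ` {1..J}. (\<lambda>z. u v * v z)) = 0" and v: "v \<in> \<phi> ` {1..J}"
    then obtain j where j: "j \<in> {1..J}" "v = \<phi> j" by auto
    have "(\<Sum>j\<in>{1..J}. u (\<phi> j) * \<phi> j z) = 0" for z
    proof -
      have "(\<Sum>v\<in>\<phi> ` {1..J}. (\<lambda>z. u v * v z)) z = 0" using s by simp
      then have "(\<Sum>v\<in>\<phi> ` {1..J}. u v * v z) = 0" by (simp add: sum_fun_apply)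
      then show ?thesis by (subst (asm) sum.reindex[OF inj]) simp
    qed
    from zero[OF this j(1)] show "u v = 0" by (simp add: j)
  qed simp
  have "\<phi> ` {1..J} \<subseteq> cfun.span (f ` {..<cusp_dim k})"
    using cusp f by (auto simp: orthonormal_basis_def)
  then have "card (\<phi> ` {1..J}) \<le> card (f ` {..<cusp_dim k})"
    using cfun.independent_span_bound[OF _ indep] by simp
  also have "\<dots> \<le> cusp_dim k" using card_image_le[of "{..<cusp_dim k}" f] by simp
  finally show ?thesis by (subst (asm) card_image[OF inj]) simp
qed

text \<open>Both powers have weight \<open>a * b\<close> and value 1 at the cusp, so their
  difference vanishes there. At \<open>\<i>\<close> the series of weight \<open>b\<close>, congruent
  to 2 modulo 4, is zero while the other is not. The weight is not explicit, which is harmless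
  because any linear growth rate is enough.\<close>

lemma exists_Delta:
  "\<exists>W \<Delta>. even W \<and> W \<ge> 1 \<and> modular_form W 0 \<Delta> \<and> \<Delta> \<i> \<noteq> 0"
proof -
  obtain m where m: "m \<ge> 2" "Eis (4 * m) \<i> \<noteq> 0" using Eis_at_i_nonzero by blast
  define a b where "a = 4 * m" and "b = 4 * m + 2"
  have ab: "a \<ge> 6" "b \<ge> 6" "even a" "even b" using m by (auto simp: a_def b_def)
  define \<Delta> where "\<Delta> = (\<lambda>z. E_norm a z ^ b - E_norm b z ^ a)"
  have "modular_form (a * b) (1 ^ b) (\<lambda>z. E_norm a z ^ b)"
    using ab by (intro modular_form_power modular_form_E_norm) auto
  moreover have "modular_form (b * a) (1 ^ a) (\<lambda>z. E_norm b z ^ a)"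
    using ab by (intro modular_form_power modular_form_E_norm) auto
  ultimately have "modular_form (a * b) (1 - 1) \<Delta>"
    unfolding \<Delta>_def by (intro modular_form_diff) (simp_all add: mult.commute)
  moreover have "\<Delta> \<i> \<noteq> 0"
  proof -
    have "b mod 4 = 2" by (simp add: b_def mod_add_eq mod_mult_left_eq[symmetric]) presburger
    then have "E_norm b \<i> = 0" by (simp add: E_norm_def Eis_at_i_zero)
    moreover have "E_norm a \<i> \<noteq> 0" using m eis_limit_neq_0[of a] ab by (simp add: E_norm_def a_def)
    ultimately show ?thesis using ab by (simp add: \<Delta>_def power_0_left)
  qed
  moreover have "even (a * b)" "a * b \<ge> 1" using ab by auto
  ultimately show ?thesis by (intro exI[of _ "a * b"] exI[of _ \<Delta>]) simp
qed

text \<open>For small \<open>k\<close> the assumed existence of a nonzero cusp form suffices; from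
  \<open>12 + 2 * W\<close> on there are \<open>(k - 6) div W\<close> independent forms. The
  constant \<open>c\<close> is chosen to serve both ranges.\<close>

lemma cusp_dim_linear:
  "\<exists>c>0. \<forall>k f. even k \<and> cusp_dim k \<ge> 1 \<and> orthonormal_basis k f \<longrightarrow> c * real k \<le> real (cusp_dim k)"
proof -
  obtain W \<Delta> where W: "even W" "W \<ge> 1" "modular_form W 0 \<Delta>" "\<Delta> \<i> \<noteq> 0" using exists_Delta by blast
  define c where "c = 1 / (12 + 2 * real W)"
  have "c * real k \<le> real (cusp_dim k)" if k: "even k" "cusp_dim k \<ge> 1" "orthonormal_basis k f" for k f
  proof (cases "k < 12 + 2 * W")
    case True
    then have "c * real k \<le> 1" by (simp add: c_def)
    then show ?thesis using k(2) by linarith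
  next
    case False
    define J where "J = (k - 6) div W"
    have "J * W \<le> k - 6" by (simp add: J_def)
    then have "J * W + 6 \<le> k" using False by linarith
    then have "J \<le> cusp_dim k" using W k by (intro cusp_dim_ge[of W \<Delta> \<i>]) auto
    moreover have "k - 6 < (J + 1) * W"
      using dividend_less_times_div[of W "k - 6"] W by (simp add: J_def algebra_simps)
    then have "real (k - 6) < real ((J + 1) * W)" by (simp only: of_nat_less_iff)
    then have "real k - 6 < (real J + 1) * W" using False by (simp add: of_nat_diff algebra_simps)
    then have "(real k - 6) / W < real J + 1" using W by (simp add: divide_less_eq)
    moreover have "c * real k \<le> (real k - 6) / W - 1"
    proof -
      have "real k \<ge> 12 + 2 * real W" using False by linarith
      then have "real k / 2 \<ge> 6 + real W" by simp
      then have "(real k / 2) / W \<le> (real k - 6 - W) / W" using W by (intro divide_right_mono) auto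
      also have "\<dots> = (real k - 6) / W - 1" using W by (simp add: diff_divide_distrib)
      finally have "real k / (2 * W) \<le> (real k - 6) / W - 1" by simp
      moreover have "c * real k \<le> real k / (2 * W)" unfolding c_def using W by (simp add: frac_le)
      ultimately show ?thesis by linarith
    qed
    ultimately show ?thesis by linarith
  qed
  moreover have "c > 0" by (simp add: c_def)
  ultimately show ?thesis by blast
qed

section \<open>The expected norm of a random cusp form\<close>

lemma orthonormal_basis_nn_integral:
  assumes f: "orthonormal_basis k f" and N: "N = cusp_dim k"
  shows "cusp_norm k (\<lambda>z. \<Sum>j<N. a j * f j z) = ennreal (norm_sq {..<N} a)"
proof -
  define I where "I i j z = indicat_real fund_domain z *\<^sub>R (f i z * cnj (f j z) * of_real (Im z ^ k))" for i j z
  have fm: "f j \<in> borel_measurable borel" if "j < N" for j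
    using f that N by (auto simp: orthonormal_basis_def intro: cusp_measurable)
  have Im: "I i j \<in> borel_measurable hyp_area" if "i < N" "j < N" for i j
  proof -
    note [measurable] = fm[OF that(1)] fm[OF that(2)]
    show ?thesis unfolding I_def by measurable
  qed
  have pet: "(\<integral>z. I i j z \<partial>hyp_area) = (if i = j then 1 else 0)" if "i < N" "j < N" for i j
    using f that N unfolding orthonormal_basis_def petersson_def set_lebesgue_integral_def I_def by auto
  \<comment> \<open>A non-integrable function has Bochner integral 0, so the value 1 on the diagonal
    already proves integrability. The mixed products are dominated by the diagonal ones.\<close>
  have Iii: "integrable hyp_area (I i i)" if "i < N" for i
    using pet[OF that that] not_integrable_integral_eq[of hyp_area "I i i"] by auto
  have nrm: "cmod (I i j z) = indicat_real fund_domain z * (cmod (f i z) * cmod (f j z) * Im z ^ k)" for i j z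
    using fund_domain_Im[of z] by (auto simp: I_def norm_mult norm_power indicator_def)
  have Iij: "integrable hyp_area (I i j)" if "i < N" "j < N" for i j
  proof (rule Bochner_Integration.integrable_bound)
    show "integrable hyp_area (\<lambda>z. cmod (I i i z) + cmod (I j j z))"
      using Iii that by (intro Bochner_Integration.integrable_add integrable_norm) auto
    show "AE z in hyp_area. norm (I i j z) \<le> norm (cmod (I i i z) + cmod (I j j z))"
    proof (rule AE_I2)
      fix z
      have "cmod (f i z) * cmod (f j z) \<le> cmod (f i z) * cmod (f i z) + cmod (f j z) * cmod (f j z)"
        using sum_squares_bound[of "cmod (f i z)" "cmod (f j z)"]
          mult_nonneg_nonneg[OF norm_ge_zero[of "f i z"] norm_ge_zero[of "f j z"]]
        unfolding power2_eq_square by linarith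
      then have "(cmod (f i z) * cmod (f j z)) * Im z ^ k \<le> (cmod (f i z) * cmod (f i z) + cmod (f j z) * cmod (f j z)) * Im z ^ k"
        if "z \<in> fund_domain" using fund_domain_Im[OF that] by (intro mult_right_mono) auto
      then show "norm (I i j z) \<le> norm (cmod (I i i z) + cmod (I j j z))"
        unfolding nrm using fund_domain_Im[of z] by (auto simp: indicator_def distrib_right)
    qed
  qed (use Im that in auto)
  define g where "g z = indicat_real fund_domain z * ((cmod (\<Sum>j<N. a j * f j z))\<^sup>2 * Im z ^ k)" for z
  have g0: "g z \<ge> 0" for z using fund_domain_Im[of z] by (auto simp: g_def indicator_def)
  have eq: "complex_of_real (g z) = (\<Sum>i<N. \<Sum>j<N. a i * cnj (a j) * I i j z)" for z
  proof -
    have "complex_of_real (g z) = indicat_real fund_domain z *\<^sub>R ((\<Sum>j<N. a j * f j z) * cnj (\<Sum>j<N. a j * f j z) * of_real (Im z ^ k))"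
      unfolding g_def of_real_mult complex_norm_square by (simp add: scaleR_conv_of_real)
    also have "(\<Sum>j<N. a j * f j z) * cnj (\<Sum>j<N. a j * f j z) = (\<Sum>i<N. \<Sum>j<N. (a i * f i z) * (cnj (a j) * cnj (f j z)))"
      by (simp add: sum_product)
    finally show ?thesis
      by (simp add: I_def sum_distrib_right sum_distrib_left scaleR_conv_of_real mult_ac)
  qed
  have int: "integrable hyp_area (\<lambda>z. complex_of_real (g z))"
    unfolding eq using Iij by (intro Bochner_Integration.integrable_sum integrable_mult_right) auto
  then have gint: "integrable hyp_area g" by (simp add: complex_of_real_integrable_eq)
  have "complex_of_real (\<integral>z. g z \<partial>hyp_area) = (\<integral>z. complex_of_real (g z) \<partial>hyp_area)"
    by (rule integral_complex_of_real[symmetric])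
  also have "\<dots> = (\<Sum>i<N. \<Sum>j<N. a i * cnj (a j) * (\<integral>z. I i j z \<partial>hyp_area))"
  proof -
    have "(\<integral>z. complex_of_real (g z) \<partial>hyp_area) = (\<Sum>i<N. \<integral>z. (\<Sum>j<N. a i * cnj (a j) * I i j z) \<partial>hyp_area)"
      unfolding eq using Iij
      by (intro Bochner_Integration.integral_sum Bochner_Integration.integrable_sum integrable_mult_right) auto
    also have "\<dots> = (\<Sum>i<N. \<Sum>j<N. \<integral>z. a i * cnj (a j) * I i j z \<partial>hyp_area)"
      using Iij by (intro sum.cong refl Bochner_Integration.integral_sum integrable_mult_right) auto
    finally show ?thesis by simp
  qed
  also have "\<dots> = (\<Sum>i<N. \<Sum>j<N. if j = i then a i * cnj (a i) else 0)"
    by (intro sum.cong) (auto simp: pet)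
  also have "\<dots> = (\<Sum>i<N. a i * cnj (a i))" by simp
  also have "\<dots> = of_real (norm_sq {..<N} a)"
    unfolding norm_sq_def of_real_sum by (simp only: complex_norm_square)
  finally have ig: "(\<integral>z. g z \<partial>hyp_area) = norm_sq {..<N} a" by (simp only: of_real_eq_iff)
  have "cusp_norm k (\<lambda>z. \<Sum>j<N. a j * f j z) = (\<integral>\<^sup>+z. ennreal (g z) \<partial>hyp_area)"
    unfolding cusp_norm_def cusp_density_def g_def by (intro nn_integral_cong) (auto simp: indicator_def)
  also have "\<dots> = ennreal (norm_sq {..<N} a)"
    unfolding ig[symmetric] using gint g0 by (intro nn_integral_eq_integral) auto
  finally show ?thesis .
qed

lemma orthonormal_basis_sum_mem:
  assumes f: "orthonormal_basis k f" and N: "N = cusp_dim k"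
  shows "(\<lambda>z. \<Sum>j<N. a j * f j z) \<in> cusp_forms k"
proof -
  have "(\<Sum>j<N. (\<lambda>z. a j * f j z)) \<in> cfun.span (f ` {..<N})"
    by (intro cfun.span_sum cfun.span_scale cfun.span_base) auto
  moreover have "(\<Sum>j<N. (\<lambda>z. a j * f j z)) = (\<lambda>z. \<Sum>j<N. a j * f j z)"
    by (rule ext) (simp add: sum_fun_apply)
  ultimately show ?thesis using f N by (simp add: orthonormal_basis_def)
qed

text \<open>Apply the pointwise bound to \<open>g = \<Sum>\<^sub>j cnj (f\<^sub>j z) f\<^sub>j\<close>, for which
  \<open>g z\<close> is the squared norm of \<open>g\<close>.\<close>

lemma orthonormal_basis_sum_bound:
  assumes f: "orthonormal_basis k f" and N: "N = cusp_dim k" and z: "z \<in> fund_domain" and C: "C \<ge> 0"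
    and bound: "\<And>g. g \<in> cusp_forms k \<Longrightarrow> cusp_density k g z \<le> ennreal C * cusp_norm k g"
  shows "(\<Sum>j<N. (cmod (f j z))\<^sup>2) * Im z ^ k \<le> C"
proof -
  define b where "b = (\<Sum>j<N. (cmod (f j z))\<^sup>2)"
  define a where "a j = cnj (f j z)" for j
  have b0: "b \<ge> 0" by (auto simp: b_def intro: sum_nonneg)
  have "(\<Sum>j<N. a j * f j z) = of_real b"
    unfolding b_def of_real_sum a_def complex_norm_square by (simp only: mult.commute)
  then have d: "cusp_density k (\<lambda>z. \<Sum>j<N. a j * f j z) z = ennreal (b\<^sup>2 * Im z ^ k)"
    using b0 by (simp add: cusp_density_def)
  have n: "cusp_norm k (\<lambda>z. \<Sum>j<N. a j * f j z) = ennreal b"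
    unfolding orthonormal_basis_nn_integral[OF f N] by (simp add: norm_sq_def b_def a_def)
  have "b\<^sup>2 * Im z ^ k \<le> C * b"
    using bound[OF orthonormal_basis_sum_mem[OF f N, of a]] b0 C unfolding d n
    by (simp add: ennreal_le_iff flip: ennreal_mult)
  then have *: "b * (b * Im z ^ k) \<le> b * C" by (simp add: power2_eq_square mult_ac)
  show ?thesis
  proof (cases "b = 0")
    case True then show ?thesis using C by (simp flip: b_def)
  next
    case False
    then have "b > 0" using b0 by simp
    with * show ?thesis unfolding b_def[symmetric] by (simp only: mult_le_cancel_left_pos)
  qed
qed

text \<open>Bessel's inequality for the cut-off forms \<open>\<phi>\<close> holds because an
  integral over \<open>A\<close> is at most the one over the fundamental domain, where the basis is
  orthonormal.\<close>

lemma expected_norm_estimate: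
  assumes f: "orthonormal_basis k f" and dim: "N = cusp_dim k" "N \<ge> 1" and p: "p \<ge> 2"
    and A: "A \<subseteq> fund_domain" "A \<in> sets borel" and S: "S > 0"
    and bound: "\<And>z. z \<in> A \<Longrightarrow> (\<Sum>j<N. (cmod (f j z))\<^sup>2) * Im z ^ k \<le> S"
  shows "\<bar>expected_norm k f p A - hyp_Lp_norm p A (\<lambda>z. csqrt (cov_diag k f z)) * sqrt (real N) *
      (Gamma (p / 2 + 1) * Gamma ((2 * real N - 1) / 2) / Gamma ((p + 2 * real N - 1) / 2)) powr (1 / p)\<bar>
      \<le> 6 * sqrt p * S powr (1 / 2 - 1 / p) / sqrt N"
proof -
  note [measurable] = A(2)
  define u where "u z = indicat_real A z * Im z powr (real k / 2)" for z
  define \<phi> where "\<phi> j z = (if j < N then of_real (u z) * f j z else 0)" for j z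
  have Apos: "Im z > 0" if "z \<in> A" for z using that A fund_domain_Im by blast
  have u2: "(u z)\<^sup>2 = indicat_real A z * Im z ^ k" for z
  proof (cases "z \<in> A")
    case True
    have "(Im z powr (real k / 2))\<^sup>2 = Im z powr (real k)"
      using Apos[OF True] by (simp add: power2_eq_square flip: powr_add)
    also have "\<dots> = Im z ^ k" using Apos[OF True] by (simp add: powr_realpow)
    finally show ?thesis using True by (simp add: u_def)
  qed (simp add: u_def)
  have hsum: "(\<Sum>j<N. a j * \<phi> j z) = of_real (indicat_real A z) * normalized_form k f a z" for a z
    by (simp add: \<phi>_def normalized_form_def random_form_def u_def sum_distrib_left dim(1) mult_ac)
  have nsq\<phi>: "norm_sq {..<N} (\<lambda>j. \<phi> j z) = indicat_real A z * ((\<Sum>j<N. (cmod (f j z))\<^sup>2) * Im z ^ k)" for z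
  proof -
    have "norm_sq {..<N} (\<lambda>j. \<phi> j z) = (\<Sum>j<N. (u z)\<^sup>2 * (cmod (f j z))\<^sup>2)"
      unfolding norm_sq_def by (intro sum.cong) (auto simp: \<phi>_def norm_mult power_mult_distrib)
    then show ?thesis by (simp add: u2 sum_distrib_left sum_distrib_right mult_ac)
  qed
  interpret random_lp hyp_area N \<phi> S p
  proof (intro random_lp.intro sigma_finite_hyp_area random_lp_axioms.intro dim(2) p S)
    fix j
    show "\<phi> j \<in> borel_measurable hyp_area"
    proof (cases "j < N")
      case True
      then have [measurable]: "f j \<in> borel_measurable borel"
        using f dim(1) by (auto simp: orthonormal_basis_def intro: cusp_measurable)
      show ?thesis unfolding \<phi>_def u_def using True by simp
    qed (simp add: \<phi>_def[abs_def])
  next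
    fix a
    have "(\<integral>\<^sup>+z. ennreal ((cmod (\<Sum>j<N. a j * \<phi> j z))\<^sup>2) \<partial>hyp_area) \<le> cusp_norm k (\<lambda>z. \<Sum>j<N. a j * f j z)"
      unfolding cusp_norm_def
    proof (rule nn_integral_mono)
      fix z
      have "(\<Sum>j<N. a j * \<phi> j z) = of_real (u z) * (\<Sum>j<N. a j * f j z)"
        by (simp add: \<phi>_def sum_distrib_left mult_ac)
      then have "(cmod (\<Sum>j<N. a j * \<phi> j z))\<^sup>2 = indicat_real A z * ((cmod (\<Sum>j<N. a j * f j z))\<^sup>2 * Im z ^ k)"
        by (simp add: norm_mult power_mult_distrib u2 mult_ac)
      then show "ennreal ((cmod (\<Sum>j<N. a j * \<phi> j z))\<^sup>2) \<le> cusp_density k (\<lambda>z. \<Sum>j<N. a j * f j z) z * indicator fund_domain z"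
        using A(1) by (auto simp: cusp_density_def indicator_def)
    qed
    also have "\<dots> = ennreal (norm_sq {..<N} a)" by (rule orthonormal_basis_nn_integral[OF f dim(1)])
    finally show "(\<integral>\<^sup>+z. ennreal ((cmod (\<Sum>j<N. a j * \<phi> j z))\<^sup>2) \<partial>hyp_area) \<le> ennreal (norm_sq {..<N} a)" .
  next
    fix z show "norm_sq {..<N} (\<lambda>j. \<phi> j z) \<le> S"
      unfolding nsq\<phi> using bound[of z] S by (auto simp: indicator_def)
  qed
  have FF: "hyp_Lp_norm p A (normalized_form k f a) = F a" for a
  proof -
    have "(LINT z:A|hyp_area. cmod (normalized_form k f a z) powr p) = Fp a"
      unfolding set_lebesgue_integral_def Fp_def h_def hsum
      by (intro Bochner_Integration.integral_cong) (auto simp: indicator_def)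
    then show ?thesis by (simp add: hyp_Lp_norm_def F_def)
  qed
  have cov: "cov_diag k f z = of_real (B z / N)" if z: "z \<in> A" for z
  proof -
    have nf: "normalized_form k f a z = (\<Sum>j<N. a j * \<phi> j z)" for a using hsum[of a z] z by simp
    have "cov_diag k f z = (\<integral>a. complex_of_real ((cmod (\<Sum>j<N. a j * \<phi> j z))\<^sup>2) \<partial>uniform_sphere N)"
      unfolding cov_diag_def cov_kernel_def nf dim(1)[symmetric] complex_norm_square ..
    also have "\<dots> = of_real (\<integral>a. (cmod (\<Sum>j<N. a j * \<phi> j z))\<^sup>2 \<partial>uniform_sphere N)"
      by (rule integral_complex_of_real)
    also have "(\<integral>a. (cmod (\<Sum>j<N. a j * \<phi> j z))\<^sup>2 \<partial>uniform_sphere N)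
      = enn2real (\<integral>\<^sup>+a. ennreal ((cmod (\<Sum>j<N. a j * \<phi> j z))\<^sup>2) \<partial>uniform_sphere N)"
      by (rule integral_eq_nn_integral) auto
    also have "\<dots> = B z / N"
      unfolding uniform_sphere_sum_sq[OF dim(2)] by (simp add: B_def)
    finally show ?thesis .
  qed
  \<comment> \<open>The normalisation \<open>1 / N\<close> of the covariance cancels the factor
    \<open>sqrt N\<close> of the main term.\<close>
  have TT: "hyp_Lp_norm p A (\<lambda>z. csqrt (cov_diag k f z)) * sqrt (real N) = T powr (1 / p)"
  proof -
    have "(LINT z:A|hyp_area. cmod (csqrt (cov_diag k f z)) powr p) = (\<integral>z. B z powr (p / 2) / N powr (p / 2) \<partial>hyp_area)"
      unfolding set_lebesgue_integral_def
    proof (rule Bochner_Integration.integral_cong)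
      fix z
      show "indicat_real A z *\<^sub>R cmod (csqrt (cov_diag k f z)) powr p = B z powr (p / 2) / N powr (p / 2)"
      proof (cases "z \<in> A")
        case True
        have "cmod (csqrt (cov_diag k f z)) = sqrt (B z / N)"
          unfolding cov[OF True] using B_nonneg[of z] by (simp add: csqrt_of_real_nonneg)
        then have "cmod (csqrt (cov_diag k f z)) powr p = (B z / N) powr (p / 2)"
          using B_nonneg[of z] by (simp add: powr_sqrt_eq del: real_sqrt_divide)
        then show ?thesis using True B_nonneg[of z] by (simp add: powr_divide)
      next
        case False
        then have "B z = 0" by (simp add: B_def nsq\<phi>)
        then show ?thesis using False by simp
      qed
    qed simp
    also have "\<dots> = T / N powr (p / 2)" by (simp add: T_def)
    finally have "hyp_Lp_norm p A (\<lambda>z. csqrt (cov_diag k f z)) = (T / N powr (p / 2)) powr (1 / p)"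
      by (simp add: hyp_Lp_norm_def)
    also have "\<dots> = T powr (1 / p) / sqrt N"
      using T_nonneg p dim(2) by (simp add: powr_divide powr_powr powr_half_sqrt)
    finally show ?thesis using dim(2) by simp
  qed
  have "expected_norm k f p A = (\<integral>a. F a \<partial>uniform_sphere N)"
    unfolding expected_norm_def FF dim(1)[symmetric] ..
  moreover have "(2 * real N - 1) / 2 = real N - 1 / 2" "(p + 2 * real N - 1) / 2 = p / 2 + real N - 1 / 2"
    by (simp_all add: field_simps)
  ultimately show ?thesis using expected_Lp_norm unfolding TT L_def by (simp only:)
qed

text \<open>Gives the size of the error for a kernel bound \<open>C * k powr x\<close> and a
  dimension of at least \<open>c * k\<close>. As \<open>C \<ge> 1\<close> and the exponent is at
  most 1, the constant does not depend on \<open>p\<close>.\<close>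

lemma scaled_powr_le:
  fixes C c x p :: real
  assumes C: "C \<ge> 1" and c: "c > 0" and k: "k \<ge> 1" and p: "p \<ge> 2" and N: "c * k \<le> N"
  shows "(C * k powr x) powr (1 / 2 - 1 / p) / sqrt N \<le> C / sqrt c * k powr (x * (1 / 2 - 1 / p) - 1 / 2)"
proof -
  have "1 / 2 - 1 / p \<ge> 0" using p by (simp add: field_simps)
  have "(C * k powr x) powr (1 / 2 - 1 / p) = C powr (1 / 2 - 1 / p) * k powr (x * (1 / 2 - 1 / p))"
    using C by (simp add: powr_mult powr_powr)
  also have "\<dots> \<le> C * k powr (x * (1 / 2 - 1 / p))"
  proof (rule mult_right_mono)
    have "1 / 2 - 1 / p \<le> 1" using p by (simp add: field_simps)
    then show "C powr (1 / 2 - 1 / p) \<le> C" using C powr_mono[of "1 / 2 - 1 / p" 1 C] by simp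
  qed simp
  finally have "(C * k powr x) powr (1 / 2 - 1 / p) / sqrt N \<le> C * k powr (x * (1 / 2 - 1 / p)) / sqrt (c * k)"
    using C c k N by (intro frac_le) auto
  also have "\<dots> = C / sqrt c * (k powr (x * (1 / 2 - 1 / p)) / k powr (1 / 2))"
    using k by (simp add: real_sqrt_mult powr_half_sqrt)
  also have "k powr (x * (1 / 2 - 1 / p)) / k powr (1 / 2) = k powr (x * (1 / 2 - 1 / p) - 1 / 2)"
    by (simp add: powr_diff)
  finally show ?thesis .
qed

theorem theorem4p1:
  shows "(\<forall>K. compact K \<and> K \<subseteq> fund_domain \<and> emeasure hyp_area K > 0 \<longrightarrow>
            (\<exists>C::real. \<forall>k f (p::real). even k \<and> k \<ge> 2 \<and> cusp_dim k \<ge> 1 \<and> orthonormal_basis k f \<and> p \<ge> 2 \<longrightarrow>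
               \<bar>expected_norm k f p K -
                 hyp_Lp_norm p K (\<lambda>z. csqrt (cov_diag k f z)) * sqrt (real (cusp_dim k)) *
                 (Gamma (p / 2 + 1) * Gamma ((2 * real (cusp_dim k) - 1) / 2)
                    / Gamma ((p + 2 * real (cusp_dim k) - 1) / 2)) powr (1 / p)\<bar>
                 \<le> C * (sqrt p / real k powr (1 / p)))) \<and>
         (\<exists>C::real. \<forall>k f (p::real). even k \<and> k \<ge> 2 \<and> cusp_dim k \<ge> 1 \<and> orthonormal_basis k f \<and> p \<ge> 2 \<longrightarrow>
               \<bar>expected_norm k f p fund_domain -
                 hyp_Lp_norm p fund_domain (\<lambda>z. csqrt (cov_diag k f z)) * sqrt (real (cusp_dim k)) *
                 (Gamma (p / 2 + 1) * Gamma ((2 * real (cusp_dim k) - 1) / 2)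
                    / Gamma ((p + 2 * real (cusp_dim k) - 1) / 2)) powr (1 / p)\<bar>
                 \<le> C * (real k powr (1 / 4 - 3 / (2 * p)) * sqrt p))"
proof -
  obtain c where c: "c > 0" and dim: "\<And>k f. even k \<Longrightarrow> cusp_dim k \<ge> 1 \<Longrightarrow> orthonormal_basis k f \<Longrightarrow> c * real k \<le> real (cusp_dim k)"
    using cusp_dim_linear by blast
  show ?thesis
  proof (intro conjI allI impI)
    fix K assume K: "compact K \<and> K \<subseteq> fund_domain \<and> emeasure hyp_area K > 0"
    \<comment> \<open>Heights are bounded on a compact set, so \<open>1 + y / sqrt k\<close> is at
      most a constant and the kernel is of order \<open>k\<close>; this is \<open>x = 1\<close> in
      \<open>scaled_powr_le\<close>.\<close>
    have "bounded (Im ` K)" using K by (intro compact_imp_bounded compact_continuous_image continuous_intros) auto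
    then obtain Y0 where "\<And>z. z \<in> K \<Longrightarrow> \<bar>Im z\<bar> \<le> Y0" by (auto simp: bounded_iff)
    then have Y: "Im z \<le> max 0 Y0" if "z \<in> K" for z using that by fastforce
    define Y where "Y = max 0 Y0"
    define C where "C = 224 * (1 + Y)"
    have C1: "C \<ge> 1" by (simp add: C_def Y_def)
    show "\<exists>C. \<forall>k f p. even k \<and> k \<ge> 2 \<and> cusp_dim k \<ge> 1 \<and> orthonormal_basis k f \<and> p \<ge> 2 \<longrightarrow>
        \<bar>expected_norm k f p K - hyp_Lp_norm p K (\<lambda>z. csqrt (cov_diag k f z)) * sqrt (real (cusp_dim k)) *
         (Gamma (p / 2 + 1) * Gamma ((2 * real (cusp_dim k) - 1) / 2) / Gamma ((p + 2 * real (cusp_dim k) - 1) / 2)) powr (1 / p)\<bar>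
        \<le> C * (sqrt p / real k powr (1 / p))"
    proof (intro exI[of _ "6 * (C / sqrt c)"] allI impI)
      fix k f and p :: real
      assume h: "even k \<and> k \<ge> 2 \<and> cusp_dim k \<ge> 1 \<and> orthonormal_basis k f \<and> p \<ge> 2"
      define N where "N = cusp_dim k"
      have k: "real k \<ge> 2" using h by simp
      have sum: "(\<Sum>j<N. (cmod (f j z))\<^sup>2) * Im z ^ k \<le> C * real k powr 1" if z: "z \<in> K" for z
      proof (rule orthonormal_basis_sum_bound[OF _ N_def])
        show "C * real k powr 1 \<ge> 0" using C1 by simp
        fix g assume g: "g \<in> cusp_forms k"
        have "cusp_density k g z \<le> ennreal (224 * real k * (1 + Im z / sqrt k)) * cusp_norm k g"
          using h z K by (intro cusp_density_bound[OF g]) auto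
        also have "\<dots> \<le> ennreal (C * real k powr 1) * cusp_norm k g"
        proof (intro mult_right_mono ennreal_leI)
          have "Im z / sqrt k \<le> Y / 1"
            using Y[OF z] k by (intro frac_le) (auto simp: Y_def)
          then have "224 * real k * (1 + Im z / sqrt k) \<le> 224 * real k * (1 + Y)" by (intro mult_left_mono) auto
          then show "224 * real k * (1 + Im z / sqrt k) \<le> C * real k powr 1" using k by (simp add: C_def mult_ac)
        qed simp
        finally show "cusp_density k g z \<le> ennreal (C * real k powr 1) * cusp_norm k g" .
      qed (use h z K in auto)
      have "\<bar>expected_norm k f p K - hyp_Lp_norm p K (\<lambda>z. csqrt (cov_diag k f z)) * sqrt (real N) *
         (Gamma (p / 2 + 1) * Gamma ((2 * real N - 1) / 2) / Gamma ((p + 2 * real N - 1) / 2)) powr (1 / p)\<bar>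
        \<le> 6 * sqrt p * (C * real k powr 1) powr (1 / 2 - 1 / p) / sqrt N"
        using h K C1 k sum by (intro expected_norm_estimate) (auto simp: N_def compact_imp_closed borel_closed)
      also have "\<dots> = 6 * sqrt p * ((C * real k powr 1) powr (1 / 2 - 1 / p) / sqrt N)" by simp
      also have "\<dots> \<le> 6 * sqrt p * (C / sqrt c * real k powr (1 * (1 / 2 - 1 / p) - 1 / 2))"
        using h k c C1 dim[of k f] by (intro mult_left_mono scaled_powr_le) (auto simp: N_def)
      also have "real k powr (1 * (1 / 2 - 1 / p) - 1 / 2) = 1 / real k powr (1 / p)"
        by (simp add: powr_minus_divide)
      finally show "\<bar>expected_norm k f p K - hyp_Lp_norm p K (\<lambda>z. csqrt (cov_diag k f z)) * sqrt (real (cusp_dim k)) *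
         (Gamma (p / 2 + 1) * Gamma ((2 * real (cusp_dim k) - 1) / 2) / Gamma ((p + 2 * real (cusp_dim k) - 1) / 2)) powr (1 / p)\<bar>
        \<le> 6 * (C / sqrt c) * (sqrt p / real k powr (1 / p))"
        by (simp add: N_def mult_ac)
    qed
  next
    show "\<exists>C. \<forall>k f p. even k \<and> k \<ge> 2 \<and> cusp_dim k \<ge> 1 \<and> orthonormal_basis k f \<and> p \<ge> 2 \<longrightarrow>
        \<bar>expected_norm k f p fund_domain - hyp_Lp_norm p fund_domain (\<lambda>z. csqrt (cov_diag k f z)) * sqrt (real (cusp_dim k)) *
         (Gamma (p / 2 + 1) * Gamma ((2 * real (cusp_dim k) - 1) / 2) / Gamma ((p + 2 * real (cusp_dim k) - 1) / 2)) powr (1 / p)\<bar>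
        \<le> C * (real k powr (1 / 4 - 3 / (2 * p)) * sqrt p)"
    \<comment> \<open>The 6 comes from \<open>expected_Lp_norm\<close>, the 448 from
      \<open>cusp_density_bound_uniform\<close>, and the root of \<open>c\<close> from the lower
      bound on the dimension; here \<open>x = 3/2\<close>.\<close>
    proof (intro exI[of _ "6 * (448 / sqrt c)"] allI impI)
      fix k f and p :: real
      assume h: "even k \<and> k \<ge> 2 \<and> cusp_dim k \<ge> 1 \<and> orthonormal_basis k f \<and> p \<ge> 2"
      define N where "N = cusp_dim k"
      have k: "real k \<ge> 2" using h by simp
      have sum: "(\<Sum>j<N. (cmod (f j z))\<^sup>2) * Im z ^ k \<le> 448 * real k powr (3 / 2)" if z: "z \<in> fund_domain" for z
        using h z by (intro orthonormal_basis_sum_bound[OF _ N_def] cusp_density_bound_uniform) auto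
      have "\<bar>expected_norm k f p fund_domain - hyp_Lp_norm p fund_domain (\<lambda>z. csqrt (cov_diag k f z)) * sqrt (real N) *
         (Gamma (p / 2 + 1) * Gamma ((2 * real N - 1) / 2) / Gamma ((p + 2 * real N - 1) / 2)) powr (1 / p)\<bar>
        \<le> 6 * sqrt p * (448 * real k powr (3 / 2)) powr (1 / 2 - 1 / p) / sqrt N"
        using h k sum by (intro expected_norm_estimate) (auto simp: N_def)
      also have "\<dots> = 6 * sqrt p * ((448 * real k powr (3 / 2)) powr (1 / 2 - 1 / p) / sqrt N)" by simp
      also have "\<dots> \<le> 6 * sqrt p * (448 / sqrt c * real k powr (3 / 2 * (1 / 2 - 1 / p) - 1 / 2))"
        using h k c dim[of k f] by (intro mult_left_mono scaled_powr_le) (auto simp: N_def)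
      also have "3 / 2 * (1 / 2 - 1 / p) - 1 / 2 = 1 / 4 - 3 / (2 * p)"
        by (simp add: algebra_simps)
      finally show "\<bar>expected_norm k f p fund_domain - hyp_Lp_norm p fund_domain (\<lambda>z. csqrt (cov_diag k f z)) * sqrt (real (cusp_dim k)) *
         (Gamma (p / 2 + 1) * Gamma ((2 * real (cusp_dim k) - 1) / 2) / Gamma ((p + 2 * real (cusp_dim k) - 1) / 2)) powr (1 / p)\<bar>
        \<le> 6 * (448 / sqrt c) * (real k powr (1 / 4 - 3 / (2 * p)) * sqrt p)"
        by (simp add: N_def mult_ac)
    qed
  qed
qed

end
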